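(* Let $A>0$ and $0<r<t<\infty$. There is a constant $C>0$, depending only on $d$, $A$ and $r$, such that if $f_k\in\mathcal{E}(A2^k)$ for each $k\in\mathbb{Z}$, then for every $k\in\mathbb{Z}$ and every $x\in\mathbb{R}^d$ $$\mathfrak{M}_{d/r,2^k}f_k(x)\le C\,\mathcal{M}_t^{k,d(1/r-1/t)}f_k(x).$$
   Context: Everything is on $\mathbb{R}^d$, and the Fourier transform is $\widehat{f}(\xi)=\int_{\mathbb{R}^d}f(x)e^{-2\pi i\langle x,\xi\rangle}dx$. For $\rho>0$, $\mathcal{E}(\rho)$ is the space of tempered distributions on $\mathbb{R}^d$ whose Fourier transforms are supported in $\{\xi:|\xi|\le 2\rho\}$ (such distributions are identified with smooth functions). For $k\in\mathbb{Z}$ and $\sigma>0$ the Peetre maximal operator is $$\mathfrak{M}_{\sigma,2^k}f(x):=\sup_{y\in\mathbb{R}^d}\frac{|f(x-y)|}{(1+2^k|y|)^\sigma}.$$ For a cube $Q$, $l(Q)$ denotes its side length. For $\epsilon\ge0$, $t>0$, $k\in\mathbb{Z}$, $$\mathcal{M}_t^{k,\epsilon}f(x):=\sup_{2^kl(Q)\le1,\,x\in Q}\Big(\frac{1}{|Q|}\int_Q|f(y)|^t\,dy\Big)^{1/t}+\sup_{2^kl(Q)>1,\,x\in Q}\big(2^kl(Q)\big)^{-\epsilon}\Big(\frac{1}{|Q|}\int_Q|f(y)|^t\,dy\Big)^{1/t},$$ where the suprema are over all cubes $Q$ (not only dyadic ones) containing $x$ and satisfying the indicated size condition. Both sides take values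 in $[0,\infty]$. *)

theory Defs
  imports "HOL-Analysis.Analysis"
begin

section \<open>Smooth functions and Schwartz functions\<close>

fun iterated_partial ::
  "'a::euclidean_space list \<Rightarrow> ('a \<Rightarrow> complex) \<Rightarrow> 'a \<Rightarrow> complex" where
  "iterated_partial [] f = f"
| "iterated_partial (b # bs) f = (\<lambda>x. frechet_derivative (iterated_partial bs f) (at x) b)"

text \<open>
  For a list \<open>bs\<close> of basis vectors, \<open>iterated_partial bs f\<close> is the partial derivative of \<open>f\<close>
  whose multi-index counts the occurrences of each basis vector in \<open>bs\<close>. Total
  differentiability of all of them entails their continuity, so the next definition is
  membership in \<open>C\<^sup>\<infinity>\<close>.
\<close>

definition smooth :: "('a::euclidean_space \<Rightarrow> complex) \<Rightarrow> bool" where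
  "smooth f \<longleftrightarrow> (\<forall>bs. set bs \<subseteq> Basis \<longrightarrow> iterated_partial bs f differentiable_on UNIV)"

definition schwartz_weight ::
  "nat \<Rightarrow> 'a::euclidean_space list \<Rightarrow> ('a \<Rightarrow> complex) \<Rightarrow> 'a \<Rightarrow> real" where
  "schwartz_weight N bs \<phi> x = (1 + norm x) ^ N * norm (iterated_partial bs \<phi> x)"

definition schwartz :: "('a::euclidean_space \<Rightarrow> complex) set" where
  "schwartz = {\<phi>. smooth \<phi> \<and>
     (\<forall>N bs. set bs \<subseteq> Basis \<longrightarrow> bdd_above (range (schwartz_weight N bs \<phi>)))}"

definition schwartz_seminorm ::
  "nat \<Rightarrow> 'a::euclidean_space list \<Rightarrow> ('a \<Rightarrow> complex) \<Rightarrow> real" where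
  "schwartz_seminorm N bs \<phi> = (SUP x. schwartz_weight N bs \<phi> x)"

definition fun_support :: "('a::topological_space \<Rightarrow> complex) \<Rightarrow> 'a set" where
  "fun_support \<phi> = closure {x. \<phi> x \<noteq> 0}"

definition test_functions :: "('a::euclidean_space \<Rightarrow> complex) set" where
  "test_functions = {\<phi>. smooth \<phi> \<and> compact (fun_support \<phi>)}"

definition fourier :: "('a::euclidean_space \<Rightarrow> complex) \<Rightarrow> 'a \<Rightarrow> complex" where
  "fourier f \<xi> = (\<integral>x. f x * exp (- 2 * of_real pi * \<i> * of_real (x \<bullet> \<xi>)) \<partial>lborel)"

section \<open>Tempered distributions\<close>

text \<open>
  A distribution is represented by a function on all of \<open>'a \<Rightarrow> complex\<close>, of which only the
  values on \<open>schwartz\<close> matter. The Schwartz space is metrizable, so continuity is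
  sequential continuity, and for a linear functional continuity at \<open>0\<close> suffices.
\<close>

definition tempered_distribution :: "(('a::euclidean_space \<Rightarrow> complex) \<Rightarrow> complex) \<Rightarrow> bool" where
  "tempered_distribution u \<longleftrightarrow>
     (\<forall>\<phi>\<in>schwartz. \<forall>\<psi>\<in>schwartz. u (\<lambda>x. \<phi> x + \<psi> x) = u \<phi> + u \<psi>) \<and>
     (\<forall>c. \<forall>\<phi>\<in>schwartz. u (\<lambda>x. c * \<phi> x) = c * u \<phi>) \<and>
     (\<forall>\<phi> :: nat \<Rightarrow> 'a \<Rightarrow> complex. (\<forall>n. \<phi> n \<in> schwartz) \<longrightarrow>
        (\<forall>N bs. set bs \<subseteq> Basis \<longrightarrow> (\<lambda>n. schwartz_seminorm N bs (\<phi> n)) \<longlonglongrightarrow> 0) \<longrightarrow>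
        (\<lambda>n. u (\<phi> n)) \<longlonglongrightarrow> 0)"

definition dist_fourier ::
  "(('a::euclidean_space \<Rightarrow> complex) \<Rightarrow> complex) \<Rightarrow> ('a \<Rightarrow> complex) \<Rightarrow> complex" where
  "dist_fourier u \<phi> = u (fourier \<phi>)"

definition dist_support ::
  "(('a::euclidean_space \<Rightarrow> complex) \<Rightarrow> complex) \<Rightarrow> 'a set" where
  "dist_support u =
     \<Inter> {K. closed K \<and> (\<forall>\<phi>\<in>test_functions. fun_support \<phi> \<inter> K = {} \<longrightarrow> u \<phi> = 0)}"

definition represents ::
  "('a::euclidean_space \<Rightarrow> complex) \<Rightarrow> (('a \<Rightarrow> complex) \<Rightarrow> complex) \<Rightarrow> bool" where
  "represents f u \<longleftrightarrow>
     (\<forall>\<phi>\<in>schwartz. integrable lborel (\<lambda>x. f x * \<phi> x) \<and> u \<phi> = (\<integral>x. f x * \<phi> x \<partial>lborel))"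

text \<open>
  The space \<open>\<E>(\<rho>)\<close>, each distribution in it being identified with the smooth function that
  represents it.
\<close>

definition band_limited :: "real \<Rightarrow> ('a::euclidean_space \<Rightarrow> complex) set" where
  "band_limited \<rho> = {f. smooth f \<and>
     (\<exists>u. tempered_distribution u \<and> dist_support (dist_fourier u) \<subseteq> cball 0 (2 * \<rho>) \<and>
          represents f u)}"

section \<open>Maximal operators\<close>

definition ennreal_powr :: "ennreal \<Rightarrow> real \<Rightarrow> ennreal" where
  "ennreal_powr a p = (if a = \<infinity> then \<infinity> else ennreal (enn2real a powr p))"
  \<comment> \<open>intended for \<open>p > 0\<close>\<close>

definition peetre :: "real \<Rightarrow> int \<Rightarrow> ('a::euclidean_space \<Rightarrow> complex) \<Rightarrow> 'a \<Rightarrow> ennreal" where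
  "peetre \<sigma> k f x =
     (SUP y. ennreal (norm (f (x - y)) / (1 + 2 powi k * norm y) powr \<sigma>))"

definition cube :: "'a::euclidean_space \<Rightarrow> real \<Rightarrow> 'a set" where
  "cube a l = cbox a (a + l *\<^sub>R One)"
  \<comment> \<open>lower corner \<open>a\<close>, side length \<open>l\<close>, sides parallel to the axes\<close>

definition cube_mean ::
  "real \<Rightarrow> ('a::euclidean_space \<Rightarrow> complex) \<Rightarrow> 'a set \<Rightarrow> ennreal" where
  "cube_mean t f Q =
     ennreal_powr ((\<integral>\<^sup>+y\<in>Q. ennreal (norm (f y) powr t) \<partial>lborel) / emeasure lborel Q) (1 / t)"

definition cube_maximal ::
  "real \<Rightarrow> int \<Rightarrow> real \<Rightarrow> ('a::euclidean_space \<Rightarrow> complex) \<Rightarrow> 'a \<Rightarrow> ennreal" where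
  "cube_maximal t k \<epsilon> f x =
     (SUP (a, l) \<in> {(a, l). 0 < l \<and> 2 powi k * l \<le> 1 \<and> x \<in> cube a l}. cube_mean t f (cube a l)) +
     (SUP (a, l) \<in> {(a, l). 0 < l \<and> 2 powi k * l > 1 \<and> x \<in> cube a l}.
        ennreal ((2 powi k * l) powr (- \<epsilon>)) * cube_mean t f (cube a l))"

end

theory Submission
  imports Defs "HOL-Probability.Characteristic_Functions"
begin

text \<open>
  If \<open>f\<close> has spectrum in the ball of radius \<open>2\<rho>\<close> and \<open>h\<close> is a test function equal to \<open>1\<close> on the
  unit ball, then \<open>u(fourier(e\<^sub>x h(\<cdot>/S)))\<close>, with \<open>e\<^sub>x\<close> the character at \<open>x\<close>, does not depend on \<open>S > 2\<rho>\<close>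
  and tends to a nonzero multiple of \<open>f(x)\<close> as \<open>S \<rightarrow> \<infinity>\<close>. Hence \<open>f\<close> is reproduced by convolution with a
  Schwartz kernel at scale \<open>1/\<rho>\<close>, and continuity of \<open>u\<close> gives polynomial growth of \<open>f\<close>.

  Put \<open>s = min 1 r\<close>, \<open>\<kappa> = 2\<^sup>k\<close> and let \<open>T\<close> be the supremum over \<open>w\<close> of \<open>|f(w)| (1 + \<kappa>|z - w|)\<^sup>-\<^sup>L\<close>. The
  reproducing formula gives \<open>T \<le> C T\<^sup>1\<^sup>-\<^sup>s I\<close>, where \<open>I\<close> is the integral of
  \<open>\<kappa>\<^sup>d |f(w)|\<^sup>s (1 + \<kappa>|z - w|)\<^sup>-\<^sup>L\<^sup>s\<close>, so that \<open>|f(z)|\<^sup>s \<le> C I\<close>. Splitting space into dyadic cubes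
  centred at \<open>x\<close> bounds \<open>I\<close> by the \<open>s\<close>-th power of the maximal function at \<open>x\<close> times
  \<open>(1 + \<kappa>|x - z|)\<^sup>d\<^sup>/\<^sup>r\<close>, uniformly in \<open>t\<close>.
\<close>

section \<open>Smooth functions\<close>

text \<open>The constant must not depend on \<open>t\<close>, and the exponents are arranged for
  that. The maximal function weights the mean over a large cube of side \<open>l\<close> by
  \<open>(\<kappa> l)^(-\<epsilon>)\<close> with \<open>\<epsilon> = d (1/r - 1/t)\<close>. Undoing
  the average contributes another \<open>d/t\<close>, so the \<open>t\<close>-th root of
  \<open>\<kappa>^d\<close> times the integral of \<open>|f|^t\<close> over the cube is at most
  \<open>(\<kappa> l)^(d/r)\<close> times the maximal function: the exponent no longer contains
  \<open>t\<close>. The choice of \<open>s\<close> meets two demands: \<open>s \<le> 1\<close>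
  leaves a nonnegative power \<open>T^(1-s)\<close> to split off, and \<open>s \<le> r < t\<close>
  lets \<open>t\<close>-th powers control \<open>s\<close>-th powers.

  The obstacle is a circularity. Cancelling \<open>T^(1-s)\<close> requires \<open>T\<close> to be
  finite for the chosen decay exponent \<open>L\<close>, but the growth obtained from the
  distribution has an order depending on \<open>f\<close>, while the final \<open>L\<close> may
  depend only on \<open>d\<close> and \<open>r\<close>.

  The kernel is left unnormalised. Its total integral only has to be nonzero, which is shown by
  pairing it with wide Gaussians, that is, by Fourier inversion at one point.\<close>

definition partial :: "'a::euclidean_space \<Rightarrow> ('a \<Rightarrow> complex) \<Rightarrow> 'a \<Rightarrow> complex" where
  "partial b f = (\<lambda>x. frechet_derivative f (at x) b)"

text \<open>\<open>iterated_partial\<close> applies new derivatives on the outside; moving the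
  innermost one into \<open>f\<close> lets inductions over the order replace \<open>f\<close> by its
  first derivatives.\<close>

lemma iterated_partial_snoc: "iterated_partial (bs @ [b]) f = iterated_partial bs (partial b f)"
  by (induction bs) (simp_all add: partial_def)

lemma iterated_partial_Cons: "iterated_partial (b # bs) f = partial b (iterated_partial bs f)"
  by (simp add: partial_def)

lemma partial_eqI:
  assumes "\<And>x. (f has_derivative f' x) (at x)"
  shows "partial b f = (\<lambda>x. f' x b)"
  unfolding partial_def using assms frechet_derivative_at by metis

text \<open>Smoothness of all orders at once gives no induction hypothesis. Counting the orders
  turns each closure property into a short induction on \<open>n\<close>.\<close>

primrec smooth_upto :: "nat \<Rightarrow> ('a::euclidean_space \<Rightarrow> complex) \<Rightarrow> bool" where
  "smooth_upto 0 f \<longleftrightarrow> (\<forall>x. f differentiable at x)"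
| "smooth_upto (Suc n) f \<longleftrightarrow>
     (\<forall>x. f differentiable at x) \<and> (\<forall>b\<in>Basis. smooth_upto n (partial b f))"

lemma smooth_upto_iff:
  "smooth_upto n f \<longleftrightarrow>
     (\<forall>bs. set bs \<subseteq> Basis \<and> length bs \<le> n \<longrightarrow> (\<forall>x. iterated_partial bs f differentiable at x))"
proof (induction n arbitrary: f)
  case 0
  then show ?case by auto
next
  case (Suc n)
  show ?case (is "?L \<longleftrightarrow> ?R")
  proof
    assume L: ?L
    show ?R
    proof (intro allI impI)
      fix bs :: "'a list" and x assume bs: "set bs \<subseteq> Basis \<and> length bs \<le> Suc n"
      show "iterated_partial bs f differentiable at x"
      proof (cases bs rule: rev_exhaust)
        case Nil
        then show ?thesis using L by simp
      next
        case (snoc cs c)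
        with L bs Suc.IH[of "partial c f"] show ?thesis
          by (simp add: iterated_partial_snoc)
      qed
    qed
  next
    assume R: ?R
    have "smooth_upto n (partial b f)" if "b \<in> Basis" for b
      unfolding Suc.IH
    proof (intro allI impI)
      fix bs :: "'a list" and x assume "set bs \<subseteq> Basis \<and> length bs \<le> n"
      then show "iterated_partial bs (partial b f) differentiable at x"
        using R[rule_format, of "bs @ [b]"] that by (simp add: iterated_partial_snoc)
    qed
    moreover have "f differentiable at x" for x
      using R[rule_format, of "[]"] by simp
    ultimately show ?L by simp
  qed
qed

lemma smooth_iff_upto: "smooth f \<longleftrightarrow> (\<forall>n. smooth_upto n f)"
  unfolding smooth_def smooth_upto_iff
  by (auto simp: differentiable_on_def)

lemma smooth_iff_partial:
  "smooth f \<longleftrightarrow> (\<forall>x. f differentiable at x) \<and> (\<forall>b\<in>Basis. smooth (partial b f))"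
  unfolding smooth_iff_upto
proof safe
  fix x assume "\<forall>n. smooth_upto n f"
  then have "smooth_upto 0 f" by blast
  then show "f differentiable at x" by simp
next
  fix b :: 'a and n assume *: "\<forall>n. smooth_upto n f" "b \<in> Basis"
  then have "smooth_upto (Suc n) f" by blast
  then show "smooth_upto n (partial b f)" using *(2) by simp
next
  fix n assume "\<forall>x. f differentiable (at x)" "\<forall>b\<in>Basis. \<forall>n. smooth_upto n (partial b f)"
  then show "smooth_upto n f" by (cases n) auto
qed

lemma smooth_differentiable: "smooth f \<Longrightarrow> f differentiable at x"
  using smooth_iff_partial[of f] by blast

lemma smooth_partial: "smooth f \<Longrightarrow> b \<in> Basis \<Longrightarrow> smooth (partial b f)"
  using smooth_iff_partial[of f] by blast

lemma smooth_iterated_partial: "smooth f \<Longrightarrow> set bs \<subseteq> Basis \<Longrightarrow> smooth (iterated_partial bs f)"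
  by (induction bs) (simp_all add: iterated_partial_Cons smooth_partial del: iterated_partial.simps(2))

lemma smooth_continuous: "smooth f \<Longrightarrow> continuous_on A f"
  by (intro differentiable_imp_continuous_on)
    (auto simp: differentiable_on_def intro: differentiable_at_withinI smooth_differentiable)

lemma smooth_measurable: "smooth f \<Longrightarrow> f \<in> borel_measurable borel"
  by (intro borel_measurable_continuous_onI smooth_continuous)

lemma smooth_upto_Suc: "smooth_upto (Suc n) f \<Longrightarrow> smooth_upto n f"
  by (induction n arbitrary: f) auto

section \<open>Differentiation rules and closure properties\<close>

lemma partial_const: "partial b (\<lambda>x. c) = (\<lambda>x. 0)"
  by (rule partial_eqI) simp

lemma differentiable_has_derivative:
  "f differentiable at x \<Longrightarrow> (f has_derivative (\<lambda>h. partial h f x)) (at x)"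
  unfolding partial_def using frechet_derivative_works by blast

lemma partial_add:
  assumes "\<And>x. f differentiable at x" "\<And>x. g differentiable at x"
  shows "partial b (\<lambda>x. f x + g x) = (\<lambda>x. partial b f x + partial b g x)"
  by (rule partial_eqI) (intro has_derivative_add differentiable_has_derivative assms)

lemma partial_mult:
  assumes "\<And>x. f differentiable at x" "\<And>x. g differentiable at x"
  shows "partial b (\<lambda>x. f x * g x) = (\<lambda>x. f x * partial b g x + partial b f x * g x)"
  by (rule partial_eqI) (intro has_derivative_mult differentiable_has_derivative assms)

lemma partial_inverse:
  assumes "\<And>x. f differentiable at x" "\<And>x. f x \<noteq> 0"
  shows "partial b (\<lambda>x. inverse (f x)) = (\<lambda>x. - (inverse (f x) * partial b f x * inverse (f x)))"
  by (rule partial_eqI) (intro Deriv.has_derivative_inverse differentiable_has_derivative assms)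

lemma partial_affine:
  assumes "\<And>x. f differentiable at x"
  shows "partial b (\<lambda>x. f (c *\<^sub>R x + v)) = (\<lambda>x. of_real c * partial b f (c *\<^sub>R x + v))"
proof -
  have *: "(f has_derivative frechet_derivative f (at x)) (at x)" for x
    using assms frechet_derivative_works by blast
  have "((\<lambda>x. f (c *\<^sub>R x + v)) has_derivative (\<lambda>h. frechet_derivative f (at (c *\<^sub>R x + v)) (c *\<^sub>R h))) (at x)" for x
    by (rule has_derivative_compose[OF _ *]) (auto intro!: derivative_eq_intros)
  from partial_eqI[OF this, of b] show ?thesis
    using linear_scale[OF has_derivative_linear[OF *]]
    by (simp add: partial_def scaleR_conv_of_real)
qed

lemma smooth_upto_const: "smooth_upto n (\<lambda>x. c)"
  by (induction n arbitrary: c) (auto simp: partial_const)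

lemma smooth_upto_add:
  "smooth_upto n f \<Longrightarrow> smooth_upto n g \<Longrightarrow> smooth_upto n (\<lambda>x. f x + g x)"
  by (induction n arbitrary: f g) (auto simp: partial_add)

lemma smooth_upto_mult:
  "smooth_upto n f \<Longrightarrow> smooth_upto n g \<Longrightarrow> smooth_upto n (\<lambda>x. f x * g x)"
proof (induction n arbitrary: f g)
  case 0
  then show ?case by (auto intro!: differentiable_mult)
next
  case (Suc n)
  then have "smooth_upto n f" "smooth_upto n g" by (auto simp only: smooth_upto_Suc)
  with Suc show ?case
    by (auto simp: partial_mult intro!: smooth_upto_add differentiable_mult)
qed

lemma smooth_upto_inverse:
  "smooth_upto n f \<Longrightarrow> (\<And>x. f x \<noteq> 0) \<Longrightarrow> smooth_upto n (\<lambda>x. inverse (f x))"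
proof (induction n)
  case 0
  then show ?case by (auto intro!: differentiable_inverse)
next
  case (Suc n)
  \<comment> \<open>The derivative of \<open>1/f\<close> contains \<open>1/f\<close> again, so its
    own regularity of order \<open>n\<close> is taken from the induction hypothesis; this is why
    \<open>f\<close> stays fixed in the induction.\<close>
  then have "smooth_upto n (\<lambda>x. inverse (f x))" by (auto simp only: smooth_upto_Suc)
  moreover have "partial b (\<lambda>x. inverse (f x)) = (\<lambda>x. (- 1) * (inverse (f x) * partial b f x * inverse (f x)))" for b
    using Suc by (subst partial_inverse) auto
  moreover have "smooth_upto n (partial b f)" if "b \<in> Basis" for b
    using Suc.prems(1) that by simp
  ultimately have "smooth_upto n (partial b (\<lambda>x. inverse (f x)))" if "b \<in> Basis" for b
    using that by (simp only:) (intro smooth_upto_mult smooth_upto_const)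
  then show ?case
    using Suc.prems by (auto intro!: differentiable_inverse)
qed

lemma smooth_upto_affine:
  "smooth_upto n f \<Longrightarrow> smooth_upto n (\<lambda>x. f (c *\<^sub>R x + v))"
proof (induction n arbitrary: f)
  case 0
  then have d: "\<And>x. f differentiable at x" by simp
  have "(\<lambda>x. f (c *\<^sub>R x + v)) differentiable at x" for x
    by (rule differentiable_compose[where f=f]) (auto intro: d)
  then show ?case by simp
next
  case (Suc n)
  then have d: "\<And>x. f differentiable at x" by simp
  have "(\<lambda>x. f (c *\<^sub>R x + v)) differentiable at x" for x
    by (rule differentiable_compose[where f=f]) (auto intro: d)
  moreover have "smooth_upto n (partial b (\<lambda>x. f (c *\<^sub>R x + v)))" if "b \<in> Basis" for b
    unfolding partial_affine[OF d]
    by (intro smooth_upto_mult smooth_upto_const Suc.IH) (use Suc.prems that in simp)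
  ultimately show ?case by simp
qed

lemma smooth_upto_inner: "smooth_upto n (\<lambda>x. of_real (x \<bullet> v))"
proof -
  have "partial b (\<lambda>x. of_real (x \<bullet> v)) = (\<lambda>x. of_real (b \<bullet> v))" for b :: 'a
    by (rule partial_eqI) (auto intro!: derivative_eq_intros)
  moreover have "(\<lambda>x::'a. complex_of_real (x \<bullet> v)) differentiable at x" for x
    by (rule differentiableI[where f'="\<lambda>h. of_real (h \<bullet> v)"]) (auto intro!: derivative_eq_intros)
  ultimately show ?thesis by (cases n) (auto simp: smooth_upto_const)
qed

lemma smooth_const: "smooth (\<lambda>x. c)"
  by (simp add: smooth_iff_upto smooth_upto_const)

lemma smooth_add: "smooth f \<Longrightarrow> smooth g \<Longrightarrow> smooth (\<lambda>x. f x + g x)"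
  by (simp add: smooth_iff_upto smooth_upto_add)

lemma smooth_mult: "smooth f \<Longrightarrow> smooth g \<Longrightarrow> smooth (\<lambda>x. f x * g x)"
  by (simp add: smooth_iff_upto smooth_upto_mult)

lemma smooth_cmult: "smooth f \<Longrightarrow> smooth (\<lambda>x. c * f x)"
  by (intro smooth_mult smooth_const)

lemma smooth_diff: "smooth f \<Longrightarrow> smooth g \<Longrightarrow> smooth (\<lambda>x. f x - g x)"
  using smooth_add[OF _ smooth_cmult[of g "-1"], of f] by simp

lemma smooth_inverse: "smooth f \<Longrightarrow> (\<And>x. f x \<noteq> 0) \<Longrightarrow> smooth (\<lambda>x. inverse (f x))"
  by (simp add: smooth_iff_upto smooth_upto_inverse)

lemma smooth_affine: "smooth f \<Longrightarrow> smooth (\<lambda>x. f (c *\<^sub>R x + v))"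
  by (simp add: smooth_iff_upto smooth_upto_affine)

lemma smooth_inner: "smooth (\<lambda>x. of_real (x \<bullet> v))"
  by (simp add: smooth_iff_upto smooth_upto_inner)

lemma smooth_character: "smooth (\<lambda>x. exp (z * of_real (x \<bullet> v)))"
proof -
  let ?E = "\<lambda>x. exp (z * of_real (x \<bullet> v))"
  have d: "(?E has_derivative (\<lambda>h. z * of_real (h \<bullet> v) * ?E x)) (at x)" for x
  proof -
    have "((\<lambda>x. z * of_real (x \<bullet> v)) has_derivative (\<lambda>h. z * of_real (h \<bullet> v))) (at x)"
      by (auto intro!: derivative_eq_intros)
    from has_derivative_compose[OF this DERIV_exp[unfolded has_field_derivative_def]]
    show ?thesis by (simp add: mult.commute)
  qed
  \<comment> \<open>The factor \<open>c\<close> is generalised because every derivative of a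
    character is a constant multiple of it.\<close>
  have "smooth_upto n (\<lambda>x. c * ?E x)" for n c
  proof (induction n arbitrary: c)
    case 0
    show ?case using d by (auto intro!: differentiable_mult differentiableI)
  next
    case (Suc n)
    have "partial b (\<lambda>x. c * ?E x) = (\<lambda>x. (c * z * of_real (b \<bullet> v)) * ?E x)" for b
      using partial_eqI[OF has_derivative_mult_right[OF d, of c]] by (simp add: mult.assoc)
    moreover have "(\<lambda>x. c * ?E x) differentiable at x" for x
      using d by (auto intro!: differentiable_mult differentiableI)
    ultimately show ?case using Suc by simp
  qed
  from this[of _ 1] show ?thesis by (simp add: smooth_iff_upto)
qed

section \<open>Iterated derivatives of sums, multiples and dilates\<close>

lemma iterated_partial_add:
  "smooth f \<Longrightarrow> smooth g \<Longrightarrow> set bs \<subseteq> Basis \<Longrightarrow>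
    iterated_partial bs (\<lambda>x. f x + g x) = (\<lambda>x. iterated_partial bs f x + iterated_partial bs g x)"
proof (induction bs)
  case (Cons b bs)
  then show ?case
    by (simp add: iterated_partial_Cons partial_add smooth_differentiable smooth_iterated_partial
        del: iterated_partial.simps(2))
qed simp

lemma iterated_partial_cmult:
  "smooth f \<Longrightarrow> set bs \<subseteq> Basis \<Longrightarrow>
    iterated_partial bs (\<lambda>x. c * f x) = (\<lambda>x. c * iterated_partial bs f x)"
proof (induction bs)
  case (Cons b bs)
  then show ?case
    by (simp add: iterated_partial_Cons partial_mult partial_const smooth_differentiable smooth_iterated_partial
        del: iterated_partial.simps(2))
qed simp

lemma iterated_partial_affine:
  "smooth f \<Longrightarrow> set bs \<subseteq> Basis \<Longrightarrow>
    iterated_partial bs (\<lambda>x. f (c *\<^sub>R x + v)) = (\<lambda>x. of_real c ^ length bs * iterated_partial bs f (c *\<^sub>R x + v))"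
proof (induction bs)
  case (Cons b bs)
  have sm: "smooth (iterated_partial bs f)" using Cons by (simp add: smooth_iterated_partial)
  have "partial b (\<lambda>x. of_real c ^ length bs * iterated_partial bs f (c *\<^sub>R x + v))
     = (\<lambda>x. of_real c ^ length bs * partial b (\<lambda>x. iterated_partial bs f (c *\<^sub>R x + v)) x)"
    using sm smooth_affine[OF sm]
    by (simp add: partial_mult partial_const smooth_differentiable)
  also have "\<dots> = (\<lambda>x. of_real c ^ length (b # bs) * iterated_partial (b # bs) f (c *\<^sub>R x + v))"
    using sm by (simp add: partial_affine smooth_differentiable iterated_partial_Cons mult.assoc mult.left_commute
        del: iterated_partial.simps(2))
  finally show ?case using Cons
    by (simp add: iterated_partial_Cons del: iterated_partial.simps(2))
qed simp

subsection \<open>A bump function\<close>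

text \<open>For \<open>p = 1\<close> this is the classical function \<open>exp (- 1 / x)\<close>
  continued by zero. The polynomial in \<open>1 / x\<close> makes the family closed under
  differentiation.\<close>

definition flat :: "real poly \<Rightarrow> real \<Rightarrow> real" where
  "flat p x = (if 0 < x then poly p (1 / x) * exp (- (1 / x)) else 0)"

lemma flat_tendsto_0:
  fixes p :: "real poly"
  shows "((\<lambda>x. poly p (1 / x) * exp (- (1 / x))) \<longlongrightarrow> 0) (at_right 0)"
proof -
  have "((\<lambda>x::real. poly p x / exp x) \<longlongrightarrow> 0) at_top"
  proof (induction p)
    case 0
    then show ?case by simp
  next
    case (pCons a p)
    have "((\<lambda>x::real. a * (x ^ 0 / exp x) + (\<Sum>i\<le>degree p. coeff p i * (x ^ Suc i / exp x))) \<longlongrightarrow>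
       a * 0 + (\<Sum>i\<le>degree p. coeff p i * 0)) at_top"
      by (intro tendsto_intros tendsto_power_div_exp_0)
    moreover have "poly (pCons a p) x / exp x = a * (x ^ 0 / exp x) + (\<Sum>i\<le>degree p. coeff p i * (x ^ Suc i / exp x))" for x :: real
      by (simp add: poly_altdef[of p] sum_distrib_left sum_divide_distrib add_divide_distrib algebra_simps)
    ultimately show ?case by simp
  qed
  from filterlim_compose[OF this filterlim_inverse_at_top_right]
  show ?thesis by (simp add: exp_minus field_simps)
qed

text \<open>With \<open>y = 1 / x\<close>, differentiation in \<open>x\<close> is
  \<open>- y^2\<close> times differentiation in \<open>y\<close>, which turns
  \<open>p(y) exp(-y)\<close> into \<open>y^2 (p - p')(y) exp(-y)\<close>; \<open>[:0,0,1:]\<close>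
  is the factor \<open>y^2\<close>. At the origin the difference quotient tends to
  \<open>0\<close>.\<close>

lemma flat_deriv:
  "(flat p has_real_derivative flat ([:0,0,1:] * (p - pderiv p)) x) (at x)"
proof -
  consider "x > 0" | "x < 0" | "x = 0" by linarith
  then show ?thesis
  proof cases
    case 1
    have "((\<lambda>x. poly p (1 / x) * exp (- (1 / x))) has_real_derivative
        flat ([:0,0,1:] * (p - pderiv p)) x) (at x)"
      using 1 by (auto intro!: derivative_eq_intros DERIV_chain2[OF poly_DERIV]
          simp: flat_def field_simps power2_eq_square)
    then show ?thesis
      by (rule has_field_derivative_transform_within_open[of _ _ _ "{0<..}"])
        (use 1 in \<open>auto simp: flat_def\<close>)
  next
    case 2
    have "((\<lambda>x. 0) has_real_derivative flat ([:0,0,1:] * (p - pderiv p)) x) (at x)"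
      using 2 by (simp add: flat_def)
    then show ?thesis
      by (rule has_field_derivative_transform_within_open[of _ _ _ "{..<0}"])
        (use 2 in \<open>auto simp: flat_def\<close>)
  next
    case 3
    \<comment> \<open>Division by \<open>h\<close> only multiplies the polynomial by its variable,
      \<open>[:0,1:]\<close>.\<close>
    have "((\<lambda>h. flat p h / h) \<longlongrightarrow> 0) (at_right 0)"
      by (rule Lim_transform_eventually[OF flat_tendsto_0[of "[:0,1:] * p"]])
        (auto simp: eventually_at_filter flat_def)
    moreover have "((\<lambda>h. flat p h / h) \<longlongrightarrow> 0) (at_left 0)"
      by (rule Lim_transform_eventually[OF tendsto_const]) (auto simp: eventually_at_filter flat_def)
    ultimately have "((\<lambda>h. flat p h / h) \<longlongrightarrow> 0) (at 0)"
      by (simp add: filterlim_split_at)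
    then show ?thesis using 3 by (simp add: DERIV_def flat_def)
  qed
qed

text \<open>Each derivative is the same expression with another \<open>p\<close>, times a linear
  function of \<open>x\<close>, so the induction runs with \<open>p\<close> generalised.\<close>

lemma smooth_flat_norm:
  fixes \<alpha> \<beta> :: real
  shows "smooth (\<lambda>x::'a::euclidean_space. of_real (flat p (\<alpha> + \<beta> * (x \<bullet> x))))"
proof -
  have d: "((\<lambda>x::'a. complex_of_real (flat p (\<alpha> + \<beta> * (x \<bullet> x)))) has_derivative
     (\<lambda>h. of_real (flat ([:0,0,1:] * (p - pderiv p)) (\<alpha> + \<beta> * (x \<bullet> x)) * (2 * \<beta> * (x \<bullet> h))))) (at x)" for p x
  proof -
    have "((\<lambda>x::'a. \<alpha> + \<beta> * (x \<bullet> x)) has_derivative (\<lambda>h. 2 * \<beta> * (x \<bullet> h))) (at x)"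
      by (auto intro!: derivative_eq_intros simp: inner_commute)
    from has_derivative_compose[OF this, of "flat p"] flat_deriv[of p "\<alpha> + \<beta> * (x \<bullet> x)"]
    show ?thesis
      unfolding has_field_derivative_def by (intro has_derivative_of_real) auto
  qed
  have "smooth_upto n (\<lambda>x::'a. of_real (flat p (\<alpha> + \<beta> * (x \<bullet> x))))" for n p
  proof (induction n arbitrary: p)
    case 0
    show ?case using d by (auto intro: differentiableI)
  next
    case (Suc n)
    have "partial b (\<lambda>x. of_real (flat p (\<alpha> + \<beta> * (x \<bullet> x)))) =
       (\<lambda>x. of_real (flat ([:0,0,1:] * (p - pderiv p)) (\<alpha> + \<beta> * (x \<bullet> x))) * (of_real (2 * \<beta>) * of_real (x \<bullet> b)))" for b :: 'a
      using partial_eqI[OF d] by simp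
    then show ?case using Suc d
      by (auto intro!: differentiableI[OF d] smooth_upto_mult smooth_upto_const smooth_upto_inner simp del: of_real_mult)
  qed
  then show ?thesis by (simp add: smooth_iff_upto)
qed

text \<open>The usual quotient of flat functions of \<open>|x|^2\<close>: the second summand of the
  denominator vanishes on the unit ball, the numerator outside the ball of radius \<open>2\<close>.
  The factors \<open>(-1)\<close> and \<open>1\<close> match the pattern
  \<open>\<alpha> + \<beta> * (x \<bullet> x)\<close> of \<open>smooth_flat_norm\<close>.\<close>

definition bump :: "'a::euclidean_space \<Rightarrow> complex" where
  "bump x = of_real (flat 1 (4 + (-1) * (x \<bullet> x))) *
     inverse (of_real (flat 1 (4 + (-1) * (x \<bullet> x))) + of_real (flat 1 (- 1 + 1 * (x \<bullet> x))))"

lemma flat_1: "flat 1 x = (if 0 < x then exp (- (1 / x)) else 0)"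
  by (simp add: flat_def)

text \<open>The two arguments add up to \<open>3\<close>, so at least one of them is
  positive.\<close>

lemma bump_denominator: "flat 1 (4 + (-1) * (x \<bullet> x)) + flat 1 (- 1 + 1 * (x \<bullet> x)) \<noteq> 0"
  by (smt (verit) flat_1 exp_gt_zero)

lemma smooth_bump: "smooth bump"
  unfolding bump_def[abs_def]
  by (intro smooth_mult smooth_inverse smooth_add smooth_flat_norm)
    (metis bump_denominator of_real_add of_real_eq_0_iff)

lemma bump_eq_1: "norm x \<le> 1 \<Longrightarrow> bump x = 1"
proof -
  assume "norm x \<le> 1"
  then have "x \<bullet> x \<le> 1" by (simp add: dot_square_norm power_le_one)
  then show ?thesis by (simp add: bump_def flat_1)
qed

lemma bump_eq_0: "norm x \<ge> 2 \<Longrightarrow> bump x = 0"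
proof -
  assume "norm x \<ge> 2"
  then have "x \<bullet> x \<ge> 2\<^sup>2" unfolding dot_square_norm by (intro power_mono) auto
  then show ?thesis by (simp add: bump_def flat_1)
qed

section \<open>Test functions\<close>

lemma fun_support_cong_zero: "x \<notin> fun_support \<phi> \<Longrightarrow> \<phi> x = 0"
  unfolding fun_support_def using closure_subset by force

lemma fun_support_subset: "closed K \<Longrightarrow> (\<And>x. x \<notin> K \<Longrightarrow> \<phi> x = 0) \<Longrightarrow> fun_support \<phi> \<subseteq> K"
  unfolding fun_support_def by (intro closure_minimal) auto

lemma closed_fun_support: "closed (fun_support \<phi>)"
  by (simp add: fun_support_def)

lemma test_functionsI:
  assumes "smooth \<phi>" "compact K" "\<And>x. x \<notin> K \<Longrightarrow> \<phi> x = 0"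
  shows "\<phi> \<in> test_functions"
proof -
  have "fun_support \<phi> \<subseteq> K" using assms by (intro fun_support_subset compact_imp_closed)
  then have "compact (fun_support \<phi>)"
    using assms(2) closed_fun_support[of \<phi>] compact_Int_closed[of K "fun_support \<phi>"] by (simp add: inf_absorb2)
  then show ?thesis using assms(1) by (simp add: test_functions_def)
qed

lemma test_smooth: "\<phi> \<in> test_functions \<Longrightarrow> smooth \<phi>"
  by (simp add: test_functions_def)

lemma test_compact: "\<phi> \<in> test_functions \<Longrightarrow> compact (fun_support \<phi>)"
  by (simp add: test_functions_def)

lemma test_mult: "\<phi> \<in> test_functions \<Longrightarrow> smooth g \<Longrightarrow> (\<lambda>x. g x * \<phi> x) \<in> test_functions"
  by (rule test_functionsI[OF smooth_mult test_compact[of \<phi>]])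
    (auto simp: fun_support_cong_zero test_smooth)

lemma test_add: "\<phi> \<in> test_functions \<Longrightarrow> \<psi> \<in> test_functions \<Longrightarrow> (\<lambda>x. \<phi> x + \<psi> x) \<in> test_functions"
  by (rule test_functionsI[OF smooth_add compact_Un[OF test_compact[of \<phi>] test_compact[of \<psi>]]])
    (auto simp: fun_support_cong_zero test_smooth)

lemma test_affine:
  assumes "\<phi> \<in> test_functions" "c \<noteq> 0"
  shows "(\<lambda>x. \<phi> (c *\<^sub>R x + v)) \<in> test_functions"
proof (rule test_functionsI)
  show "smooth (\<lambda>x. \<phi> (c *\<^sub>R x + v))" using assms by (intro smooth_affine test_smooth)
  let ?K = "(\<lambda>y. (1 / c) *\<^sub>R (y - v)) ` fun_support \<phi>"
  show "compact ?K" using assms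
    by (intro compact_continuous_image continuous_intros test_compact)
  fix x assume x: "x \<notin> ?K"
  show "\<phi> (c *\<^sub>R x + v) = 0"
  proof (rule ccontr)
    assume "\<phi> (c *\<^sub>R x + v) \<noteq> 0"
    then have "c *\<^sub>R x + v \<in> fun_support \<phi>" using fun_support_cong_zero by blast
    then have "(1 / c) *\<^sub>R ((c *\<^sub>R x + v) - v) \<in> ?K" by blast
    with x assms show False by simp
  qed
qed

lemma partial_eq_0:
  assumes "open U" "x \<in> U" "\<And>y. y \<in> U \<Longrightarrow> f y = 0"
  shows "partial b f x = 0"
proof -
  have "((\<lambda>_. 0::complex) has_derivative (\<lambda>_. 0)) (at x)" by simp
  then have "(f has_derivative (\<lambda>_. 0)) (at x)"
    by (rule has_derivative_transform_within_open[OF _ assms(1,2)]) (use assms in auto)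
  then show ?thesis unfolding partial_def by (metis frechet_derivative_at)
qed

lemma partial_eq_0_outside: "x \<notin> fun_support \<phi> \<Longrightarrow> partial b \<phi> x = 0"
  by (rule partial_eq_0[of "- fun_support \<phi>"])
    (auto simp: closed_fun_support open_Compl fun_support_cong_zero)

lemma test_partial: "\<phi> \<in> test_functions \<Longrightarrow> b \<in> Basis \<Longrightarrow> partial b \<phi> \<in> test_functions"
  by (rule test_functionsI[OF smooth_partial test_compact[of \<phi>]])
    (auto simp: partial_eq_0_outside test_smooth)

lemma test_bounded:
  assumes "\<phi> \<in> test_functions"
  shows "\<exists>B>0. \<forall>x. norm (\<phi> x) \<le> B"
proof -
  have "compact (\<phi> ` fun_support \<phi>)"
    using assms by (intro compact_continuous_image smooth_continuous test_smooth test_compact)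
  then obtain B where "B > 0" "\<forall>y\<in>\<phi> ` fun_support \<phi>. norm y \<le> B"
    using compact_imp_bounded bounded_pos by blast
  then show ?thesis by (intro exI[of _ B]) (metis fun_support_cong_zero image_eqI less_eq_real_def norm_zero)
qed

lemma test_integrable:
  assumes "\<phi> \<in> test_functions"
  shows "integrable lborel \<phi>"
proof -
  have "integrable lborel (\<lambda>x. indicator (fun_support \<phi>) x *\<^sub>R \<phi> x)"
    using assms by (intro borel_integrable_compact test_compact smooth_continuous test_smooth)
  moreover have "(\<lambda>x. indicator (fun_support \<phi>) x *\<^sub>R \<phi> x) = \<phi>"
    by (auto simp: indicator_def fun_support_cong_zero)
  ultimately show ?thesis by simp
qed

lemma test_bump: "bump \<in> test_functions"
  by (rule test_functionsI[OF smooth_bump compact_cball[of 0 2]]) (auto simp: bump_eq_0)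

section \<open>The Fourier transform of test functions\<close>

lemma test_integrable_mult:
  assumes "\<phi> \<in> test_functions" "continuous_on UNIV g"
  shows "integrable lborel (\<lambda>x. g x * \<phi> x :: complex)"
proof -
  have "integrable lborel (\<lambda>x. indicator (fun_support \<phi>) x *\<^sub>R (g x * \<phi> x))"
    by (intro borel_integrable_compact test_compact continuous_on_mult smooth_continuous test_smooth
        continuous_on_subset[OF assms(2)] assms(1)) simp
  moreover have "(\<lambda>x. indicator (fun_support \<phi>) x *\<^sub>R (g x * \<phi> x)) = (\<lambda>x. g x * \<phi> x)"
    by (auto simp: indicator_def fun_support_cong_zero)
  ultimately show ?thesis by simp
qed

lemma norm_character: "norm (exp (- 2 * of_real pi * \<i> * of_real r)) = 1"
  by (simp add: norm_exp_eq_Re)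

lemma integrable_fourier:
  assumes f: "integrable lborel f"
  shows "integrable lborel (\<lambda>x. f x * exp (- 2 * of_real pi * \<i> * of_real (x \<bullet> \<xi>)))"
proof (rule Bochner_Integration.integrable_bound[OF f])
  have [measurable]: "f \<in> borel_measurable borel" using f by auto
  show "(\<lambda>x. f x * exp (- 2 * of_real pi * \<i> * of_real (x \<bullet> \<xi>))) \<in> borel_measurable lborel"
    by measurable
qed (simp only: norm_mult norm_character, simp)

lemma fourier_add:
  "integrable lborel f \<Longrightarrow> integrable lborel g \<Longrightarrow>
    fourier (\<lambda>x. f x + g x) = (\<lambda>\<xi>. fourier f \<xi> + fourier g \<xi>)"
  unfolding fourier_def distrib_right
  by (intro ext Bochner_Integration.integral_add integrable_fourier)

lemma fourier_cmult: "fourier (\<lambda>x. c * f x) = (\<lambda>\<xi>. c * fourier f \<xi>)"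
  unfolding fourier_def by (simp add: mult.assoc)

lemma norm_fourier_le: "norm (fourier f \<xi>) \<le> (\<integral>x. norm (f x) \<partial>lborel)"
  unfolding fourier_def
  by (rule order_trans[OF integral_norm_bound]) (simp add: norm_mult norm_character)

text \<open>The remainder bound \<open>|exp(i a) - 1 - i a| \<le> a^2 / 2\<close>, integrated
  against \<open>\<phi>\<close>, gives a quadratic error whose constant \<open>K\<close> is a second
  moment of \<open>\<phi>\<close>, finite by compact support. This yields the total derivative at
  once, as \<open>partial\<close> requires.\<close>

lemma fourier_has_derivative:
  assumes \<phi>: "\<phi> \<in> test_functions"
  shows "(fourier \<phi> has_derivative
    (\<lambda>\<eta>. fourier (\<lambda>x. (- 2 * of_real pi * \<i>) * (of_real (x \<bullet> \<eta>) * \<phi> x)) \<xi>)) (at \<xi>)"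
proof -
  define L where "L \<eta> = fourier (\<lambda>x. of_real (x \<bullet> \<eta>) * \<phi> x) \<xi>" for \<eta>
  have int: "integrable lborel (\<lambda>x. of_real (x \<bullet> \<eta>) * \<phi> x)" for \<eta>
    using \<phi> by (intro test_integrable_mult continuous_intros)
  have "linear L"
  proof (rule linearI)
    fix a b show "L (a + b) = L a + L b"
      unfolding L_def by (simp add: inner_add_right distrib_right fourier_add[OF int int])
  next
    fix r b show "L (r *\<^sub>R b) = r *\<^sub>R L b"
      unfolding L_def scaleR_conv_of_real by (simp add: mult.assoc fourier_cmult)
  qed
  then have bl: "bounded_linear (\<lambda>\<eta>. (- 2 * of_real pi * \<i>) * L \<eta>)"
    by (intro bounded_linear_const_mult) (simp add: linear_conv_bounded_linear)
  define K where "K = (\<integral>x. norm (of_real (((2 * pi) * norm x)\<^sup>2) * \<phi> x) \<partial>lborel)"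
  have intK: "integrable lborel (\<lambda>x. of_real (((2 * pi) * norm x)\<^sup>2) * \<phi> x)"
    using \<phi> by (intro test_integrable_mult continuous_intros)
  have bnd: "norm (fourier \<phi> \<zeta> - fourier \<phi> \<xi> - (- 2 * of_real pi * \<i>) * L (\<zeta> - \<xi>)) \<le> K * (norm (\<zeta> - \<xi>))\<^sup>2" for \<zeta>
  proof -
    define \<eta> where "\<eta> = \<zeta> - \<xi>"
    let ?e = "\<lambda>x \<xi>. exp (- 2 * of_real pi * \<i> * of_real (x \<bullet> \<xi>))"
    let ?R = "\<lambda>x. iexp (- 2 * pi * (x \<bullet> \<eta>)) - 1 - \<i> * of_real (- 2 * pi * (x \<bullet> \<eta>))"
    have R: "norm (?R x) \<le> (2 * pi * norm x)\<^sup>2 * (norm \<eta>)\<^sup>2" for x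
    proof -
      have "norm (?R x) \<le> (- 2 * pi * (x \<bullet> \<eta>))\<^sup>2 / 2"
        using iexp_approx1[of "- 2 * pi * (x \<bullet> \<eta>)" 1] by (simp add: eval_nat_numeral algebra_simps)
      also have "\<dots> \<le> (2 * pi)\<^sup>2 * (\<bar>x \<bullet> \<eta>\<bar>)\<^sup>2"
        by (simp add: power_mult_distrib)
      also have "\<dots> \<le> (2 * pi)\<^sup>2 * (norm x * norm \<eta>)\<^sup>2"
        by (intro mult_left_mono power_mono Cauchy_Schwarz_ineq2) auto
      finally show ?thesis by (simp add: power_mult_distrib mult_ac)
    qed
    have i: "integrable lborel (\<lambda>x. \<phi> x * ?e x \<zeta>)" for \<zeta>
      by (intro integrable_fourier test_integrable \<phi>)
    have j: "integrable lborel (\<lambda>x. (- 2 * of_real pi * \<i>) * (of_real (x \<bullet> \<eta>) * \<phi> x * ?e x \<xi>))"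
      by (intro integrable_mult_right integrable_fourier int)
    have "fourier \<phi> \<zeta> - fourier \<phi> \<xi> - (- 2 * of_real pi * \<i>) * L \<eta> =
       (\<integral>x. \<phi> x * ?e x \<zeta> \<partial>lborel) - (\<integral>x. \<phi> x * ?e x \<xi> \<partial>lborel)
        - (\<integral>x. (- 2 * of_real pi * \<i>) * (of_real (x \<bullet> \<eta>) * \<phi> x * ?e x \<xi>) \<partial>lborel)"
      by (simp add: L_def fourier_def)
    also have "\<dots> = (\<integral>x. \<phi> x * ?e x \<zeta> - \<phi> x * ?e x \<xi> - (- 2 * of_real pi * \<i>) * (of_real (x \<bullet> \<eta>) * \<phi> x * ?e x \<xi>) \<partial>lborel)"
      by (subst Bochner_Integration.integral_diff[OF Bochner_Integration.integrable_diff[OF i i] j],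
        subst Bochner_Integration.integral_diff[OF i i]) (rule refl)
    also have "\<dots> = (\<integral>x. \<phi> x * ?e x \<xi> * ?R x \<partial>lborel)"
    proof (rule Bochner_Integration.integral_cong[OF refl])
      fix x
      have "?e x \<zeta> = ?e x \<xi> * iexp (- 2 * pi * (x \<bullet> \<eta>))"
        unfolding exp_add[symmetric] by (simp add: \<eta>_def inner_diff_right algebra_simps)
      then show "\<phi> x * ?e x \<zeta> - \<phi> x * ?e x \<xi> - (- 2 * of_real pi * \<i>) * (of_real (x \<bullet> \<eta>) * \<phi> x * ?e x \<xi>) =
        \<phi> x * ?e x \<xi> * ?R x"
        by (simp add: algebra_simps)
    qed
    finally have "norm (fourier \<phi> \<zeta> - fourier \<phi> \<xi> - (- 2 * of_real pi * \<i>) * L \<eta>) \<le>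
        (\<integral>x. norm (\<phi> x * ?e x \<xi> * ?R x) \<partial>lborel)"
      by (simp only: integral_norm_bound)
    also have "\<dots> \<le> (\<integral>x. norm (of_real ((2 * pi * norm x)\<^sup>2) * \<phi> x) * (norm \<eta>)\<^sup>2 \<partial>lborel)"
    proof (rule integral_mono_AE')
      show "integrable lborel (\<lambda>x. norm (of_real ((2 * pi * norm x)\<^sup>2) * \<phi> x) * (norm \<eta>)\<^sup>2)"
        using intK by (intro integrable_mult_left integrable_norm)
      have "norm (\<phi> x * ?e x \<xi> * ?R x) \<le> norm (of_real ((2 * pi * norm x)\<^sup>2) * \<phi> x) * (norm \<eta>)\<^sup>2" for x
        using mult_left_mono[OF R[of x] norm_ge_zero[of "\<phi> x"]]
        by (simp add: norm_mult norm_character norm_power mult_ac power_mult_distrib)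
      then show "AE x in lborel. norm (\<phi> x * ?e x \<xi> * ?R x) \<le> norm (of_real ((2 * pi * norm x)\<^sup>2) * \<phi> x) * (norm \<eta>)\<^sup>2"
        by simp
    qed auto
    also have "\<dots> = K * (norm \<eta>)\<^sup>2" by (simp add: K_def)
    finally show ?thesis by (simp add: \<eta>_def)
  qed
  have "(fourier \<phi> has_derivative (\<lambda>\<eta>. (- 2 * of_real pi * \<i>) * L \<eta>)) (at \<xi>)"
  proof (rule has_derivativeI_sandwich[OF zero_less_one bl])
    show "((\<lambda>\<zeta>. K * norm (\<zeta> - \<xi>)) \<longlongrightarrow> 0) (at \<xi>)"
      by (auto intro!: tendsto_eq_intros)
    fix \<zeta> assume "\<zeta> \<noteq> \<xi>"
    then show "norm (fourier \<phi> \<zeta> - fourier \<phi> \<xi> - (- 2 * of_real pi * \<i>) * L (\<zeta> - \<xi>)) / norm (\<zeta> - \<xi>) \<le> K * norm (\<zeta> - \<xi>)"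
      using bnd[of \<zeta>] by (simp add: divide_le_eq power2_eq_square mult.assoc)
  qed
  then show ?thesis by (simp only: fourier_cmult L_def)
qed

lemma partial_fourier:
  "\<phi> \<in> test_functions \<Longrightarrow>
    partial b (fourier \<phi>) = fourier (\<lambda>x. (- 2 * of_real pi * \<i>) * (of_real (x \<bullet> b) * \<phi> x))"
  by (rule partial_eqI[OF fourier_has_derivative])

lemma has_vector_derivative_at_0_quotient:
  assumes "(g has_vector_derivative D) (at 0)"
  shows "((\<lambda>h. (g h - g 0) /\<^sub>R h) \<longlongrightarrow> D) (at 0)"
proof -
  have *: "((\<lambda>h. norm (g h - g 0 - h *\<^sub>R D) / norm h) \<longlongrightarrow> 0) (at 0)"
    using assms by (simp add: has_vector_derivative_def has_derivative_at)
  have "((\<lambda>h. norm ((g h - g 0) /\<^sub>R h - D)) \<longlongrightarrow> 0) (at 0)"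
  proof (rule Lim_transform_eventually[OF *], unfold eventually_at_filter, intro always_eventually allI impI)
    fix h :: real assume "h \<noteq> 0"
    then have "(g h - g 0) /\<^sub>R h - D = (g h - g 0 - h *\<^sub>R D) /\<^sub>R h"
      by (simp add: scaleR_diff_right)
    then show "norm (g h - g 0 - h *\<^sub>R D) / norm h = norm ((g h - g 0) /\<^sub>R h - D)"
      by (simp add: divide_inverse mult.commute)
  qed
  then show ?thesis by (rule LIM_zero_cancel[OF tendsto_norm_zero_cancel])
qed

lemma integral_shift_lborel:
  fixes f :: "'a::euclidean_space \<Rightarrow> complex"
  assumes "f \<in> borel_measurable borel"
  shows "(\<integral>x. f (c + x) \<partial>lborel) = (\<integral>x. f x \<partial>lborel)"
  using assms by (subst (2) lborel_distr_plus[symmetric, of c]) (simp add: integral_distr)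

text \<open>The integral of \<open>G\<close> is translation invariant, so its derivative along \<open>b\<close> has integral \<open>0\<close>.\<close>

lemma integral_partial_test:
  assumes G: "G \<in> test_functions" and b: "b \<in> Basis"
  shows "(\<integral>x. partial b G x \<partial>lborel) = 0"
proof -
  obtain B where B: "B > 0" "\<And>x. norm (partial b G x) \<le> B"
    using test_bounded[OF test_partial[OF G b]] by blast
  obtain R where R: "\<And>x. x \<in> fun_support G \<Longrightarrow> norm x \<le> R"
    using compact_imp_bounded[OF test_compact[OF G]] unfolding bounded_iff by blast
  have meas [measurable]: "G \<in> borel_measurable borel"
    using G by (intro smooth_measurable test_smooth)
  have pmeas [measurable]: "partial b G \<in> borel_measurable borel"
    using G b by (intro smooth_measurable test_smooth test_partial)
  have der: "(G has_derivative (\<lambda>h. partial h G x)) (at x)" for x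
    using G by (intro differentiable_has_derivative smooth_differentiable test_smooth)
  have line: "((\<lambda>t. G (x + t *\<^sub>R b)) has_derivative (\<lambda>s. s *\<^sub>R partial b G (x + t *\<^sub>R b))) (at t)" for x t
  proof -
    have "((\<lambda>t. G (x + t *\<^sub>R b)) has_derivative (\<lambda>s. partial (s *\<^sub>R b) G (x + t *\<^sub>R b))) (at t)"
      by (rule has_derivative_compose[OF _ der]) (auto intro!: derivative_eq_intros)
    then show ?thesis
      using linear_scale[OF has_derivative_linear[OF der]] by simp
  qed
  have lip: "norm (G (x + t *\<^sub>R b) - G x) \<le> B * \<bar>t\<bar>" for x t
  proof -
    have "norm ((\<lambda>t. G (x + t *\<^sub>R b)) t - (\<lambda>t. G (x + t *\<^sub>R b)) 0) \<le> B * norm (t - 0)"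
    proof (rule differentiable_bound[OF convex_UNIV])
      show "((\<lambda>t. G (x + t *\<^sub>R b)) has_derivative (\<lambda>s. s *\<^sub>R partial b G (x + t *\<^sub>R b))) (at t within UNIV)" for t
        using line by simp
      show "onorm (\<lambda>s. s *\<^sub>R partial b G (x + t *\<^sub>R b)) \<le> B" for t
        using B by (intro onorm_bound) (auto simp: mult.commute[of B] intro: mult_left_mono)
    qed auto
    then show ?thesis by simp
  qed
  define q where "q n x = of_nat (Suc n) * (G (x + (1 / real (Suc n)) *\<^sub>R b) - G x)" for n x
  have q0: "(\<integral>x. q n x \<partial>lborel) = 0" for n
  proof -
    have "integrable lborel (\<lambda>x. G (x + (1 / real (Suc n)) *\<^sub>R b))"
      using test_integrable[OF test_affine[OF G, of 1]] by simp
    moreover have "(\<integral>x. G (x + (1 / real (Suc n)) *\<^sub>R b) \<partial>lborel) = (\<integral>x. G x \<partial>lborel)"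
      using integral_shift_lborel[OF meas, of "(1 / real (Suc n)) *\<^sub>R b"] by (simp add: add.commute)
    ultimately show ?thesis unfolding q_def using test_integrable[OF G] by simp
  qed
  \<comment> \<open>The step sizes are at most \<open>1\<close>, so all difference quotients vanish
    outside the ball of radius \<open>R + 1\<close>; inside it the Lipschitz constant
    \<open>B\<close> dominates them.\<close>
  have "(\<lambda>n. \<integral>x. q n x \<partial>lborel) \<longlonglongrightarrow> (\<integral>x. partial b G x \<partial>lborel)"
  proof (rule integral_dominated_convergence)
    show "integrable lborel (\<lambda>x. indicator (cball 0 (R + 1)) x *\<^sub>R B)"
      by (intro borel_integrable_compact) auto
    show "AE x in lborel. (\<lambda>n. q n x) \<longlonglongrightarrow> partial b G x"
    proof (rule AE_I2)
      fix x
      have "((\<lambda>t. G (x + t *\<^sub>R b)) has_vector_derivative partial b G x) (at 0)"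
        using line[of x 0] by (simp add: has_vector_derivative_def)
      then have "((\<lambda>h. (G (x + h *\<^sub>R b) - G (x + 0 *\<^sub>R b)) /\<^sub>R h) \<longlongrightarrow> partial b G x) (at 0)"
        by (rule has_vector_derivative_at_0_quotient)
      moreover have "filterlim (\<lambda>n. 1 / real (Suc n)) (at 0) sequentially"
        unfolding filterlim_at using LIMSEQ_inverse_real_of_nat by (simp add: inverse_eq_divide)
      ultimately have "(\<lambda>n. (G (x + (1 / real (Suc n)) *\<^sub>R b) - G (x + 0 *\<^sub>R b)) /\<^sub>R (1 / real (Suc n))) \<longlonglongrightarrow> partial b G x"
        by (rule filterlim_compose)
      then show "(\<lambda>n. q n x) \<longlonglongrightarrow> partial b G x"
        by (simp add: q_def scaleR_conv_of_real)
    qed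
    show "AE x in lborel. norm (q n x) \<le> indicator (cball 0 (R + 1)) x *\<^sub>R B" for n
    proof (rule AE_I2)
      fix x
      let ?h = "1 / real (Suc n)"
      show "norm (q n x) \<le> indicator (cball 0 (R + 1)) x *\<^sub>R B"
      proof (cases "x \<in> cball 0 (R + 1)")
        case True
        have "norm (q n x) \<le> real (Suc n) * (B * \<bar>?h\<bar>)"
          unfolding q_def norm_mult by (intro mult_mono lip) (auto simp: norm_of_nat simp del: of_nat_Suc)
        then show ?thesis using True by simp
      next
        case False
        then have x: "norm x > R + 1" by simp
        have "norm (x + ?h *\<^sub>R b) \<ge> norm x - norm (?h *\<^sub>R b)"
          by (rule norm_diff_ineq)
        moreover have "norm (?h *\<^sub>R b) \<le> 1" using b by simp
        ultimately have "norm (x + ?h *\<^sub>R b) > R" using x by linarith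
        then have "G (x + ?h *\<^sub>R b) = 0" "G x = 0"
          using R[of "x + ?h *\<^sub>R b"] R[of x] x by (force intro: fun_support_cong_zero)+
        then show ?thesis using B(1) by (simp add: q_def)
      qed
    qed
  qed (simp_all add: q_def[abs_def])
  with q0 show ?thesis by (simp add: LIMSEQ_const_iff)
qed

text \<open>Integration by parts: the derivative of the product of \<open>\<phi>\<close> with the
  character has integral \<open>0\<close> by \<open>integral_partial_test\<close>.\<close>

lemma fourier_partial:
  assumes \<phi>: "\<phi> \<in> test_functions" and b: "b \<in> Basis"
  shows "fourier (partial b \<phi>) \<xi> = (2 * of_real pi * \<i> * of_real (\<xi> \<bullet> b)) * fourier \<phi> \<xi>"
proof -
  define e where "e = (\<lambda>x. exp ((- 2 * of_real pi * \<i>) * of_real (x \<bullet> \<xi>)))"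
  have sm: "smooth e" unfolding e_def by (rule smooth_character)
  have de: "partial b e = (\<lambda>x. - 2 * of_real pi * \<i> * of_real (b \<bullet> \<xi>) * e x)"
  proof (rule partial_eqI)
    fix x
    have "((\<lambda>x. (- 2 * of_real pi * \<i>) * of_real (x \<bullet> \<xi>)) has_derivative (\<lambda>h. (- 2 * of_real pi * \<i>) * of_real (h \<bullet> \<xi>))) (at x)"
      by (intro has_derivative_mult_right has_derivative_of_real has_derivative_inner_left has_derivative_ident)
    from has_derivative_compose[OF this DERIV_exp[unfolded has_field_derivative_def]]
    show "(e has_derivative (\<lambda>b. - 2 * of_real pi * \<i> * of_real (b \<bullet> \<xi>) * e x)) (at x)"
      by (simp add: e_def mult.commute)
  qed
  have "0 = (\<integral>x. partial b (\<lambda>x. e x * \<phi> x) x \<partial>lborel)"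
    using integral_partial_test[OF test_mult[OF \<phi> sm] b] by simp
  also have "\<dots> = (\<integral>x. partial b \<phi> x * e x + (- 2 * of_real pi * \<i> * of_real (b \<bullet> \<xi>)) * (\<phi> x * e x) \<partial>lborel)"
    using partial_mult[of e \<phi> b] sm \<phi> by (simp add: smooth_differentiable test_smooth de mult_ac)
  also have "\<dots> = fourier (partial b \<phi>) \<xi> + (- 2 * of_real pi * \<i> * of_real (b \<bullet> \<xi>)) * fourier \<phi> \<xi>"
    unfolding fourier_def e_def
    by (subst Bochner_Integration.integral_add)
      (intro integrable_fourier test_integrable test_partial \<phi> b integrable_mult_right
        | simp only: integral_mult_right_zero)+
  finally show ?thesis by (simp add: inner_commute)
qed

text \<open>Each further factor \<open>norm \<xi>\<close> is at most the sum of the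
  \<open>|\<xi> \<bullet> b|\<close>, and each of these is paid for by passing to
  \<open>partial b \<phi>\<close>, again a test function; so \<open>\<phi>\<close> varies in the
  induction.\<close>

lemma fourier_test_decay:
  "\<phi> \<in> test_functions \<Longrightarrow> \<exists>B. \<forall>\<xi>. (1 + norm \<xi>) ^ N * norm (fourier \<phi> \<xi>) \<le> B"
proof (induction N arbitrary: \<phi>)
  case 0
  then show ?case using norm_fourier_le by auto
next
  case (Suc N)
  obtain B0 where B0: "\<And>\<xi>. (1 + norm \<xi>) ^ N * norm (fourier \<phi> \<xi>) \<le> B0"
    using Suc by blast
  have "\<forall>b\<in>Basis. \<exists>B. \<forall>\<xi>. (1 + norm \<xi>) ^ N * norm (fourier (partial b \<phi>) \<xi>) \<le> B"
    using Suc test_partial by blast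
  then obtain B where B: "\<And>b \<xi>. b \<in> Basis \<Longrightarrow> (1 + norm \<xi>) ^ N * norm (fourier (partial b \<phi>) \<xi>) \<le> B b"
    by metis
  have "(1 + norm \<xi>) ^ Suc N * norm (fourier \<phi> \<xi>) \<le> B0 + (\<Sum>b\<in>Basis. B b)" for \<xi>
  proof -
    have "norm \<xi> * norm (fourier \<phi> \<xi>) \<le> (\<Sum>b\<in>Basis. \<bar>\<xi> \<bullet> b\<bar>) * norm (fourier \<phi> \<xi>)"
      by (intro mult_right_mono norm_le_l1) auto
    also have "\<dots> \<le> (\<Sum>b\<in>Basis. norm (fourier (partial b \<phi>) \<xi>))"
      unfolding sum_distrib_right
    proof (rule sum_mono)
      fix b :: 'a assume b: "b \<in> Basis"
      have "1 * (\<bar>\<xi> \<bullet> b\<bar> * norm (fourier \<phi> \<xi>)) \<le> (2 * pi) * (\<bar>\<xi> \<bullet> b\<bar> * norm (fourier \<phi> \<xi>))"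
        using pi_gt3 by (intro mult_right_mono) auto
      then show "\<bar>\<xi> \<bullet> b\<bar> * norm (fourier \<phi> \<xi>) \<le> norm (fourier (partial b \<phi>) \<xi>)"
        by (simp add: fourier_partial[OF Suc.prems b] norm_mult)
    qed
    finally have "norm \<xi> * norm (fourier \<phi> \<xi>) \<le> (\<Sum>b\<in>Basis. norm (fourier (partial b \<phi>) \<xi>))" .
    then have "(1 + norm \<xi>) ^ N * (norm \<xi> * norm (fourier \<phi> \<xi>)) \<le> (1 + norm \<xi>) ^ N * (\<Sum>b\<in>Basis. norm (fourier (partial b \<phi>) \<xi>))"
      by (intro mult_left_mono) auto
    also have "\<dots> \<le> (\<Sum>b\<in>Basis. B b)"
      unfolding sum_distrib_left by (intro sum_mono B)
    finally show ?thesis using B0[of \<xi>] by (simp add: algebra_simps)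
  qed
  then show ?case by blast
qed

text \<open>A class closed under first derivatives contains all iterated derivatives of its members,
  so decay of the undifferentiated members already gives every seminorm bound. This avoids Leibniz
  formulas.\<close>

lemma schwartz_coinduct:
  assumes "\<phi> \<in> X"
    and diff: "\<And>\<phi> x. \<phi> \<in> X \<Longrightarrow> \<phi> differentiable at x"
    and part: "\<And>\<phi> b. \<phi> \<in> X \<Longrightarrow> b \<in> Basis \<Longrightarrow> partial b \<phi> \<in> X"
    and decay: "\<And>\<phi> N. \<phi> \<in> X \<Longrightarrow> \<exists>B. \<forall>x. (1 + norm x) ^ N * norm (\<phi> x) \<le> B"
  shows "\<phi> \<in> schwartz"
proof -
  have X: "iterated_partial bs \<phi> \<in> X" if "set bs \<subseteq> Basis" for bs
    using that by (induction bs)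
      (auto simp: iterated_partial_Cons assms(1) part simp del: iterated_partial.simps(2))
  have "smooth \<phi>"
    unfolding smooth_def differentiable_on_def using X diff by (auto intro: differentiable_at_withinI)
  then show ?thesis
    using decay[OF X] unfolding schwartz_def bdd_above_def schwartz_weight_def by fastforce
qed

lemma schwartzD:
  assumes "\<phi> \<in> schwartz"
  shows schwartz_smooth: "smooth \<phi>"
    and schwartz_bound: "set bs \<subseteq> Basis \<Longrightarrow> \<exists>B. \<forall>x. (1 + norm x) ^ N * norm (iterated_partial bs \<phi> x) \<le> B"
  using assms unfolding schwartz_def bdd_above_def schwartz_weight_def by auto

lemma schwartzI:
  assumes "smooth \<phi>" "\<And>N bs. set bs \<subseteq> Basis \<Longrightarrow> \<exists>B. \<forall>x. (1 + norm x) ^ N * norm (iterated_partial bs \<phi> x) \<le> B"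
  shows "\<phi> \<in> schwartz"
  using assms unfolding schwartz_def bdd_above_def schwartz_weight_def by fastforce

text \<open>The Fourier images of test functions form a class to which
  \<open>schwartz_coinduct\<close> applies: differentiating the image multiplies the test function
  by a linear factor, which leaves it a test function.\<close>

lemma fourier_test_schwartz:
  assumes "\<phi> \<in> test_functions"
  shows "fourier \<phi> \<in> schwartz"
proof (rule schwartz_coinduct[of _ "fourier ` test_functions"])
  show "fourier \<phi> \<in> fourier ` test_functions" using assms by blast
  fix F :: "'a \<Rightarrow> complex" assume "F \<in> fourier ` test_functions"
  then obtain \<psi> where \<psi>: "\<psi> \<in> test_functions" and F: "F = fourier \<psi>" by blast
  show "F differentiable at x" for x
    unfolding F using fourier_has_derivative[OF \<psi>] by (rule differentiableI)
  show "partial b F \<in> fourier ` test_functions" if "b \<in> Basis" for b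
    unfolding F partial_fourier[OF \<psi>]
    by (intro imageI test_mult[OF _ smooth_const] test_mult[OF _ smooth_inner] \<psi>)
  show "\<exists>B. \<forall>x. (1 + norm x) ^ N * norm (F x) \<le> B" for N
    unfolding F by (rule fourier_test_decay[OF \<psi>])
qed

section \<open>Vanishing outside the support\<close>

text \<open>The support is an intersection of closed sets off each of which \<open>w\<close>
  vanishes; that \<open>w\<close> vanishes off the intersection is a local-to-global statement.
  Compactness of the support of \<open>\<phi>\<close> gives a finite cover by balls, and cutoffs
  peel off one ball at a time.\<close>

lemma vanishes_outside_dist_support:
  fixes w :: "('a::euclidean_space \<Rightarrow> complex) \<Rightarrow> complex"
  assumes add: "\<And>\<phi> \<psi>. \<phi> \<in> test_functions \<Longrightarrow> \<psi> \<in> test_functions \<Longrightarrow> w (\<lambda>x. \<phi> x + \<psi> x) = w \<phi> + w \<psi>"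
    and \<phi>: "\<phi> \<in> test_functions" and disj: "fun_support \<phi> \<inter> dist_support w = {}"
  shows "w \<phi> = 0"
proof -
  define van where "van K \<longleftrightarrow> closed K \<and> (\<forall>\<phi>\<in>test_functions. fun_support \<phi> \<inter> K = {} \<longrightarrow> w \<phi> = 0)" for K
  have zero: "w (\<lambda>x. 0) = 0"
    using add[of "\<lambda>x. 0" "\<lambda>x. 0"] test_functionsI[OF smooth_const[of 0] compact_empty] by simp
  \<comment> \<open>The radius is doubled because the cutoff below is \<open>1\<close> on the ball
    of radius \<open>r p\<close> but is only known to vanish outside the ball of radius
    \<open>2 * r p\<close>.\<close>
  have "\<forall>p\<in>fun_support \<phi>. \<exists>r>0. \<exists>K. van K \<and> cball p (2 * r) \<inter> K = {}"
  proof
    fix p assume "p \<in> fun_support \<phi>"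
    then obtain K where K: "van K" "p \<notin> K"
      using disj unfolding dist_support_def van_def by blast
    then obtain e where e: "e > 0" "ball p e \<subseteq> - K"
      unfolding van_def by (metis ComplI openE open_Compl)
    moreover from e(1) have "cball p (2 * (e / 3)) \<subseteq> ball p e" by auto
    ultimately have "cball p (2 * (e / 3)) \<inter> K = {}" by blast
    then show "\<exists>r>0. \<exists>K. van K \<and> cball p (2 * r) \<inter> K = {}"
      using K e by (intro exI[of _ "e / 3"]) auto
  qed
  then obtain r where r: "\<And>p. p \<in> fun_support \<phi> \<Longrightarrow> r p > 0 \<and> (\<exists>K. van K \<and> cball p (2 * r p) \<inter> K = {})"
    by metis
  obtain F where F: "F \<subseteq> fun_support \<phi>" "finite F" "fun_support \<phi> \<subseteq> (\<Union>p\<in>F. ball p (r p))"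
    by (rule compactE_image[OF test_compact[OF \<phi>], of "fun_support \<phi>" "\<lambda>p. ball p (r p)"])
      (use r in \<open>auto intro!: bexI\<close>)
  have "\<psi> \<in> test_functions \<Longrightarrow> fun_support \<psi> \<subseteq> (\<Union>p\<in>F. ball p (r p)) \<Longrightarrow> w \<psi> = 0" for \<psi>
    using F(2,1)
  proof (induction F arbitrary: \<psi> rule: finite_induct)
    case empty
    then have "\<psi> = (\<lambda>x. 0)" using fun_support_cong_zero by fastforce
    then show ?case using zero by simp
  next
    case (insert p F)
    then have rp: "r p > 0" using r by blast
    obtain K where K: "van K" "cball p (2 * r p) \<inter> K = {}" using r insert.prems by blast
    define b where "b x = bump ((1 / r p) *\<^sub>R x + (- (1 / r p) *\<^sub>R p))" for x
    have b_arg: "norm ((1 / r p) *\<^sub>R x + (- (1 / r p) *\<^sub>R p)) = dist p x / r p" for x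
      using rp by (simp add: dist_norm norm_minus_commute flip: scaleR_diff_right)
    have b1: "b x = 1" if "x \<in> cball p (r p)" for x
      unfolding b_def using that rp by (intro bump_eq_1) (simp add: b_arg del: scaleR_minus_left)
    have b0: "b x = 0" if "x \<notin> cball p (2 * r p)" for x
      unfolding b_def using that rp by (intro bump_eq_0) (simp add: b_arg field_simps del: scaleR_minus_left)
    have bs: "smooth b" unfolding b_def[abs_def] by (intro smooth_affine smooth_bump)
    have t1: "(\<lambda>x. b x * \<psi> x) \<in> test_functions" and t2: "(\<lambda>x. (1 - b x) * \<psi> x) \<in> test_functions"
      using insert.prems bs by (auto intro!: test_mult smooth_diff smooth_const)
    have "fun_support (\<lambda>x. b x * \<psi> x) \<subseteq> cball p (2 * r p)"
      by (rule fun_support_subset) (use b0 in auto)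
    then have "w (\<lambda>x. b x * \<psi> x) = 0" using K t1 unfolding van_def by blast
    moreover have "fun_support (\<lambda>x. (1 - b x) * \<psi> x) \<subseteq> fun_support \<psi> - ball p (r p)"
      by (rule fun_support_subset) (use b1 in \<open>auto simp: closed_fun_support closed_Diff fun_support_cong_zero\<close>)
    then have "fun_support (\<lambda>x. (1 - b x) * \<psi> x) \<subseteq> (\<Union>p\<in>F. ball p (r p))" using insert.prems by blast
    then have "w (\<lambda>x. (1 - b x) * \<psi> x) = 0" using insert t2 by blast
    ultimately show ?case using add[OF t1 t2] by (simp add: algebra_simps)
  qed
  then show ?thesis using \<phi> F by blast
qed

lemma tempered_fourier_vanishes:
  assumes u: "tempered_distribution u"
    and "\<phi> \<in> test_functions" "fun_support \<phi> \<inter> dist_support (dist_fourier u) = {}"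
  shows "u (fourier \<phi>) = 0"
  using vanishes_outside_dist_support[of "dist_fourier u" \<phi>] assms
  by (simp add: dist_fourier_def fourier_add test_integrable tempered_distribution_def fourier_test_schwartz)

section \<open>Integrals over dyadic cubes\<close>

lemma mem_centred_cube:
  assumes "norm (w - c) \<le> h"
  shows "w \<in> cube (c - h *\<^sub>R One) (2 * h)"
proof -
  have "\<bar>(w - c) \<bullet> b\<bar> \<le> h" if "b \<in> Basis" for b
    using Basis_le_norm[OF that, of "w - c"] assms by linarith
  then show ?thesis
    by (force simp: cube_def mem_box inner_simps abs_le_iff)
qed

lemma cube_measurable [measurable]: "cube a l \<in> sets borel"
  by (simp add: cube_def)

lemma emeasure_cube:
  fixes a :: "'a::euclidean_space"
  assumes "0 \<le> l"
  shows "emeasure lborel (cube a l) = ennreal (l ^ DIM('a))"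
  unfolding cube_def using assms by (subst emeasure_lborel_cbox) (auto simp: inner_simps)

text \<open>Each point is charged to the smallest dyadic index \<open>j\<close> with
  \<open>\<kappa> * norm (w - c) / a \<le> 2 ^ j\<close>. Minimality gives
  \<open>W w \<ge> 2 powr (j - 1)\<close>; for \<open>j = 0\<close> this follows from
  \<open>W w \<ge> 1\<close>. The shells are enlarged to whole cubes, since cubes are what the
  maximal function controls.\<close>

lemma nn_integral_le_dyadic_cubes:
  fixes F :: "'a::euclidean_space \<Rightarrow> ennreal" and W :: "'a \<Rightarrow> real"
  assumes [measurable]: "F \<in> borel_measurable borel"
    and lam: "\<kappa> > 0" and a: "a > 0" and \<gamma>: "\<gamma> \<ge> 0"
    and W1: "\<And>w. W w \<ge> 1" and W2: "\<And>w. W w \<ge> \<kappa> * norm (w - c) / a"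
  shows "(\<integral>\<^sup>+w. F w * ennreal (W w powr (- \<gamma>)) \<partial>lborel) \<le>
    (\<Sum>j. ennreal (2 powr (- \<gamma> * (real j - 1))) *
      (\<integral>\<^sup>+w\<in>cube (c - (a * 2 ^ j / \<kappa>) *\<^sub>R One) (2 * (a * 2 ^ j / \<kappa>)). F w \<partial>lborel))"
proof -
  define Q where "Q j = cube (c - (a * 2 ^ j / \<kappa>) *\<^sub>R One) (2 * (a * 2 ^ j / \<kappa>))" for j :: nat
  have [measurable]: "Q j \<in> sets borel" for j by (simp add: Q_def cube_measurable)
  have pt: "F w * ennreal (W w powr (- \<gamma>)) \<le>
      (\<Sum>j. ennreal (2 powr (- \<gamma> * (real j - 1))) * (F w * indicator (Q j) w))" for w
  proof -
    have "\<exists>j::nat. \<kappa> * norm (w - c) / a \<le> 2 ^ j"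
      using real_arch_pow[of 2 "\<kappa> * norm (w - c) / a"] by (auto intro: less_imp_le)
    then obtain j :: nat where j: "\<kappa> * norm (w - c) / a \<le> 2 ^ j"
      and jmin: "\<And>i. i < j \<Longrightarrow> \<not> \<kappa> * norm (w - c) / a \<le> 2 ^ i"
      using exists_least_iff[of "\<lambda>j. \<kappa> * norm (w - c) / a \<le> 2 ^ j"] by blast
    have "w \<in> Q j" unfolding Q_def
      by (rule mem_centred_cube) (use j lam a in \<open>simp add: field_simps\<close>)
    have "2 powr (real j - 1) \<le> W w"
    proof (cases j)
      case 0
      then show ?thesis using W1[of w] by (simp add: powr_minus)
    next
      case (Suc i)
      then show ?thesis using jmin[of i] W2[of w] by (simp add: powr_realpow)
    qed
    then have "W w powr (- \<gamma>) \<le> (2 powr (real j - 1)) powr (- \<gamma>)"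
      using \<gamma> by (intro powr_mono2') auto
    then have "F w * ennreal (W w powr (- \<gamma>)) \<le> F w * ennreal (2 powr (- \<gamma> * (real j - 1)))"
      by (intro mult_left_mono ennreal_leI) (auto simp: powr_powr mult.commute)
    also have "\<dots> = (\<Sum>j\<in>{j}. ennreal (2 powr (- \<gamma> * (real j - 1))) * (F w * indicator (Q j) w))"
      using \<open>w \<in> Q j\<close> by (simp add: mult.commute)
    also have "\<dots> \<le> (\<Sum>j. ennreal (2 powr (- \<gamma> * (real j - 1))) * (F w * indicator (Q j) w))"
      by (rule sum_le_suminf) auto
    finally show ?thesis .
  qed
  have "(\<integral>\<^sup>+w. F w * ennreal (W w powr (- \<gamma>)) \<partial>lborel) \<le>
     (\<integral>\<^sup>+w. (\<Sum>j. ennreal (2 powr (- \<gamma> * (real j - 1))) * (F w * indicator (Q j) w)) \<partial>lborel)"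
    by (intro nn_integral_mono pt)
  also have "\<dots> = (\<Sum>j. ennreal (2 powr (- \<gamma> * (real j - 1))) * (\<integral>\<^sup>+w\<in>Q j. F w \<partial>lborel))"
    by (subst nn_integral_suminf) (simp_all add: nn_integral_cmult)
  finally show ?thesis by (simp add: Q_def)
qed

lemma suminf_geometric_ennreal:
  assumes "0 \<le> q" "q < 1" "0 \<le> b"
  shows "(\<Sum>j. ennreal (b * q ^ j)) = ennreal (b / (1 - q))"
proof -
  have "(\<lambda>j. b * q ^ j) sums (b * (1 / (1 - q)))"
    using assms by (intro sums_mult geometric_sums) auto
  then show ?thesis
    using assms by (subst suminf_ennreal2) (auto simp: sums_iff)
qed

text \<open>With decay exponent \<open>d + 1\<close> the \<open>j\<close>-th cube, of volume
  \<open>(2 * 2^j / \<kappa>)^d\<close>, contributes \<open>2^(2 d + 1 - j) / \<kappa>^d\<close>;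
  the geometric series supplies the last factor \<open>2\<close>.\<close>

lemma nn_integral_decay:
  fixes z :: "'a::euclidean_space"
  assumes lam: "\<kappa> > 0"
  shows "ennreal (\<kappa> ^ DIM('a)) * (\<integral>\<^sup>+w. ennreal ((1 + \<kappa> * norm (z - w)) powr (- (real DIM('a) + 1))) \<partial>lborel)
    \<le> ennreal (2 ^ (2 * DIM('a) + 2))"
proof -
  let ?d = "DIM('a)"
  have "(\<integral>\<^sup>+w. 1 * ennreal ((1 + \<kappa> * norm (z - w)) powr (- (real ?d + 1))) \<partial>lborel) \<le>
    (\<Sum>j. ennreal (2 powr (- (real ?d + 1) * (real j - 1))) *
      (\<integral>\<^sup>+w\<in>cube (z - (1 * 2 ^ j / \<kappa>) *\<^sub>R One) (2 * (1 * 2 ^ j / \<kappa>)). 1 \<partial>lborel))"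
    by (rule nn_integral_le_dyadic_cubes) (use lam in \<open>auto simp: norm_minus_commute\<close>)
  also have "\<dots> = (\<Sum>j. ennreal ((2 ^ (2 * ?d + 1) / \<kappa> ^ ?d) * (1 / 2) ^ j))"
  proof (rule arg_cong[where f = suminf], rule ext)
    fix j :: nat
    have "2 powr (- (real ?d + 1) * (real j - 1)) * (2 * (2 ^ j / \<kappa>)) ^ ?d =
       (2 powr (- (real ?d + 1) * (real j - 1)) * (2 powr (1 + real j)) powr ?d) / \<kappa> ^ ?d"
      by (simp add: powr_add powr_realpow power_divide)
    also have "\<dots> = 2 powr (2 * real ?d + 1 - real j) / \<kappa> ^ ?d"
      by (simp add: powr_powr flip: powr_add) (simp add: algebra_simps)
    also have "\<dots> = (2 ^ (2 * ?d + 1) / \<kappa> ^ ?d) * (1 / 2) ^ j"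
    proof -
      have "2 powr (2 * real ?d + 1 - real j) = 2 powr real (2 * ?d + 1) / 2 powr real j"
        unfolding powr_diff[symmetric] by (simp add: add.commute)
      also have "\<dots> = 2 ^ (2 * ?d + 1) / 2 ^ j" by (subst (1 2) powr_realpow) auto
      finally show ?thesis by (simp add: power_divide)
    qed
    finally have eq: "2 powr (- (real ?d + 1) * (real j - 1)) * (2 * (2 ^ j / \<kappa>)) ^ ?d =
      (2 ^ (2 * ?d + 1) / \<kappa> ^ ?d) * (1 / 2) ^ j" .
    have "(\<integral>\<^sup>+w\<in>cube (z - (1 * 2 ^ j / \<kappa>) *\<^sub>R One) (2 * (1 * 2 ^ j / \<kappa>)). 1 \<partial>lborel) =
      ennreal ((2 * (2 ^ j / \<kappa>)) ^ ?d)"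
      using lam by (simp add: emeasure_cube)
    then show "ennreal (2 powr (- (real ?d + 1) * (real j - 1))) *
      (\<integral>\<^sup>+w\<in>cube (z - (1 * 2 ^ j / \<kappa>) *\<^sub>R One) (2 * (1 * 2 ^ j / \<kappa>)). 1 \<partial>lborel) =
      ennreal ((2 ^ (2 * ?d + 1) / \<kappa> ^ ?d) * (1 / 2) ^ j)"
      using lam by (simp only: ennreal_mult'[symmetric] powr_ge_zero eq)
  qed
  also have "\<dots> = ennreal (2 ^ (2 * ?d + 2) / \<kappa> ^ ?d)"
    using lam by (subst suminf_geometric_ennreal) auto
  finally have "ennreal (\<kappa> ^ ?d) * (\<integral>\<^sup>+w. ennreal ((1 + \<kappa> * norm (z - w)) powr (- (real ?d + 1))) \<partial>lborel)
      \<le> ennreal (\<kappa> ^ ?d) * ennreal (2 ^ (2 * ?d + 2) / \<kappa> ^ ?d)"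
    by (intro mult_left_mono) auto
  also have "\<dots> = ennreal (2 ^ (2 * ?d + 2))"
    using lam by (simp flip: ennreal_mult)
  finally show ?thesis .
qed

section \<open>From weighted integrals to pointwise bounds\<close>

lemma peetre_weight_submultiplicative:
  fixes x y z :: "'a::real_normed_vector"
  assumes "\<kappa> \<ge> 0"
  shows "1 + \<kappa> * norm (x - z) \<le> (1 + \<kappa> * norm (x - y)) * (1 + \<kappa> * norm (y - z))"
proof -
  have "norm (x - z) \<le> norm (x - y) + norm (y - z)"
    using norm_triangle_ineq[of "x - y" "y - z"] by simp
  then have "\<kappa> * norm (x - z) \<le> \<kappa> * norm (x - y) + \<kappa> * norm (y - z)"
    using assms by (metis mult_left_mono distrib_left)
  moreover have "0 \<le> (\<kappa> * norm (x - y)) * (\<kappa> * norm (y - z))" using assms by simp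
  ultimately show ?thesis by (simp add: algebra_simps)
qed

text \<open>Only the cubes of side length \<open>> 1/\<kappa>\<close> are needed. Young's inequality in the crude form
  \<open>y\<^sup>s \<le> 1 + y\<^sup>t\<close> replaces Hoelder's, and the factor \<open>2\<^sup>2\<^sup>p\<^sup>+\<^sup>1\<close> absorbs everything that is
  raised to the power \<open>t\<close>, which keeps the bound uniform in \<open>t\<close>.\<close>

lemma weighted_integral_le_cube_bound:
  fixes f :: "'a::euclidean_space \<Rightarrow> complex" and x z :: 'a
  assumes [measurable]: "f \<in> borel_measurable borel"
    and lam: "\<kappa> > 0" and D: "D > 0" and s: "0 < s" "s \<le> t" and r: "0 < r" "r \<le> t" and p: "p \<ge> 0"
    and cubes: "\<And>a l. 0 < l \<Longrightarrow> 1 < \<kappa> * l \<Longrightarrow> x \<in> cube a l \<Longrightarrow>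
      ennreal (\<kappa> ^ DIM('a)) * (\<integral>\<^sup>+w\<in>cube a l. ennreal (norm (f w) powr t) \<partial>lborel) \<le>
        ennreal ((D * (\<kappa> * l) powr p) powr t)"
    and L: "L \<ge> p + 1 + (real DIM('a) + 1) / s"
  shows "ennreal (\<kappa> ^ DIM('a)) *
      (\<integral>\<^sup>+w. ennreal (norm (f w) powr s * (1 + \<kappa> * norm (z - w)) powr (- L * s)) \<partial>lborel)
    \<le> ennreal ((2 powr (2 * p + 1) * D * (1 + \<kappa> * norm (x - z)) powr p) powr s *
        (2 ^ (2 * DIM('a) + 2) + 1 / (1 - 2 powr (- r))))"
proof -
  let ?d = "DIM('a)"
  \<comment> \<open>The integral is centred at \<open>z\<close>, the maximal function is taken at
    \<open>x\<close>. Dyadic cubes around \<open>x\<close> absorb the shift when they start at scale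
    \<open>a / \<kappa>\<close>.\<close>
  define a where "a = 1 + \<kappa> * norm (x - z)"
  define G where "G = 2 powr (2 * p + 1) * D * a powr p"
  define W where "W w = 1 + \<kappa> * norm (z - w)" for w
  have a1: "a \<ge> 1" using lam by (simp add: a_def)
  have G0: "G > 0" using D a1 by (simp add: G_def)
  have W1: "W w \<ge> 1" for w using lam by (simp add: W_def)
  have Wpos: "W w > 0" for w using W1[of w] by linarith
  have [measurable]: "W \<in> borel_measurable borel" by (simp add: W_def[abs_def])
  have t0: "t > 0" using s by simp
  have W2: "W w \<ge> \<kappa> * norm (w - x) / a" for w
  proof -
    have "\<kappa> * norm (w - x) \<le> 1 + \<kappa> * norm (x - w)" by (simp add: norm_minus_commute)
    also have "\<dots> \<le> a * W w"
      unfolding a_def W_def using lam by (intro peetre_weight_submultiplicative) simp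
    finally show ?thesis using a1 by (simp add: divide_le_eq mult.commute)
  qed
  have pt: "norm (f w) powr s * W w powr (- L * s) \<le>
     G powr s * W w powr (- (real ?d + 1)) + G powr s * G powr (- t) * (norm (f w) powr t * W w powr (- ((p + 1) * t)))" for w
  proof -
    define y where "y = norm (f w) / G * W w powr (- (p + 1))"
    have y0: "y \<ge> 0" using G0 by (simp add: y_def)
    have ys: "y powr s \<le> 1 + y powr t"
    proof (cases "y \<le> 1")
      case True
      then have "y powr s \<le> 1" using y0 s by (intro powr_le1) auto
      then show ?thesis by (simp add: add_increasing2)
    next
      case False
      then have "y powr s \<le> y powr t" using s by (intro powr_mono) auto
      then show ?thesis by simp
    qed
    \<comment> \<open>The decay \<open>L s\<close> covers two demands: \<open>(p + 1) s\<close>,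
      absorbed into \<open>y\<close>, and \<open>d + 1\<close>, which makes the constant term of
      \<open>1 + y powr t\<close> integrable.\<close>
    have "(p + 1 + (real ?d + 1) / s) * s \<le> L * s" using L s by (intro mult_right_mono) auto
    moreover have "(p + 1 + (real ?d + 1) / s) * s = (p + 1) * s + (real ?d + 1)"
      using s by (subst distrib_right) simp
    ultimately have e: "- L * s \<le> - (p + 1) * s - (real ?d + 1)" by (simp add: algebra_simps)
    have "norm (f w) powr s * W w powr (- L * s) \<le> norm (f w) powr s * W w powr (- (p + 1) * s - (real ?d + 1))"
      using W1[of w] e by (intro mult_left_mono powr_mono) auto
    also have "\<dots> = G powr s * y powr s * W w powr (- (real ?d + 1))"
    proof -
      have "W w powr (- (p + 1) * s - (real ?d + 1)) = (W w powr (- (p + 1))) powr s * W w powr (- (real ?d + 1))"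
        unfolding powr_powr powr_add[symmetric] by (simp only: diff_conv_add_uminus)
      moreover have "norm (f w) powr s = G powr s * (norm (f w) / G) powr s"
        using G0 by (simp add: powr_divide)
      moreover have "y powr s = (norm (f w) / G) powr s * (W w powr (- (p + 1))) powr s"
        unfolding y_def by (rule powr_mult)
      ultimately show ?thesis by (simp only: mult.assoc)
    qed
    also have "\<dots> \<le> G powr s * (1 + y powr t) * W w powr (- (real ?d + 1))"
      by (intro mult_right_mono mult_left_mono ys) auto
    also have "\<dots> = G powr s * W w powr (- (real ?d + 1)) + G powr s * y powr t * W w powr (- (real ?d + 1))"
      by (simp add: algebra_simps)
    also have "\<dots> \<le> G powr s * W w powr (- (real ?d + 1)) + G powr s * y powr t * 1"
    proof -
      have "W w powr (- (real ?d + 1)) \<le> W w powr 0" using W1[of w] by (intro powr_mono) auto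
      then show ?thesis using Wpos[of w] by (intro add_mono mult_left_mono) auto
    qed
    also have "y powr t = G powr (- t) * (norm (f w) powr t * W w powr (- ((p + 1) * t)))"
    proof -
      have "(W w powr (- (p + 1))) powr t = W w powr (- ((p + 1) * t))"
        by (simp only: powr_powr mult_minus_left)
      moreover have "(norm (f w) / G) powr t = norm (f w) powr t * G powr (- t)"
        using G0 by (simp add: powr_divide powr_minus_divide)
      ultimately show ?thesis unfolding y_def powr_mult by (simp only: mult_ac)
    qed
    finally show ?thesis by (simp add: mult.assoc)
  qed
  have A: "ennreal (\<kappa> ^ ?d) * (\<integral>\<^sup>+w. ennreal (W w powr (- (real ?d + 1))) \<partial>lborel) \<le> ennreal (2 ^ (2 * ?d + 2))"
    using nn_integral_decay[OF lam, of z] by (simp add: W_def)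
  have B: "ennreal (\<kappa> ^ ?d) * (\<integral>\<^sup>+w. ennreal (norm (f w) powr t * W w powr (- ((p + 1) * t))) \<partial>lborel)
     \<le> ennreal (G powr t * (1 / (1 - 2 powr (- r))))"
  proof -
    define Q where "Q j = cube (x - (a * 2 ^ j / \<kappa>) *\<^sub>R One) (2 * (a * 2 ^ j / \<kappa>))" for j :: nat
    have "(\<integral>\<^sup>+w. ennreal (norm (f w) powr t) * ennreal (W w powr (- ((p + 1) * t))) \<partial>lborel) \<le>
      (\<Sum>j. ennreal (2 powr (- ((p + 1) * t) * (real j - 1))) * (\<integral>\<^sup>+w\<in>Q j. ennreal (norm (f w) powr t) \<partial>lborel))"
      unfolding Q_def
      by (rule nn_integral_le_dyadic_cubes) (use W1 W2 a1 lam p t0 in auto)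
    then have "ennreal (\<kappa> ^ ?d) * (\<integral>\<^sup>+w. ennreal (norm (f w) powr t) * ennreal (W w powr (- ((p + 1) * t))) \<partial>lborel) \<le>
      ennreal (\<kappa> ^ ?d) * (\<Sum>j. ennreal (2 powr (- ((p + 1) * t) * (real j - 1))) * (\<integral>\<^sup>+w\<in>Q j. ennreal (norm (f w) powr t) \<partial>lborel))"
      by (intro mult_left_mono) auto
    also have "\<dots> = (\<Sum>j. ennreal (2 powr (- ((p + 1) * t) * (real j - 1))) * (ennreal (\<kappa> ^ ?d) * (\<integral>\<^sup>+w\<in>Q j. ennreal (norm (f w) powr t) \<partial>lborel)))"
      unfolding ennreal_suminf_cmult[symmetric] by (simp only: mult.left_commute)
    also have "\<dots> \<le> (\<Sum>j. ennreal (G powr t * (2 powr (- t)) ^ j))"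
    proof (intro suminf_le summableI)
      fix j :: nat
      \<comment> \<open>Every cube has \<open>\<kappa> l = 2 a 2^j \<ge> 2\<close>, so the
        hypothesis \<open>cubes\<close> applies to all of them, including
        \<open>j = 0\<close>.\<close>
      have "1 * 1 \<le> a * 2 ^ j" using a1 by (intro mult_mono) auto
      then have big: "1 < \<kappa> * (2 * (a * 2 ^ j / \<kappa>))" using lam by simp
      have "ennreal (\<kappa> ^ ?d) * (\<integral>\<^sup>+w\<in>Q j. ennreal (norm (f w) powr t) \<partial>lborel) \<le>
         ennreal ((D * (\<kappa> * (2 * (a * 2 ^ j / \<kappa>))) powr p) powr t)"
        unfolding Q_def by (intro cubes big mem_centred_cube) (use a1 lam in auto)
      then have "ennreal (2 powr (- ((p + 1) * t) * (real j - 1))) * (ennreal (\<kappa> ^ ?d) * (\<integral>\<^sup>+w\<in>Q j. ennreal (norm (f w) powr t) \<partial>lborel))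
        \<le> ennreal (2 powr (- ((p + 1) * t) * (real j - 1))) * ennreal ((D * (\<kappa> * (2 * (a * 2 ^ j / \<kappa>))) powr p) powr t)"
        by (intro mult_left_mono) auto
      also have "\<dots> = ennreal ((2 powr (- (p + 1) * (real j - 1)) * (D * (2 powr (1 + j) * a) powr p)) powr t)"
      proof -
        have "\<kappa> * (2 * (a * 2 ^ j / \<kappa>)) = 2 powr (1 + j) * a"
          using lam by (simp add: powr_add powr_realpow)
        moreover have "2 powr (- ((p + 1) * t) * (real j - 1)) = (2 powr (- (p + 1) * (real j - 1))) powr t"
          unfolding powr_powr by (simp add: algebra_simps)
        ultimately show ?thesis using D a1 by (simp add: powr_mult flip: ennreal_mult)
      qed
      \<comment> \<open>The exponents of \<open>2\<close> add up to
        \<open>(1 + j) p - (p + 1) (j - 1) = 2 p + 1 - j\<close>: the surplus \<open>1\<close> in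
        \<open>p + 1\<close> leaves the summable factor \<open>2^(-j)\<close>.\<close>
      also have "2 powr (- (p + 1) * (real j - 1)) * (D * (2 powr (1 + j) * a) powr p) = G * 2 powr (- real j)"
      proof -
        have "2 powr (- (p + 1) * (real j - 1)) * (D * (2 powr (1 + j) * a) powr p) =
          (2 powr (- (p + 1) * (real j - 1)) * 2 powr ((1 + j) * p)) * (D * a powr p)"
          using a1 by (simp add: powr_mult powr_powr mult_ac)
        also have "2 powr (- (p + 1) * (real j - 1)) * 2 powr ((1 + j) * p) = 2 powr (2 * p + 1) * 2 powr (- real j)"
          unfolding powr_add[symmetric] by (simp add: algebra_simps)
        finally show ?thesis by (simp only: G_def mult_ac)
      qed
      also have "(G * 2 powr (- real j)) powr t = G powr t * (2 powr (- t)) ^ j"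
        using G0 by (simp add: powr_mult powr_powr mult.commute flip: powr_realpow)
      finally show "ennreal (2 powr (- ((p + 1) * t) * (real j - 1))) * (ennreal (\<kappa> ^ ?d) * (\<integral>\<^sup>+w\<in>Q j. ennreal (norm (f w) powr t) \<partial>lborel))
         \<le> ennreal (G powr t * (2 powr (- t)) ^ j)" .
    qed
    also have "\<dots> = ennreal (G powr t / (1 - 2 powr (- t)))"
      using t0 by (intro suminf_geometric_ennreal) (auto simp: powr_less_one)
    \<comment> \<open>Here \<open>t\<close> leaves the series constant, through
      \<open>r \<le> t\<close>. The remaining \<open>G powr t\<close> is cancelled at the end by
      \<open>G powr (- t)\<close>.\<close>
    also have "\<dots> \<le> ennreal (G powr t * (1 / (1 - 2 powr (- r))))"
    proof -
      have "2 powr (- t) \<le> (2::real) powr (- r)" "2 powr (- r) < (1::real)" using r by (auto simp: powr_less_one)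
      then show ?thesis by (intro ennreal_leI) (simp add: frac_le)
    qed
    finally show ?thesis by (simp add: ennreal_mult')
  qed
  have "(\<integral>\<^sup>+w. ennreal (norm (f w) powr s * W w powr (- L * s)) \<partial>lborel) \<le>
    (\<integral>\<^sup>+w. ennreal (G powr s) * ennreal (W w powr (- (real ?d + 1))) +
       ennreal (G powr s * G powr (- t)) * ennreal (norm (f w) powr t * W w powr (- ((p + 1) * t))) \<partial>lborel)"
    using ennreal_leI[OF pt] by (intro nn_integral_mono) (simp add: ennreal_mult ennreal_plus)
  also have "\<dots> = ennreal (G powr s) * (\<integral>\<^sup>+w. ennreal (W w powr (- (real ?d + 1))) \<partial>lborel) +
      ennreal (G powr s * G powr (- t)) * (\<integral>\<^sup>+w. ennreal (norm (f w) powr t * W w powr (- ((p + 1) * t))) \<partial>lborel)"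
    by (simp add: nn_integral_add nn_integral_cmult)
  finally have "ennreal (\<kappa> ^ ?d) * (\<integral>\<^sup>+w. ennreal (norm (f w) powr s * W w powr (- L * s)) \<partial>lborel) \<le>
      ennreal (\<kappa> ^ ?d) * \<dots>"
    by (intro mult_left_mono) auto
  also have "\<dots> = ennreal (G powr s) * (ennreal (\<kappa> ^ ?d) * (\<integral>\<^sup>+w. ennreal (W w powr (- (real ?d + 1))) \<partial>lborel)) +
      ennreal (G powr s * G powr (- t)) * (ennreal (\<kappa> ^ ?d) * (\<integral>\<^sup>+w. ennreal (norm (f w) powr t * W w powr (- ((p + 1) * t))) \<partial>lborel))"
    by (simp add: distrib_left mult_ac)
  also have "\<dots> \<le> ennreal (G powr s) * ennreal (2 ^ (2 * ?d + 2)) +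
      ennreal (G powr s * G powr (- t)) * ennreal (G powr t * (1 / (1 - 2 powr (- r))))"
    by (intro add_mono mult_left_mono A B) auto
  also have "\<dots> = ennreal (G powr s * (2 ^ (2 * ?d + 2) + 1 / (1 - 2 powr (- r))))"
  proof -
    have "2 powr (- r) < (1::real)" using r by (simp add: powr_less_one)
    moreover have "G powr (- t) * G powr t = 1" using G0 by (simp flip: powr_add)
    then have "G powr s * G powr (- t) * (G powr t * (1 / (1 - 2 powr (- r)))) = G powr s * (1 / (1 - 2 powr (- r)))"
      by (simp add: mult.assoc)
    ultimately show ?thesis
      by (simp add: distrib_left del: times_divide_eq_right mult_1_right flip: ennreal_mult ennreal_plus)
  qed
  finally show ?thesis by (simp add: W_def G_def a_def)
qed

text \<open>\<open>T\<close> is the weighted supremum of \<open>f\<close>; splitting off \<open>T\<^sup>1\<^sup>-\<^sup>s\<close> from the integrand gives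
  \<open>T \<le> T\<^sup>1\<^sup>-\<^sup>s I\<close>, and dividing needs \<open>T < \<infinity>\<close>.\<close>

lemma powr_le_weighted_integral:
  fixes f :: "'a::euclidean_space \<Rightarrow> complex" and z :: 'a
  assumes [measurable]: "f \<in> borel_measurable borel"
    and lam: "\<kappa> > 0" and C: "C > 0" and s: "0 < s" "s \<le> 1" and L: "L \<ge> 0"
    and growth: "\<And>w. norm (f w) \<le> M * (1 + \<kappa> * norm (z - w)) powr L"
    and self: "\<And>v. ennreal (norm (f v)) \<le>
      ennreal C * (\<integral>\<^sup>+w. ennreal (norm (f w) * (1 + \<kappa> * norm (v - w)) powr (- L)) \<partial>lborel)"
  shows "ennreal (norm (f z) powr s) \<le>
    ennreal C * (\<integral>\<^sup>+w. ennreal (norm (f w) powr s * (1 + \<kappa> * norm (z - w)) powr (- L * s)) \<partial>lborel)"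
proof -
  define W where "W v w = 1 + \<kappa> * norm (v - w)" for v w :: 'a
  have W1: "W v w \<ge> 1" for v w using lam by (simp add: W_def)
  have Wpos: "W v w > 0" for v w using W1[of v w] by linarith
  have [measurable]: "W v \<in> borel_measurable borel" for v by (simp add: W_def[abs_def])
  define g where "g w = norm (f w) * W z w powr (- L)" for w
  define T where "T = (SUP w. g w)"
  define I where "I = (\<integral>\<^sup>+w. ennreal (norm (f w) powr s * W z w powr (- L * s)) \<partial>lborel)"
  have g0: "g w \<ge> 0" for w by (simp add: g_def)
  have "g w \<le> M" for w
    using growth[of w] Wpos[of z w] by (simp add: g_def W_def powr_minus divide_le_eq flip: divide_inverse)
  then have "bdd_above (range g)" by (auto simp: bdd_above_def)
  then have gT: "g w \<le> T" for w unfolding T_def by (rule cSUP_upper[OF UNIV_I])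
  have T0: "T \<ge> 0" using g0 gT order_trans by blast
  have gz: "g z = norm (f z)" by (simp add: g_def W_def)
  show ?thesis
  proof (cases "T = 0 \<or> I = \<infinity>")
    case True
    then show ?thesis
    proof
      assume "T = 0"
      then have "norm (f z) = 0" using gT[of z] gz by simp
      then show ?thesis using s by simp
    next
      assume "I = \<infinity>"
      then show ?thesis using C by (simp add: I_def W_def ennreal_mult_top)
    qed
  next
    case False
    then have Tpos: "T > 0" using T0 by auto
    obtain i where i: "I = ennreal i" "i \<ge> 0" using False by (cases I) auto
    \<comment> \<open>The bound is needed at every \<open>v\<close>, not just at \<open>z\<close>,
      since the supremum \<open>T\<close> is afterwards taken on the left. Submultiplicativity moves
      the weight from centre \<open>v\<close> to centre \<open>z\<close>.\<close>
    have bound: "ennreal (g v) \<le> ennreal (T powr (1 - s) * (C * i))" for v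
    proof -
      have "ennreal (g v) = ennreal (W z v powr (- L)) * ennreal (norm (f v))"
        by (simp add: g_def ennreal_mult' mult.commute)
      also have "\<dots> \<le> ennreal (W z v powr (- L)) * (ennreal C * (\<integral>\<^sup>+w. ennreal (norm (f w) * W v w powr (- L)) \<partial>lborel))"
        using self[of v] by (intro mult_left_mono) (auto simp: W_def)
      also have "\<dots> = ennreal C * (\<integral>\<^sup>+w. ennreal (W z v powr (- L)) * ennreal (norm (f w) * W v w powr (- L)) \<partial>lborel)"
        by (subst nn_integral_cmult) (auto simp: mult.left_commute)
      also have "\<dots> \<le> ennreal C * (\<integral>\<^sup>+w. ennreal (T powr (1 - s)) * ennreal (norm (f w) powr s * W z w powr (- L * s)) \<partial>lborel)"
      proof (intro mult_left_mono nn_integral_mono)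
        fix w
        have "W z w powr L \<le> (W z v * W v w) powr L"
          using L Wpos[of z w] lam unfolding W_def
          by (intro powr_mono2 peetre_weight_submultiplicative) (auto simp: less_imp_le)
        then have "W z v powr (- L) * W v w powr (- L) \<le> W z w powr (- L)"
          using Wpos[of z w] Wpos[of z v] Wpos[of v w]
          by (simp add: powr_minus powr_mult le_imp_inverse_le flip: inverse_mult_distrib)
        then have "W z v powr (- L) * (norm (f w) * W v w powr (- L)) \<le> g w"
          using mult_left_mono[of _ _ "norm (f w)"] by (force simp: g_def mult_ac)
        also have "g w = g w powr (1 - s) * g w powr s"
          using g0[of w] by (cases "g w = 0") (auto simp flip: powr_add)
        also have "\<dots> \<le> T powr (1 - s) * g w powr s"
          using g0 gT s by (intro mult_right_mono powr_mono2) auto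
        also have "g w powr s = norm (f w) powr s * W z w powr (- L * s)"
          using Wpos[of z w] by (simp add: g_def powr_mult powr_powr)
        finally show "ennreal (W z v powr (- L)) * ennreal (norm (f w) * W v w powr (- L))
           \<le> ennreal (T powr (1 - s)) * ennreal (norm (f w) powr s * W z w powr (- L * s))"
          by (simp add: ennreal_leI flip: ennreal_mult)
      qed auto
      also have "\<dots> = ennreal C * (ennreal (T powr (1 - s)) * I)"
        unfolding I_def by (subst nn_integral_cmult) auto
      also have "\<dots> = ennreal (T powr (1 - s) * (C * i))"
        using C i by (simp add: mult_ac flip: ennreal_mult)
      finally show ?thesis .
    qed
    have "g v \<le> T powr (1 - s) * (C * i)" for v
      using bound[of v] C i by (subst (asm) ennreal_le_iff) auto
    then have "T \<le> T powr (1 - s) * (C * i)"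
      unfolding T_def by (intro cSUP_least) (auto simp: T_def)
    then have "T powr (1 - s) * T powr s \<le> T powr (1 - s) * (C * i)"
      using Tpos by (simp flip: powr_add)
    then have "T powr s \<le> C * i" using Tpos by simp
    moreover have "norm (f z) powr s \<le> T powr s"
      using gT[of z] gz s by (intro powr_mono2) auto
    ultimately have "ennreal (norm (f z) powr s) \<le> ennreal (C * i)" by (intro ennreal_leI) simp
    then show ?thesis using C i by (simp add: ennreal_mult' I_def W_def)
  qed
qed

section \<open>Schwartz functions and continuity of tempered distributions\<close>

lemma schwartz_partial: "\<phi> \<in> schwartz \<Longrightarrow> b \<in> Basis \<Longrightarrow> partial b \<phi> \<in> schwartz"
proof (rule schwartzI)
  assume \<phi>: "\<phi> \<in> schwartz" "b \<in> Basis"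
  then show "smooth (partial b \<phi>)" by (intro smooth_partial schwartz_smooth)
  fix N and bs :: "'a list" assume "set bs \<subseteq> Basis"
  with \<phi> show "\<exists>B. \<forall>x. (1 + norm x) ^ N * norm (iterated_partial bs (partial b \<phi>) x) \<le> B"
    using schwartz_bound[OF \<phi>(1), of "bs @ [b]" N] by (simp add: iterated_partial_snoc)
qed

lemma schwartz_cmult: "\<phi> \<in> schwartz \<Longrightarrow> (\<lambda>x. c * \<phi> x) \<in> schwartz"
proof (rule schwartzI)
  assume \<phi>: "\<phi> \<in> schwartz"
  then show "smooth (\<lambda>x. c * \<phi> x)" by (intro smooth_cmult schwartz_smooth)
  fix N and bs :: "'a list" assume bs: "set bs \<subseteq> Basis"
  obtain B where B: "\<And>x. (1 + norm x) ^ N * norm (iterated_partial bs \<phi> x) \<le> B"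
    using schwartz_bound[OF \<phi> bs] by blast
  have "(1 + norm x) ^ N * norm (iterated_partial bs (\<lambda>x. c * \<phi> x) x) \<le> norm c * B" for x
    using mult_left_mono[OF B[of x] norm_ge_zero[of c]]
    by (simp add: iterated_partial_cmult \<phi> schwartz_smooth bs norm_mult mult_ac)
  then show "\<exists>B. \<forall>x. (1 + norm x) ^ N * norm (iterated_partial bs (\<lambda>x. c * \<phi> x) x) \<le> B" by blast
qed

lemma schwartz_affine:
  assumes \<phi>: "\<phi> \<in> schwartz" and c: "c \<noteq> 0"
  shows "(\<lambda>x. \<phi> (c *\<^sub>R x + v)) \<in> schwartz"
proof (rule schwartzI)
  show "smooth (\<lambda>x. \<phi> (c *\<^sub>R x + v))" using \<phi> by (intro smooth_affine schwartz_smooth)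
  fix N and bs :: "'a list" assume bs: "set bs \<subseteq> Basis"
  obtain B where B: "\<And>x. (1 + norm x) ^ N * norm (iterated_partial bs \<phi> x) \<le> B"
    using schwartz_bound[OF \<phi> bs] by blast
  \<comment> \<open>\<open>E\<close> compares the weights before and after the substitution,
    starting from \<open>|c| |x| \<le> |c x + v| + |v|\<close>.\<close>
  define E where "E = 1 + (1 + norm v) / \<bar>c\<bar>"
  have E: "1 + norm x \<le> E * (1 + norm (c *\<^sub>R x + v))" for x
  proof -
    have "\<bar>c\<bar> * norm x \<le> norm (c *\<^sub>R x + v) + norm v"
      using norm_triangle_ineq4[of "c *\<^sub>R x + v" v] by simp
    also have "\<dots> \<le> (1 + norm v) * (1 + norm (c *\<^sub>R x + v))"
      by (simp add: algebra_simps)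
    finally have "norm x \<le> (1 + norm v) / \<bar>c\<bar> * (1 + norm (c *\<^sub>R x + v))"
      using c by (simp add: field_simps)
    moreover have "1 \<le> 1 * (1 + norm (c *\<^sub>R x + v))" by simp
    ultimately show ?thesis unfolding E_def distrib_right by linarith
  qed
  have E0: "E \<ge> 0" by (simp add: E_def)
  have "(1 + norm x) ^ N * norm (iterated_partial bs (\<lambda>x. \<phi> (c *\<^sub>R x + v)) x) \<le> E ^ N * \<bar>c\<bar> ^ length bs * B" for x
  proof -
    let ?z = "c *\<^sub>R x + v"
    have "(1 + norm x) ^ N * norm (iterated_partial bs (\<lambda>x. \<phi> (c *\<^sub>R x + v)) x) =
       (1 + norm x) ^ N * (\<bar>c\<bar> ^ length bs * norm (iterated_partial bs \<phi> ?z))"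
      by (simp add: iterated_partial_affine \<phi> schwartz_smooth bs norm_mult norm_power)
    also have "\<dots> \<le> (E * (1 + norm ?z)) ^ N * (\<bar>c\<bar> ^ length bs * norm (iterated_partial bs \<phi> ?z))"
      by (intro mult_right_mono power_mono E) auto
    also have "\<dots> = E ^ N * \<bar>c\<bar> ^ length bs * ((1 + norm ?z) ^ N * norm (iterated_partial bs \<phi> ?z))"
      by (simp add: power_mult_distrib mult_ac)
    also have "\<dots> \<le> E ^ N * \<bar>c\<bar> ^ length bs * B"
      using E0 by (intro mult_left_mono B) auto
    finally show ?thesis .
  qed
  then show "\<exists>B. \<forall>x. (1 + norm x) ^ N * norm (iterated_partial bs (\<lambda>x. \<phi> (c *\<^sub>R x + v)) x) \<le> B" by blast
qed

lemma test_schwartz: "\<phi> \<in> test_functions \<Longrightarrow> \<phi> \<in> schwartz"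
proof (erule schwartz_coinduct)
  fix \<phi> :: "'a \<Rightarrow> complex" and x N b assume \<phi>: "\<phi> \<in> test_functions"
  show "\<phi> differentiable at x" using \<phi> by (intro smooth_differentiable test_smooth)
  show "partial b \<phi> \<in> test_functions" if "b \<in> Basis" using \<phi> that by (rule test_partial)
  obtain B where B: "B > 0" "\<And>x. norm (\<phi> x) \<le> B" using test_bounded[OF \<phi>] by blast
  obtain R where R: "\<And>x. x \<in> fun_support \<phi> \<Longrightarrow> norm x \<le> R"
    using compact_imp_bounded[OF test_compact[OF \<phi>]] unfolding bounded_iff by blast
  have "(1 + norm x) ^ N * norm (\<phi> x) \<le> (1 + \<bar>R\<bar>) ^ N * B" for x
  proof (cases "x \<in> fun_support \<phi>")
    case True
    then show ?thesis using R[of x] B by (intro mult_mono power_mono) auto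
  next
    case False
    then show ?thesis using B by (simp add: fun_support_cong_zero)
  qed
  then show "\<exists>B. \<forall>x. (1 + norm x) ^ N * norm (\<phi> x) \<le> B" by blast
qed

text \<open>\<open>DIM('a) + 1\<close> powers of decay suffice, by \<open>nn_integral_decay\<close>
  at scale \<open>\<kappa> = 1\<close>.\<close>

lemma schwartz_integrable:
  fixes \<phi> :: "'a::euclidean_space \<Rightarrow> complex"
  assumes "\<phi> \<in> schwartz"
  shows "integrable lborel \<phi>"
proof (rule integrableI_bounded)
  show "\<phi> \<in> borel_measurable lborel"
    using smooth_measurable[OF schwartz_smooth[OF assms]] by simp
  obtain B where B: "\<And>x. (1 + norm x) ^ (DIM('a) + 1) * norm (\<phi> x) \<le> B"
    using schwartz_bound[OF assms, of "[]" "DIM('a) + 1"] by auto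
  have "norm (\<phi> 0) \<le> B" using B[of 0] by simp
  then have B0: "B \<ge> 0" using norm_ge_zero order_trans by blast
  have "norm (\<phi> w) \<le> B * (1 + 1 * norm (0 - w)) powr (- (real DIM('a) + 1))" for w
  proof -
    have "(1 + norm w) powr (real DIM('a) + 1) = (1 + norm w) ^ (DIM('a) + 1)"
      by (subst powr_realpow[symmetric]) (auto simp: add_pos_nonneg add.commute)
    moreover have "(1 + norm w) ^ (DIM('a) + 1) > 0" by (intro zero_less_power) (simp add: add_pos_nonneg)
    ultimately show ?thesis using B[of w]
      by (simp only: powr_minus) (simp add: field_simps)
  qed
  then have "(\<integral>\<^sup>+w. ennreal (norm (\<phi> w)) \<partial>lborel) \<le>
     (\<integral>\<^sup>+w. ennreal B * ennreal ((1 + 1 * norm (0 - w)) powr (- (real DIM('a) + 1))) \<partial>(lborel :: 'a measure))"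
    using B0 by (intro nn_integral_mono) (simp add: ennreal_leI flip: ennreal_mult')
  also have "\<dots> = ennreal B * (\<integral>\<^sup>+w. ennreal ((1 + 1 * norm (0 - w)) powr (- (real DIM('a) + 1))) \<partial>(lborel :: 'a measure))"
    by (subst nn_integral_cmult) auto
  also have "\<dots> \<le> ennreal B * ennreal (2 ^ (2 * DIM('a) + 2))"
    using nn_integral_decay[of 1 "0::'a"] by (intro mult_left_mono) (auto simp del: powr_minus)
  also have "\<dots> < \<infinity>" by (simp add: ennreal_mult_less_top)
  finally show "(\<integral>\<^sup>+w. ennreal (norm (\<phi> w)) \<partial>lborel) < \<infinity>" .
qed

text \<open>\<open>K\<close> may depend on the seminorm, and each seminorm is controlled only
  eventually. This suits \<open>tempered_translates_growth\<close>, where a weight of order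
  \<open>N\<close> is under control from \<open>n = N\<close> on.\<close>

lemma tempered_tendsto_0:
  assumes u: "tempered_distribution u" and \<phi>: "\<And>n. \<phi> n \<in> schwartz"
    and bound: "\<And>N bs. set bs \<subseteq> Basis \<Longrightarrow> \<exists>K. \<forall>\<^sub>F n in sequentially. \<forall>x.
        (1 + norm x) ^ N * norm (iterated_partial bs (\<phi> n) x) \<le> K / real (Suc n)"
  shows "(\<lambda>n. u (\<phi> n)) \<longlonglongrightarrow> 0"
proof -
  have "(\<lambda>n. schwartz_seminorm N bs (\<phi> n)) \<longlonglongrightarrow> 0" if bs: "set bs \<subseteq> Basis" for N and bs :: "'a list"
  proof -
    obtain K where K: "\<forall>\<^sub>F n in sequentially. \<forall>x.
        (1 + norm x) ^ N * norm (iterated_partial bs (\<phi> n) x) \<le> K / real (Suc n)"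
      using bound[OF bs] by blast
    show ?thesis
    proof (rule tendsto_sandwich[OF _ _ tendsto_const])
      show "\<forall>\<^sub>F n in sequentially. 0 \<le> schwartz_seminorm N bs (\<phi> n)"
      proof (rule always_eventually, rule allI)
        fix n
        have "bdd_above (range (schwartz_weight N bs (\<phi> n)))"
          using \<phi>[of n] bs by (auto simp: schwartz_def)
        then have "schwartz_weight N bs (\<phi> n) 0 \<le> schwartz_seminorm N bs (\<phi> n)"
          unfolding schwartz_seminorm_def by (intro cSUP_upper) auto
        then show "0 \<le> schwartz_seminorm N bs (\<phi> n)"
          by (rule order_trans[rotated]) (simp add: schwartz_weight_def)
      qed
      show "\<forall>\<^sub>F n in sequentially. schwartz_seminorm N bs (\<phi> n) \<le> K / real (Suc n)"
        using K by eventually_elim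
          (auto simp: schwartz_seminorm_def schwartz_weight_def intro!: cSUP_least)
      show "(\<lambda>n. K / real (Suc n)) \<longlonglongrightarrow> 0"
        using tendsto_mult_right_zero[OF LIMSEQ_inverse_real_of_nat, of K] by (simp add: divide_inverse)
    qed
  qed
  then show ?thesis using u \<phi> unfolding tempered_distribution_def by blast
qed

text \<open>Continuity is given sequentially, so no finite set of controlling seminorms is at hand.
  If no single \<open>M\<close> worked as both factor and exponent, translates violating the bound
  for \<open>M = Suc n\<close>, divided by that bound, would tend to \<open>0\<close> in the
  Schwartz space although \<open>u\<close> exceeds \<open>1\<close> in modulus on them.\<close>

lemma tempered_translates_growth:
  assumes u: "tempered_distribution u" and \<theta>: "\<theta> \<in> schwartz"
  shows "\<exists>M::nat. \<forall>x. norm (u (\<lambda>y. \<theta> (y - x))) \<le> real M * (1 + norm x) ^ M"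
proof (rule ccontr)
  assume "\<not> ?thesis"
  then have "\<forall>n. \<exists>x. norm (u (\<lambda>y. \<theta> (y - x))) > real (Suc n) * (1 + norm x) ^ Suc n"
    by (metis not_le)
  then obtain X where X: "\<And>n. norm (u (\<lambda>y. \<theta> (y - X n))) > real (Suc n) * (1 + norm (X n)) ^ Suc n"
    by metis
  define c where "c n = 1 / (real (Suc n) * (1 + norm (X n)) ^ Suc n)" for n
  have c0: "c n > 0" for n by (simp add: c_def add_pos_nonneg del: of_nat_Suc)
  define \<phi> where "\<phi> n y = of_real (c n) * \<theta> (1 *\<^sub>R y + (- X n))" for n y
  have t: "(\<lambda>y. \<theta> (1 *\<^sub>R y + (- X n))) \<in> schwartz" for n
    using \<theta> by (intro schwartz_affine) auto
  have \<phi>s: "\<phi> n \<in> schwartz" for n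
    unfolding \<phi>_def[abs_def] by (intro schwartz_cmult t)
  have "(\<lambda>n. u (\<phi> n)) \<longlonglongrightarrow> 0"
  proof (rule tempered_tendsto_0[OF u \<phi>s])
    fix N and bs :: "'a list" assume bs: "set bs \<subseteq> Basis"
    obtain B where B: "\<And>x. (1 + norm x) ^ N * norm (iterated_partial bs \<theta> x) \<le> B"
      using schwartz_bound[OF \<theta> bs] by blast
    have "norm (iterated_partial bs \<theta> 0) \<le> B" using B[of 0] by simp
    then have B0: "B \<ge> 0" using norm_ge_zero order_trans by blast
    have "(1 + norm y) ^ N * norm (iterated_partial bs (\<phi> n) y) \<le> B / real (Suc n)" if n: "n \<ge> N" for n y
    proof -
      let ?z = "y - X n" and ?D = "norm (iterated_partial bs \<theta> (y - X n))"
      have "iterated_partial bs (\<phi> n) y = of_real (c n) * iterated_partial bs \<theta> ?z"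
        unfolding \<phi>_def[abs_def]
        by (subst iterated_partial_cmult[OF schwartz_smooth[OF t] bs], subst iterated_partial_affine[OF schwartz_smooth[OF \<theta>] bs]) simp
      then have eq: "(1 + norm y) ^ N * norm (iterated_partial bs (\<phi> n) y) = c n * ((1 + norm y) ^ N * ?D)"
        using c0[of n] by (simp add: norm_mult)
      \<comment> \<open>Translation by \<open>X n\<close> costs a factor
        \<open>(1 + |X n|)^N\<close>, which the normalisation with exponent \<open>Suc n\<close>
        beats as soon as \<open>n \<ge> N\<close>.\<close>
      have "1 + norm y \<le> (1 + norm (X n)) * (1 + norm ?z)"
        using peetre_weight_submultiplicative[of 1 "X n" "X n - y" "0"]
          peetre_weight_submultiplicative[of 1 y ?z 0] by simp
      then have "(1 + norm y) ^ N \<le> (1 + norm (X n)) ^ N * (1 + norm ?z) ^ N"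
        unfolding power_mult_distrib[symmetric] by (intro power_mono) auto
      then have "(1 + norm y) ^ N * ?D \<le> (1 + norm (X n)) ^ N * ((1 + norm ?z) ^ N * ?D)"
        unfolding mult.assoc[symmetric] by (rule mult_right_mono) simp
      also have "\<dots> \<le> (1 + norm (X n)) ^ N * B"
        by (intro mult_left_mono B) auto
      also have "\<dots> \<le> (1 + norm (X n)) ^ Suc n * B"
        using n B0 by (intro mult_right_mono power_increasing) auto
      finally have "c n * ((1 + norm y) ^ N * ?D) \<le> c n * ((1 + norm (X n)) ^ Suc n * B)"
        using c0[of n] by (intro mult_left_mono) auto
      also have "\<dots> = B / real (Suc n)"
      proof -
        have "(1 + norm (X n)) ^ Suc n \<noteq> 0"
          by (metis add_pos_nonneg norm_ge_zero power_not_zero less_irrefl zero_less_one)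
        then show ?thesis unfolding c_def by (simp only: mult_eq_0_iff divide_simps) (simp add: mult_ac)
      qed
      finally show ?thesis unfolding eq .
    qed
    then show "\<exists>K. \<forall>\<^sub>F n in sequentially. \<forall>x. (1 + norm x) ^ N * norm (iterated_partial bs (\<phi> n) x) \<le> K / real (Suc n)"
      unfolding eventually_sequentially by blast
  qed
  then have "\<forall>\<^sub>F n in sequentially. norm (u (\<phi> n)) < 1"
    using tendsto_norm_zero order_tendstoD(2) zero_less_one by blast
  then obtain n where n: "norm (u (\<phi> n)) < 1" using eventually_happens by force
  have "u (\<lambda>x. a * \<psi> x) = a * u \<psi>" if "\<psi> \<in> schwartz" for a \<psi>
    using u that unfolding tempered_distribution_def by blast
  from this[OF t] have "u (\<phi> n) = of_real (c n) * u (\<lambda>y. \<theta> (1 *\<^sub>R y + (- X n)))"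
    unfolding \<phi>_def[abs_def] .
  then have "norm (u (\<phi> n)) = c n * norm (u (\<lambda>y. \<theta> (y - X n)))"
    using c0[of n] by (simp add: norm_mult)
  also have "\<dots> > c n * (real (Suc n) * (1 + norm (X n)) ^ Suc n)"
    using X c0[of n] by (intro mult_strict_left_mono) auto
  also have "c n * (real (Suc n) * (1 + norm (X n)) ^ Suc n) = 1"
    using c0[of n] unfolding c_def by auto
  finally show False using n by simp
qed

section \<open>The reproducing formula\<close>

lemma integral_affine_lborel:
  fixes f :: "'a::euclidean_space \<Rightarrow> complex"
  assumes [measurable]: "f \<in> borel_measurable borel" and c: "c \<noteq> 0"
  shows "(\<integral>x. f x \<partial>lborel) = of_real (\<bar>c\<bar> ^ DIM('a)) * (\<integral>x. f (t + c *\<^sub>R x) \<partial>lborel)"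
  by (subst lborel_affine[OF c, of t])
    (simp add: integral_density integral_distr scaleR_conv_of_real)

text \<open>The character at \<open>x\<close> times a dilated cutoff; its Fourier transform is a
  kernel of width \<open>1/R\<close> centred at \<open>x\<close>. The summand \<open>0\<close> fits
  the shape of the affine lemmas.\<close>

definition bandpass :: "real \<Rightarrow> 'a::euclidean_space \<Rightarrow> 'a \<Rightarrow> complex" where
  "bandpass R x = (\<lambda>\<xi>. exp (2 * of_real pi * \<i> * of_real (\<xi> \<bullet> x)) * bump ((1 / R) *\<^sub>R \<xi> + 0))"

lemma bandpass_test: "R > 0 \<Longrightarrow> bandpass R x \<in> test_functions"
  unfolding bandpass_def by (intro test_mult smooth_character test_affine test_bump) auto

lemma fourier_bandpass:
  fixes x :: "'a::euclidean_space"
  assumes R: "R > 0"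
  shows "fourier (bandpass R x) = (\<lambda>y. of_real (R ^ DIM('a)) * fourier bump (R *\<^sub>R y + - (R *\<^sub>R x)))"
proof
  fix y
  let ?g = "\<lambda>\<xi>. bandpass R x \<xi> * exp (- 2 * of_real pi * \<i> * of_real (\<xi> \<bullet> y))"
  have [measurable]: "bandpass R x \<in> borel_measurable borel"
    by (intro smooth_measurable test_smooth bandpass_test R)
  have "fourier (bandpass R x) y = of_real (\<bar>R\<bar> ^ DIM('a)) * (\<integral>\<xi>. ?g (0 + R *\<^sub>R \<xi>) \<partial>lborel)"
    unfolding fourier_def using R by (intro integral_affine_lborel) auto
  also have "(\<integral>\<xi>. ?g (0 + R *\<^sub>R \<xi>) \<partial>lborel) = fourier bump (R *\<^sub>R y + - (R *\<^sub>R x))"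
    unfolding fourier_def
  proof (rule Bochner_Integration.integral_cong[OF refl])
    fix \<xi>
    have "exp (2 * of_real pi * \<i> * of_real ((R *\<^sub>R \<xi>) \<bullet> x)) * exp (- 2 * of_real pi * \<i> * of_real ((R *\<^sub>R \<xi>) \<bullet> y)) =
      exp (- 2 * of_real pi * \<i> * of_real (\<xi> \<bullet> (R *\<^sub>R y + - (R *\<^sub>R x))))"
      unfolding exp_add[symmetric] by (simp add: inner_diff_right algebra_simps)
    then show "?g (0 + R *\<^sub>R \<xi>) = bump \<xi> * exp (- 2 * of_real pi * \<i> * of_real (\<xi> \<bullet> (R *\<^sub>R y + - (R *\<^sub>R x))))"
      using R by (simp add: bandpass_def mult_ac)
  qed
  finally show "fourier (bandpass R x) y = of_real (R ^ DIM('a)) * fourier bump (R *\<^sub>R y + - (R *\<^sub>R x))"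
    using R by simp
qed

text \<open>Both cutoffs equal \<open>1\<close> where \<open>norm \<xi> < R\<close>, so the
  difference is supported in \<open>norm \<xi> \<ge> R\<close>. The strict inequality
  \<open>B < R\<close> separates this closed set from the spectrum.\<close>

lemma tempered_bandpass_eq:
  assumes u: "tempered_distribution u" and supp: "dist_support (dist_fourier u) \<subseteq> cball 0 B"
    and R: "0 < R" "B < R" "R \<le> S"
  shows "u (fourier (bandpass S x)) = u (fourier (bandpass R x))"
proof -
  define D where "D = (\<lambda>\<xi>. bandpass S x \<xi> + (- 1) * bandpass R x \<xi>)"
  have t: "D \<in> test_functions" unfolding D_def
    using R by (intro test_add test_mult smooth_const bandpass_test) auto
  have "fun_support D \<subseteq> {\<xi>. R \<le> norm \<xi>}"
  proof (rule fun_support_subset)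
    show "closed {\<xi>::'a. R \<le> norm \<xi>}" by (intro closed_Collect_le continuous_intros)
    fix \<xi> :: 'a assume "\<xi> \<notin> {\<xi>. R \<le> norm \<xi>}"
    then have "norm ((1 / R) *\<^sub>R \<xi>) \<le> 1" "norm ((1 / S) *\<^sub>R \<xi>) \<le> 1"
      using R by (auto simp: divide_le_eq)
    then show "D \<xi> = 0" by (simp add: D_def bandpass_def bump_eq_1)
  qed
  then have "fun_support D \<inter> dist_support (dist_fourier u) = {}" using supp R by force
  then have "u (fourier D) = 0" by (rule tempered_fourier_vanishes[OF u t])
  moreover have "bandpass S x = (\<lambda>\<xi>. D \<xi> + bandpass R x \<xi>)" by (simp add: D_def)
  then have "fourier (bandpass S x) = (\<lambda>\<xi>. fourier D \<xi> + fourier (bandpass R x) \<xi>)"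
    using R t by (simp add: fourier_add test_integrable bandpass_test)
  then have "u (fourier (bandpass S x)) = u (fourier D) + u (fourier (bandpass R x))"
    using u R t by (simp add: tempered_distribution_def fourier_test_schwartz bandpass_test)
  ultimately show ?thesis by simp
qed

text \<open>Where \<open>c\<close> is nonzero the dilated argument has norm at least
  \<open>a\<close>, so Schwartz decay beats every power of \<open>a\<close>. Differentiating the
  product either hits \<open>c\<close>, or replaces \<open>\<Psi>\<close> by a derivative and raises
  \<open>j\<close> by one; hence the generalisation over \<open>\<Psi>\<close>, \<open>c\<close> and
  \<open>j\<close>. The disjunction describes the class reached from \<open>1 - \<psi>\<close> by
  differentiation.\<close>

lemma cutoff_dilate_bound:
  fixes x :: "'a::euclidean_space"
  assumes "set bs \<subseteq> Basis" "\<Psi> \<in> schwartz"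
    and "c \<in> test_functions \<or> (\<exists>\<psi>\<in>test_functions. c = (\<lambda>y. 1 + - 1 * \<psi> y))"
    and "\<And>y. y \<in> ball x 1 \<Longrightarrow> c y = 0"
  shows "\<exists>K. \<forall>a\<ge>1. \<forall>y. (1 + norm y) ^ N *
    norm (iterated_partial bs (\<lambda>y. of_real (a ^ j) * \<Psi> (a *\<^sub>R y + - (a *\<^sub>R x)) * c y) y) \<le> K / a"
  using assms
proof (induction bs arbitrary: \<Psi> c j rule: rev_induct)
  case Nil
  \<comment> \<open>\<open>N\<close> powers pay for the weight in \<open>y\<close>, \<open>j\<close>
    for the factor \<open>a ^ j\<close>, and one more for the final \<open>1 / a\<close>.\<close>
  obtain B where B: "\<And>z. (1 + norm z) ^ (N + (j + 1)) * norm (\<Psi> z) \<le> B"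
    using schwartz_bound[OF Nil(2), of "[]" "N + (j + 1)"] by auto
  have "\<exists>Bc. Bc \<ge> 0 \<and> (\<forall>y. norm (c y) \<le> Bc)"
    using Nil(3)
  proof
    assume "c \<in> test_functions"
    then show ?thesis using test_bounded[of c] less_imp_le by blast
  next
    assume "\<exists>\<psi>\<in>test_functions. c = (\<lambda>y. 1 + - 1 * \<psi> y)"
    then obtain \<psi> B where \<psi>: "c = (\<lambda>y. 1 + - 1 * \<psi> y)" "B > 0" "\<And>y. norm (\<psi> y) \<le> B"
      using test_bounded by metis
    have "norm (c y) \<le> 1 + B" for y
      using norm_triangle_ineq4[of 1 "\<psi> y"] \<psi>(3)[of y] by (simp add: \<psi>(1))
    then show ?thesis using \<psi>(2) by (intro exI[of _ "1 + B"]) auto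
  qed
  then obtain Bc where Bc: "Bc \<ge> 0" "\<And>y. norm (c y) \<le> Bc" by blast
  have "norm (\<Psi> 0) \<le> B" using B[of 0] by simp
  then have B0: "B \<ge> 0" using norm_ge_zero order_trans by blast
  have "(1 + norm y) ^ N * norm (of_real (a ^ j) * \<Psi> (a *\<^sub>R y + - (a *\<^sub>R x)) * c y)
     \<le> ((1 + norm x) ^ N * B * Bc) / a" if a: "a \<ge> 1" for a :: real and y
  proof (cases "y \<in> ball x 1")
    case True
    then show ?thesis using Nil(4)[OF True] a B0 Bc by simp
  next
    case False
    define s where "s = norm (y - x)"
    have s: "s \<ge> 1" using False by (simp add: s_def dist_norm norm_minus_commute)
    define z where "z = a *\<^sub>R y + - (a *\<^sub>R x)"
    have z: "norm z = a * s"
      using a by (simp add: z_def s_def flip: scaleR_diff_right)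
    have as: "a \<le> 1 + a * s" "s \<le> a * s"
    proof -
      have "a * 1 \<le> a * s" using a s by (intro mult_left_mono) auto
      then show "a \<le> 1 + a * s" by simp
      have "1 * s \<le> a * s" using a s by (intro mult_right_mono) auto
      then show "s \<le> a * s" by simp
    qed
    have "1 + norm y \<le> (1 + norm x) * (1 + s)"
      using peetre_weight_submultiplicative[of 1 0 y x] by (simp add: s_def norm_minus_commute)
    then have "(1 + norm y) ^ N \<le> ((1 + norm x) * (1 + s)) ^ N" by (intro power_mono) auto
    then have y: "(1 + norm y) ^ N \<le> (1 + norm x) ^ N * (1 + s) ^ N" by (simp add: power_mult_distrib)
    have "(1 + s) ^ N * a ^ (j + 1) * norm (\<Psi> z) \<le> (1 + norm z) ^ N * (1 + norm z) ^ (j + 1) * norm (\<Psi> z)"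
      using a s as unfolding z by (intro mult_right_mono mult_mono power_mono) auto
    also have "\<dots> \<le> B" using B[of z] by (simp only: power_add)
    finally have *: "a * ((1 + s) ^ N * (a ^ j * norm (\<Psi> z))) \<le> B" by (simp add: mult_ac)
    have "(1 + norm y) ^ N * norm (of_real (a ^ j) * \<Psi> z * c y) =
       (1 + norm y) ^ N * (a ^ j * norm (\<Psi> z)) * norm (c y)"
      using a by (simp add: norm_mult norm_power mult_ac)
    also have "\<dots> \<le> ((1 + norm x) ^ N * (1 + s) ^ N) * (a ^ j * norm (\<Psi> z)) * Bc"
      using a Bc s by (intro mult_mono y) auto
    also have "\<dots> = (1 + norm x) ^ N * ((1 + s) ^ N * (a ^ j * norm (\<Psi> z))) * Bc" by (simp add: mult_ac)
    also have "\<dots> \<le> (1 + norm x) ^ N * (B / a) * Bc"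
      using * a Bc by (intro mult_right_mono mult_left_mono) (auto simp: field_simps)
    finally show ?thesis by (simp add: z_def)
  qed
  then show ?case by (intro exI[of _ "(1 + norm x) ^ N * B * Bc"]) auto
next
  case (snoc b bs)
  have b: "b \<in> Basis" and bs: "set bs \<subseteq> Basis" using snoc.prems by auto
  have csm: "smooth c" using snoc.prems(3)
    by (auto intro!: smooth_diff smooth_const dest: test_smooth)
  have ct: "partial b c \<in> test_functions" using snoc.prems(3)
  proof
    assume "c \<in> test_functions" then show ?thesis using b by (rule test_partial)
  next
    assume "\<exists>\<psi>\<in>test_functions. c = (\<lambda>y. 1 + - 1 * \<psi> y)"
    then obtain \<psi> where \<psi>: "\<psi> \<in> test_functions" "c = (\<lambda>y. 1 + - 1 * \<psi> y)" by blast
    have "partial b c = (\<lambda>y. - 1 * partial b \<psi> y)"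
      unfolding \<psi>(2)
      using partial_add[of "\<lambda>_. 1" "\<lambda>y. - 1 * \<psi> y" b] partial_mult[of "\<lambda>_. - 1" \<psi> b]
        smooth_differentiable[OF test_smooth[OF \<psi>(1)]]
        smooth_differentiable[OF smooth_cmult[OF test_smooth[OF \<psi>(1)]], of "- 1"]
      by (simp add: partial_const)
    then show ?thesis using test_mult[OF test_partial[OF \<psi>(1) b] smooth_const, of "- 1"] by simp
  qed
  have c0: "partial b c y = 0" if "y \<in> ball x 1" for y
    by (rule partial_eq_0[OF open_ball that]) (rule snoc.prems(4))
  obtain K1 where K1: "\<And>a y. a \<ge> 1 \<Longrightarrow> (1 + norm y) ^ N *
    norm (iterated_partial bs (\<lambda>y. of_real (a ^ j) * \<Psi> (a *\<^sub>R y + - (a *\<^sub>R x)) * partial b c y) y) \<le> K1 / a"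
    using snoc.IH[OF bs snoc.prems(2) disjI1[OF ct] c0, of j] by blast
  obtain K2 where K2: "\<And>a y. a \<ge> 1 \<Longrightarrow> (1 + norm y) ^ N *
    norm (iterated_partial bs (\<lambda>y. of_real (a ^ Suc j) * partial b \<Psi> (a *\<^sub>R y + - (a *\<^sub>R x)) * c y) y) \<le> K2 / a"
    using snoc.IH[OF bs schwartz_partial[OF snoc.prems(2) b] snoc.prems(3,4), of "Suc j"] by blast
  have "(1 + norm y) ^ N * norm (iterated_partial (bs @ [b]) (\<lambda>y. of_real (a ^ j) * \<Psi> (a *\<^sub>R y + - (a *\<^sub>R x)) * c y) y)
     \<le> (K1 + K2) / a" if a: "a \<ge> 1" for a y
  proof -
    let ?P = "\<lambda>y. of_real (a ^ j) * \<Psi> (a *\<^sub>R y + - (a *\<^sub>R x))"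
    let ?Q = "\<lambda>y. of_real (a ^ Suc j) * partial b \<Psi> (a *\<^sub>R y + - (a *\<^sub>R x))"
    have \<Psi>: "smooth \<Psi>" using snoc.prems(2) by (rule schwartz_smooth)
    have Pa: "smooth (\<lambda>y. \<Psi> (a *\<^sub>R y + - (a *\<^sub>R x)))" by (intro smooth_affine \<Psi>)
    have P: "smooth ?P" by (intro smooth_cmult Pa)
    have Q: "smooth ?Q" by (intro smooth_cmult smooth_affine smooth_partial \<Psi> b)
    have dP: "partial b ?P = ?Q"
      using partial_mult[of "\<lambda>_. of_real (a ^ j)" "\<lambda>y. \<Psi> (a *\<^sub>R y + - (a *\<^sub>R x))" b]
        partial_affine[of \<Psi> b a "- (a *\<^sub>R x)"] smooth_differentiable[OF \<Psi>] smooth_differentiable[OF Pa]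
      by (simp add: partial_const mult_ac)
    have "partial b (\<lambda>y. ?P y * c y) = (\<lambda>y. ?P y * partial b c y + ?Q y * c y)"
      using partial_mult[of ?P c b] smooth_differentiable[OF P] smooth_differentiable[OF csm]
      unfolding dP by simp
    then have "iterated_partial (bs @ [b]) (\<lambda>y. ?P y * c y) y =
      iterated_partial bs (\<lambda>y. ?P y * partial b c y) y + iterated_partial bs (\<lambda>y. ?Q y * c y) y"
      unfolding iterated_partial_snoc
      by (simp only: iterated_partial_add[OF smooth_mult[OF P test_smooth[OF ct]] smooth_mult[OF Q csm] bs])
    then have "(1 + norm y) ^ N * norm (iterated_partial (bs @ [b]) (\<lambda>y. ?P y * c y) y) \<le>
      (1 + norm y) ^ N * (norm (iterated_partial bs (\<lambda>y. ?P y * partial b c y) y) + norm (iterated_partial bs (\<lambda>y. ?Q y * c y) y))"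
      by (intro mult_left_mono) (simp_all add: norm_triangle_ineq)
    also have "\<dots> \<le> K1 / a + K2 / a"
      unfolding distrib_left by (intro add_mono K1 K2 a)
    finally show ?thesis by (simp add: add_divide_distrib)
  qed
  then show ?case by blast
qed

text \<open>The dilates form an approximate identity at \<open>x\<close>, up to the total integral.
  No bound on \<open>f\<close> at infinity is assumed, so the pairing is cut with a bump
  \<open>b\<close> around \<open>x\<close>: the near part is an integral to which dominated
  convergence applies, while the far part tends to \<open>0\<close> in the Schwartz space and is
  handled by continuity of \<open>u\<close>.\<close>

lemma tempered_dilate_tendsto:
  fixes f :: "'a::euclidean_space \<Rightarrow> complex"
  assumes u: "tempered_distribution u" and f: "smooth f" and rep: "represents f u" and \<Psi>: "\<Psi> \<in> schwartz"
  shows "(\<lambda>n. u (\<lambda>y. of_real (real (Suc n) ^ DIM('a)) * \<Psi> (real (Suc n) *\<^sub>R y + - (real (Suc n) *\<^sub>R x))))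
    \<longlonglongrightarrow> f x * (\<integral>y. \<Psi> y \<partial>lborel)"
proof -
  let ?d = "DIM('a)"
  define b where "b y = bump (1 *\<^sub>R y + - x)" for y
  have bt: "b \<in> test_functions" unfolding b_def[abs_def] by (intro test_affine test_bump) auto
  define \<eta> where "\<eta> a y = of_real (a ^ ?d) * \<Psi> (a *\<^sub>R y + - (a *\<^sub>R x))" for a y
  have \<eta>: "\<eta> a \<in> schwartz" if "a \<noteq> 0" for a
    unfolding \<eta>_def[abs_def] using that by (intro schwartz_cmult schwartz_affine \<Psi>)
  have bound: "\<exists>K. \<forall>a\<ge>1. \<forall>y. (1 + norm y) ^ N * norm (iterated_partial bs (\<lambda>y. \<eta> a y * (1 + - 1 * b y)) y) \<le> K / a"
    if "set bs \<subseteq> Basis" for bs N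
    unfolding \<eta>_def
  proof (rule cutoff_dilate_bound[OF that \<Psi> disjI2])
    show "\<exists>\<psi>\<in>test_functions. (\<lambda>y. 1 + - 1 * b y) = (\<lambda>y. 1 + - 1 * \<psi> y)" using bt by blast
    fix y assume "y \<in> ball x 1"
    then have "b y = 1" unfolding b_def by (intro bump_eq_1) (simp add: dist_norm norm_minus_commute)
    then show "1 + - 1 * b y = 0" by simp
  qed
  have c: "(\<lambda>y. \<eta> a y * (1 + - 1 * b y)) \<in> schwartz" if "a \<ge> 1" for a
  proof (rule schwartzI)
    show "smooth (\<lambda>y. \<eta> a y * (1 + - 1 * b y))"
      using that by (intro smooth_mult smooth_add smooth_const schwartz_smooth[OF \<eta>] test_smooth[OF bt]) auto
    show "\<exists>B. \<forall>y. (1 + norm y) ^ N * norm (iterated_partial bs (\<lambda>y. \<eta> a y * (1 + - 1 * b y)) y) \<le> B"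
      if "set bs \<subseteq> Basis" for N bs
      using bound[OF that, of N] \<open>a \<ge> 1\<close> by blast
  qed
  have d: "(\<lambda>y. \<eta> a y * b y) \<in> test_functions" if "a \<noteq> 0" for a
    by (intro test_mult bt schwartz_smooth \<eta> that)
  have "(\<lambda>n. u (\<lambda>y. \<eta> (real (Suc n)) y * (1 + - 1 * b y))) \<longlonglongrightarrow> 0"
  proof (rule tempered_tendsto_0[OF u])
    show "(\<lambda>y. \<eta> (real (Suc n)) y * (1 + - 1 * b y)) \<in> schwartz" for n by (rule c) simp
    fix N and bs :: "'a list" assume "set bs \<subseteq> Basis"
    from bound[OF this, of N] obtain K where K: "\<And>a y. a \<ge> 1 \<Longrightarrow>
      (1 + norm y) ^ N * norm (iterated_partial bs (\<lambda>y. \<eta> a y * (1 + - 1 * b y)) y) \<le> K / a" by blast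
    show "\<exists>K. \<forall>\<^sub>F n in sequentially. \<forall>y. (1 + norm y) ^ N *
      norm (iterated_partial bs (\<lambda>y. \<eta> (real (Suc n)) y * (1 + - 1 * b y)) y) \<le> K / real (Suc n)"
      by (intro exI[of _ K] always_eventually allI K) simp
  qed
  moreover have "(\<lambda>n. u (\<lambda>y. \<eta> (real (Suc n)) y * b y)) \<longlonglongrightarrow> f x * (\<integral>y. \<Psi> y \<partial>lborel)"
  proof -
    have fb: "(\<lambda>y. f y * b y) \<in> test_functions" by (intro test_mult bt f)
    have [measurable]: "f \<in> borel_measurable borel" "b \<in> borel_measurable borel" "\<Psi> \<in> borel_measurable borel"
      by (intro smooth_measurable f test_smooth bt schwartz_smooth \<Psi>)+
    obtain B where B: "B > 0" "\<And>y. norm (f y * b y) \<le> B" using test_bounded[OF fb] by blast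
    define q where "q n z = (f (x + (1 / real (Suc n)) *\<^sub>R z) * b (x + (1 / real (Suc n)) *\<^sub>R z)) * \<Psi> z" for n z
    have "u (\<lambda>y. \<eta> (real (Suc n)) y * b y) = (\<integral>z. q n z \<partial>lborel)" for n
    proof -
      let ?a = "real (Suc n)"
      have a: "?a \<noteq> 0" "?a > 0" by auto
      have "u (\<lambda>y. \<eta> ?a y * b y) = (\<integral>y. f y * (\<eta> ?a y * b y) \<partial>lborel)"
        using rep test_schwartz[OF d[OF a(1)]] unfolding represents_def by blast
      \<comment> \<open>The substitution \<open>y = x + z / a\<close> cancels \<open>a ^ d\<close>
        and leaves the fixed function \<open>\<Psi>\<close> as a dominating weight.\<close>
      also have "\<dots> = of_real (\<bar>1 / ?a\<bar> ^ ?d) * (\<integral>z. f (x + (1 / ?a) *\<^sub>R z) * (\<eta> ?a (x + (1 / ?a) *\<^sub>R z) * b (x + (1 / ?a) *\<^sub>R z)) \<partial>lborel)"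
        using a unfolding \<eta>_def by (intro integral_affine_lborel) auto
      also have "\<dots> = of_real (\<bar>1 / ?a\<bar> ^ ?d) * (\<integral>z. of_real (?a ^ ?d) * q n z \<partial>lborel)"
      proof -
        have "?a *\<^sub>R (x + (1 / ?a) *\<^sub>R z) + - (?a *\<^sub>R x) = z" for z
          using a by (simp add: scaleR_add_right del: of_nat_Suc)
        then show ?thesis by (simp only: q_def \<eta>_def mult_ac)
      qed
      also have "\<dots> = (\<integral>z. q n z \<partial>lborel)"
      proof -
        have "\<bar>1 / ?a\<bar> ^ ?d * ?a ^ ?d = 1"
          using a unfolding power_mult_distrib[symmetric] by simp
        then show ?thesis
          by (simp only: integral_mult_right_zero mult.assoc[symmetric] of_real_mult[symmetric]) simp
      qed
      finally show ?thesis .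
    qed
    moreover have "(\<lambda>n. \<integral>z. q n z \<partial>lborel) \<longlonglongrightarrow> (\<integral>z. (f x * b x) * \<Psi> z \<partial>lborel)"
    proof (rule integral_dominated_convergence)
      show "integrable lborel (\<lambda>z. B * norm (\<Psi> z))"
        by (intro integrable_mult_right integrable_norm schwartz_integrable \<Psi>)
      show "AE z in lborel. (\<lambda>n. q n z) \<longlonglongrightarrow> (f x * b x) * \<Psi> z"
      proof (rule AE_I2)
        fix z
        have "(\<lambda>n. x + (1 / real (Suc n)) *\<^sub>R z) \<longlonglongrightarrow> x + 0 *\<^sub>R z"
          using LIMSEQ_inverse_real_of_nat by (intro tendsto_intros) (simp add: inverse_eq_divide)
        moreover have "isCont (\<lambda>y. f y * b y) x"
          using smooth_continuous[OF test_smooth[OF fb], of UNIV] by (simp add: continuous_on_eq_continuous_at)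
        ultimately have "(\<lambda>n. (\<lambda>y. f y * b y) (x + (1 / real (Suc n)) *\<^sub>R z)) \<longlonglongrightarrow> f x * b x"
          by (intro isCont_tendsto_compose[of x "\<lambda>y. f y * b y"]) auto
        then show "(\<lambda>n. q n z) \<longlonglongrightarrow> (f x * b x) * \<Psi> z"
          unfolding q_def by (intro tendsto_mult_right)
      qed
      show "AE z in lborel. norm (q n z) \<le> B * norm (\<Psi> z)" for n
        unfolding q_def norm_mult[of _ "\<Psi> _"] by (intro AE_I2 mult_right_mono B) auto
    qed (simp_all add: q_def[abs_def])
    moreover have "b x = 1" by (simp add: b_def bump_eq_1)
    ultimately show ?thesis by simp
  qed
  ultimately have lim: "(\<lambda>n. u (\<lambda>y. \<eta> (real (Suc n)) y * b y) + u (\<lambda>y. \<eta> (real (Suc n)) y * (1 + - 1 * b y)))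
     \<longlonglongrightarrow> f x * (\<integral>y. \<Psi> y \<partial>lborel) + 0"
    by (intro tendsto_add)
  have "u (\<eta> (real (Suc n))) = u (\<lambda>y. \<eta> (real (Suc n)) y * b y) + u (\<lambda>y. \<eta> (real (Suc n)) y * (1 + - 1 * b y))" for n
  proof -
    let ?a = "real (Suc n)"
    have "u (\<lambda>y. \<eta> ?a y * b y + \<eta> ?a y * (1 + - 1 * b y)) = u (\<lambda>y. \<eta> ?a y * b y) + u (\<lambda>y. \<eta> ?a y * (1 + - 1 * b y))"
      using u test_schwartz[OF d[of ?a]] c[of ?a] unfolding tempered_distribution_def by simp
    moreover have "(\<lambda>y. \<eta> ?a y * b y + \<eta> ?a y * (1 + - 1 * b y)) = \<eta> ?a"
      by (simp add: algebra_simps)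
    ultimately show ?thesis by simp
  qed
  with lim show ?thesis unfolding \<eta>_def[abs_def] by simp
qed

text \<open>All three claims rest on the value of \<open>u\<close> at the kernel. The kernels for
  different \<open>x\<close> are translates of one Schwartz function \<open>\<theta>\<close>, which
  gives the growth bound. The factor next to \<open>f x\<close> is left as it is and shown to be
  nonzero separately.\<close>

theorem band_limited_reproducing:
  fixes f :: "'a::euclidean_space \<Rightarrow> complex"
  assumes f: "f \<in> band_limited \<rho>" and R: "0 < R" "2 * \<rho> < R"
  shows "integrable lborel (\<lambda>y. f y * (of_real (R ^ DIM('a)) * fourier bump (R *\<^sub>R y + - (R *\<^sub>R x))))"
    and "f x * (\<integral>y. fourier bump y \<partial>(lborel :: 'a measure)) =
      (\<integral>y. f y * (of_real (R ^ DIM('a)) * fourier bump (R *\<^sub>R y + - (R *\<^sub>R x))) \<partial>lborel)"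
    and "\<exists>M::nat. \<forall>x. norm (f x * (\<integral>y. fourier bump y \<partial>(lborel :: 'a measure))) \<le> real M * (1 + norm x) ^ M"
proof -
  let ?\<Psi> = "fourier bump :: 'a \<Rightarrow> complex"
  have \<Psi>: "?\<Psi> \<in> schwartz" by (intro fourier_test_schwartz test_bump)
  obtain u where u: "tempered_distribution u" "dist_support (dist_fourier u) \<subseteq> cball 0 (2 * \<rho>)"
    and rep: "represents f u" and sm: "smooth f"
    using f by (auto simp: band_limited_def)
  define \<theta> where "\<theta> = (\<lambda>y. of_real (R ^ DIM('a)) * ?\<Psi> (R *\<^sub>R y + 0))"
  have \<theta>: "\<theta> \<in> schwartz" unfolding \<theta>_def using R by (intro schwartz_cmult schwartz_affine \<Psi>) auto
  have ker: "fourier (bandpass R x) = (\<lambda>y. \<theta> (y - x))" for x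
    unfolding fourier_bandpass[OF R(1)] \<theta>_def by (simp add: scaleR_diff_right)
  have main: "f x * (\<integral>y. ?\<Psi> y \<partial>lborel) = u (fourier (bandpass R x))" for x
  proof (rule LIMSEQ_unique)
    show "(\<lambda>n. u (fourier (bandpass (real (Suc n)) x))) \<longlonglongrightarrow> f x * (\<integral>y. ?\<Psi> y \<partial>lborel)"
      using tempered_dilate_tendsto[OF u(1) sm rep \<Psi>, of x]
      by (subst fourier_bandpass) auto
    obtain n0 where "R \<le> real n0" using real_arch_simple by blast
    then have "\<forall>n\<ge>n0. u (fourier (bandpass (real (Suc n)) x)) = u (fourier (bandpass R x))"
      by (intro allI impI tempered_bandpass_eq[OF u R]) linarith
    then show "(\<lambda>n. u (fourier (bandpass (real (Suc n)) x))) \<longlonglongrightarrow> u (fourier (bandpass R x))"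
      by (intro tendsto_eventually) (auto simp: eventually_sequentially)
  qed
  have "fourier (bandpass R x) \<in> schwartz" by (intro fourier_test_schwartz bandpass_test R)
  then show "integrable lborel (\<lambda>y. f y * (of_real (R ^ DIM('a)) * fourier bump (R *\<^sub>R y + - (R *\<^sub>R x))))"
    and "f x * (\<integral>y. ?\<Psi> y \<partial>lborel) =
      (\<integral>y. f y * (of_real (R ^ DIM('a)) * fourier bump (R *\<^sub>R y + - (R *\<^sub>R x))) \<partial>lborel)"
    using rep main[of x] unfolding represents_def fourier_bandpass[OF R(1)] by auto
  show "\<exists>M::nat. \<forall>x. norm (f x * (\<integral>y. ?\<Psi> y \<partial>lborel)) \<le> real M * (1 + norm x) ^ M"
    unfolding main ker by (rule tempered_translates_growth[OF u(1) \<theta>])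
qed

subsection \<open>The integral of the kernel does not vanish\<close>

lemma fourier_multiplication_formula:
  fixes f g :: "'a::euclidean_space \<Rightarrow> complex"
  assumes f: "integrable lborel f" and g: "integrable lborel g"
  shows "(\<integral>y. fourier f y * g y \<partial>lborel) = (\<integral>x. f x * fourier g x \<partial>lborel)"
proof -
  let ?F = "\<lambda>x y. f x * exp (- 2 * of_real pi * \<i> * of_real (x \<bullet> y)) * g y"
  have [measurable]: "f \<in> borel_measurable borel" "g \<in> borel_measurable borel" using f g by auto
  have norm_F: "norm (?F x y) = norm (f x) * norm (g y)" for x y
    by (simp only: norm_mult norm_character mult_1_right)
  have "integrable (lborel \<Otimes>\<^sub>M lborel) (case_prod ?F)"
  proof (rule lborel_pair.Fubini_integrable)
    show "case_prod ?F \<in> borel_measurable (lborel \<Otimes>\<^sub>M lborel)" by measurable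
    show "integrable lborel (\<lambda>x. \<integral>y. norm (case_prod ?F (x, y)) \<partial>lborel)"
      unfolding prod.case norm_F using f by (simp add: integrable_norm)
    have "integrable lborel (\<lambda>y. ?F x y)" for x
      by (rule Bochner_Integration.integrable_bound[OF integrable_mult_right[OF integrable_norm[OF g], of "norm (f x)"]])
        (measurable, simp only: norm_F, simp)
    then show "AE x in lborel. integrable lborel (\<lambda>y. case_prod ?F (x, y))" by simp
  qed
  then have "(\<integral>y. \<integral>x. ?F x y \<partial>lborel \<partial>lborel) = (\<integral>x. \<integral>y. ?F x y \<partial>lborel \<partial>lborel)"
    by (rule lborel_pair.Fubini_integral)
  moreover have "(\<integral>x. ?F x y \<partial>lborel) = fourier f y * g y" for y
    unfolding fourier_def by simp
  moreover have "(\<integral>y. ?F x y \<partial>lborel) = f x * fourier g x" for x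
    unfolding fourier_def by (subst integral_mult_right_zero[symmetric]) (simp add: inner_commute mult_ac)
  ultimately show ?thesis by (simp only:)
qed

section \<open>Gaussians in several variables\<close>

lemma
  fixes g :: "'a::euclidean_space \<Rightarrow> real \<Rightarrow> complex"
  assumes g: "\<And>b. b \<in> Basis \<Longrightarrow> integrable lborel (g b)"
  shows integrable_prod_Basis: "integrable lborel (\<lambda>x::'a. \<Prod>b\<in>Basis. g b (x \<bullet> b))"
    and integral_prod_Basis:
      "(\<integral>x. (\<Prod>b\<in>Basis. g b (x \<bullet> b)) \<partial>(lborel :: 'a measure)) = (\<Prod>b\<in>Basis. \<integral>t. g b t \<partial>lborel)"
proof -
  interpret product_sigma_finite "\<lambda>_::'a. lborel :: real measure" by standard
  have [measurable]: "b \<in> Basis \<Longrightarrow> g b \<in> borel_measurable borel" for b using g by fastforce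
  have m1: "(\<lambda>f. \<Sum>b\<in>Basis. f b *\<^sub>R b) \<in> (\<Pi>\<^sub>M b\<in>(Basis :: 'a set). lborel) \<rightarrow>\<^sub>M borel" by measurable
  have m2: "(\<lambda>x::'a. \<Prod>b\<in>Basis. g b (x \<bullet> b)) \<in> borel_measurable borel"
    by (intro borel_measurable_prod measurable_compose[OF _ \<open>_ \<Longrightarrow> g _ \<in> borel_measurable borel\<close>]) auto
  have eq: "(\<Prod>b\<in>Basis. g b ((\<Sum>b\<in>Basis. h b *\<^sub>R b) \<bullet> b)) = (\<Prod>b\<in>Basis. g b (h b))" for h :: "'a \<Rightarrow> real"
    by (intro prod.cong refl) (simp add: inner_sum_left_Basis)
  show "integrable lborel (\<lambda>x::'a. \<Prod>b\<in>Basis. g b (x \<bullet> b))"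
    unfolding lborel_eq[where 'a='a] integrable_distr_eq[OF m1 m2] eq
    by (intro product_integrable_prod g) auto
  show "(\<integral>x. (\<Prod>b\<in>Basis. g b (x \<bullet> b)) \<partial>(lborel :: 'a measure)) = (\<Prod>b\<in>Basis. \<integral>t. g b t \<partial>lborel)"
    unfolding lborel_eq[where 'a='a] integral_distr[OF m1 m2] eq
    by (intro product_integral_prod g) auto
qed

text \<open>Normalised to have integral \<open>1\<close>. The product form reduces the Fourier
  transform to the characteristic function of the one-dimensional standard normal
  distribution.\<close>

definition gauss :: "'a::euclidean_space \<Rightarrow> complex" where
  "gauss x = (\<Prod>b\<in>Basis. of_real (std_normal_density (x \<bullet> b)))"

lemma gauss_continuous: "continuous_on UNIV gauss"
  unfolding gauss_def[abs_def] std_normal_density_def by (intro continuous_intros) auto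

lemma gauss_measurable [measurable]: "gauss \<in> borel_measurable borel"
  by (rule borel_measurable_continuous_onI[OF gauss_continuous])

lemma integrable_gauss: "integrable lborel gauss"
  unfolding gauss_def[abs_def] by (intro integrable_prod_Basis integrable_of_real) auto

lemma integral_gauss: "(\<integral>x. gauss x \<partial>(lborel :: 'a::euclidean_space measure)) = 1"
  unfolding gauss_def by (subst integral_prod_Basis) (auto intro: integrable_of_real)

lemma gauss_bounded: "norm (gauss (x::'a::euclidean_space)) \<le> norm (gauss (0::'a))"
  unfolding gauss_def prod_norm[symmetric]
  by (intro prod_mono) (auto simp: std_normal_density_def norm_mult norm_divide intro!: divide_right_mono)

text \<open>Evaluating the characteristic function at \<open>- 2 * pi * s\<close> accounts for the
  Fourier convention, and \<open>sqrt (2 * pi) ^ DIM('a)\<close> undoes the normalisation of the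
  density.\<close>

lemma fourier_gauss:
  fixes \<xi> :: "'a::euclidean_space"
  shows "fourier gauss \<xi> = of_real (sqrt (2 * pi) ^ DIM('a)) * gauss (0 + (2 * pi) *\<^sub>R \<xi>)"
proof -
  let ?g = "\<lambda>b t. of_real (std_normal_density t) * exp (- 2 * of_real pi * \<i> * of_real (t * (\<xi> \<bullet> b)))"
  have one: "(\<integral>t. of_real (std_normal_density t) * exp (- 2 * of_real pi * \<i> * of_real (t * s)) \<partial>lborel) =
     complex_of_real (exp (- (2 * pi * s)\<^sup>2 / 2))" for s
  proof -
    have "complex_of_real (exp (- (- 2 * pi * s)\<^sup>2 / 2)) = char std_normal_distribution (- 2 * pi * s)"
      by (simp only: char_std_normal_distribution)
    also have "\<dots> = (\<integral>t. std_normal_density t *\<^sub>R iexp (- 2 * pi * s * t) \<partial>lborel)"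
      unfolding char_def by (subst integral_density) auto
    also have "\<dots> = (\<integral>t. of_real (std_normal_density t) * exp (- 2 * of_real pi * \<i> * of_real (t * s)) \<partial>lborel)"
      by (simp add: scaleR_conv_of_real mult_ac)
    finally show ?thesis by simp
  qed
  have int: "integrable lborel (?g b)" for b
  proof (rule Bochner_Integration.integrable_bound)
    show "integrable lborel (\<lambda>t. complex_of_real (std_normal_density t))"
      by (intro integrable_of_real integrable_normal_density) simp
    show "?g b \<in> borel_measurable lborel" by measurable
  qed (simp only: norm_mult norm_character, simp)
  have "fourier gauss \<xi> = (\<integral>x. (\<Prod>b\<in>Basis. ?g b (x \<bullet> b)) \<partial>lborel)"
    unfolding fourier_def
  proof (rule Bochner_Integration.integral_cong[OF refl])
    fix x :: 'a
    have "exp (- 2 * of_real pi * \<i> * of_real (x \<bullet> \<xi>)) =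
        (\<Prod>b\<in>Basis. exp (- 2 * of_real pi * \<i> * of_real ((x \<bullet> b) * (\<xi> \<bullet> b))))"
      by (subst euclidean_inner) (simp add: sum_distrib_left exp_sum flip: sum_negf)
    then show "gauss x * exp (- 2 * of_real pi * \<i> * of_real (x \<bullet> \<xi>)) = (\<Prod>b\<in>Basis. ?g b (x \<bullet> b))"
      by (simp only: gauss_def prod.distrib)
  qed
  also have "\<dots> = (\<Prod>b\<in>Basis. complex_of_real (exp (- (2 * pi * (\<xi> \<bullet> b))\<^sup>2 / 2)))"
    by (subst integral_prod_Basis[OF int]) (simp only: one)
  also have "\<dots> = (\<Prod>b\<in>Basis. of_real (sqrt (2 * pi)) * of_real (std_normal_density ((0 + (2 * pi) *\<^sub>R \<xi>) \<bullet> b)))"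
    unfolding of_real_mult[symmetric] by (intro prod.cong refl) (simp add: std_normal_density_def)
  finally show ?thesis by (simp add: gauss_def prod.distrib)
qed

text \<open>Fourier inversion at the single point \<open>0\<close>. The multiplication formula
  equates \<open>L n\<close>, the transform of \<open>bump\<close> against a Gaussian of width
  \<open>Suc n\<close>, with \<open>R n\<close>, which is \<open>bump\<close> against the
  transformed Gaussian after rescaling. In the limit, \<open>gauss 0\<close> times the integral in
  question equals \<open>bump 0 = 1\<close> times the integral of \<open>fourier gauss\<close>,
  which is not \<open>0\<close>.\<close>

lemma integral_fourier_bump_nonzero:
  "(\<integral>y. fourier bump y \<partial>(lborel :: 'a::euclidean_space measure)) \<noteq> 0"
proof
  assume zero: "(\<integral>y. fourier bump y \<partial>(lborel :: 'a measure)) = 0"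
  let ?d = "DIM('a)"
  let ?\<Psi> = "fourier bump :: 'a \<Rightarrow> complex"
  have \<Psi>i: "integrable lborel ?\<Psi>"
    by (intro schwartz_integrable fourier_test_schwartz test_bump)
  have fg: "fourier gauss = (\<lambda>\<xi>::'a. of_real (sqrt (2 * pi) ^ ?d) * gauss (0 + (2 * pi) *\<^sub>R \<xi>))"
    by (rule ext) (rule fourier_gauss)
  have [measurable]: "fourier (gauss :: 'a \<Rightarrow> complex) \<in> borel_measurable borel"
    "(bump :: 'a \<Rightarrow> complex) \<in> borel_measurable borel" "?\<Psi> \<in> borel_measurable borel"
    using smooth_measurable[OF smooth_bump] \<Psi>i unfolding fg by auto
  have "integrable lborel (\<lambda>\<xi>::'a. gauss (0 + (2 * pi) *\<^sub>R \<xi>))"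
  proof (rule integrableI_bounded)
    have "(\<integral>\<^sup>+x. ennreal (norm (gauss (x::'a))) \<partial>lborel) =
      ennreal (\<bar>2 * pi\<bar> ^ ?d) * (\<integral>\<^sup>+\<xi>. ennreal (norm (gauss (0 + (2 * pi) *\<^sub>R \<xi> :: 'a))) \<partial>lborel)"
      by (subst lborel_affine[of "2 * pi" 0]) (simp_all add: nn_integral_density nn_integral_distr nn_integral_cmult)
    moreover have "(\<integral>\<^sup>+x. ennreal (norm (gauss (x::'a))) \<partial>lborel) < \<infinity>"
      using integrable_gauss[where 'a='a] by (simp add: integrable_iff_bounded)
    ultimately show "(\<integral>\<^sup>+\<xi>. ennreal (norm (gauss (0 + (2 * pi) *\<^sub>R \<xi> :: 'a))) \<partial>lborel) < \<infinity>"
      by (auto simp: ennreal_mult_less_top)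
  qed simp
  then have fgi: "integrable lborel (fourier (gauss :: 'a \<Rightarrow> complex))"
    unfolding fg by (intro integrable_mult_right)
  define L where "L n = (\<integral>y. ?\<Psi> y * gauss ((1 / real (Suc n)) *\<^sub>R y) \<partial>lborel)" for n
  define R where "R n = (\<integral>\<xi>. bump ((1 / real (Suc n)) *\<^sub>R \<xi>) * fourier gauss (\<xi> :: 'a) \<partial>lborel)" for n
  have null: "(\<lambda>n. (1 / real (Suc n)) *\<^sub>R y) \<longlonglongrightarrow> 0" for y :: 'a
    using tendsto_scaleR[OF LIMSEQ_inverse_real_of_nat tendsto_const, of y] by (simp add: inverse_eq_divide)
  have LR: "L n = R n" for n
  proof -
    let ?a = "real (Suc n)"
    have a: "?a > 0" by simp
    let ?G = "\<lambda>y::'a. gauss ((1 / ?a) *\<^sub>R y)"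
    have Gi: "integrable lborel ?G"
    proof (rule integrableI_bounded)
      have "(\<integral>\<^sup>+x. ennreal (norm (gauss (x::'a))) \<partial>lborel) =
        ennreal (\<bar>1 / ?a\<bar> ^ ?d) * (\<integral>\<^sup>+\<xi>. ennreal (norm (?G \<xi>)) \<partial>lborel)"
        using a by (subst lborel_affine[of "1 / ?a" 0]) (simp_all add: nn_integral_density nn_integral_distr nn_integral_cmult del: of_nat_Suc)
      moreover have "(\<integral>\<^sup>+x. ennreal (norm (gauss (x::'a))) \<partial>lborel) < \<infinity>"
        using integrable_gauss[where 'a='a] by (simp add: integrable_iff_bounded)
      ultimately show "(\<integral>\<^sup>+\<xi>. ennreal (norm (?G \<xi>)) \<partial>lborel) < \<infinity>"
        using a by (auto simp: ennreal_mult_less_top simp del: of_nat_Suc)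
    qed simp
    have fG: "fourier ?G \<xi> = of_real (?a ^ ?d) * fourier gauss (0 + ?a *\<^sub>R \<xi>)" for \<xi>
    proof -
      let ?h = "\<lambda>y. ?G y * exp (- 2 * of_real pi * \<i> * of_real (y \<bullet> \<xi>))"
      have "fourier ?G \<xi> = of_real (\<bar>?a\<bar> ^ ?d) * (\<integral>y. ?h (0 + ?a *\<^sub>R y) \<partial>lborel)"
        unfolding fourier_def using a by (intro integral_affine_lborel) auto
      also have "(\<lambda>y. ?h (0 + ?a *\<^sub>R y)) = (\<lambda>y. gauss y * exp (- 2 * of_real pi * \<i> * of_real (y \<bullet> (0 + ?a *\<^sub>R \<xi>))))"
        using a by (simp del: of_nat_Suc)
      finally show ?thesis using a by (simp add: fourier_def del: of_nat_Suc)
    qed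
    have "L n = (\<integral>\<xi>. bump \<xi> * fourier ?G \<xi> \<partial>lborel)"
      unfolding L_def by (rule fourier_multiplication_formula[OF test_integrable[OF test_bump] Gi])
    also have "\<dots> = of_real (\<bar>?a\<bar> ^ ?d) * (\<integral>\<xi>. bump ((1 / ?a) *\<^sub>R (0 + ?a *\<^sub>R \<xi>)) * fourier gauss (0 + ?a *\<^sub>R \<xi> :: 'a) \<partial>lborel)"
      unfolding fG integral_mult_right_zero[symmetric] using a
      by (intro Bochner_Integration.integral_cong refl) (simp add: mult_ac del: of_nat_Suc)
    also have "\<dots> = R n"
      unfolding R_def using a by (intro integral_affine_lborel[symmetric]) auto
    finally show ?thesis .
  qed
  have "L \<longlonglongrightarrow> (\<integral>y. ?\<Psi> y * gauss (0::'a) \<partial>lborel)"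
    unfolding L_def
  proof (rule integral_dominated_convergence)
    show "integrable lborel (\<lambda>y. norm (?\<Psi> y) * norm (gauss (0::'a)))"
      by (intro integrable_mult_left integrable_norm \<Psi>i)
    have "isCont gauss (0::'a)"
      using gauss_continuous[where 'a='a] by (simp add: continuous_on_eq_continuous_at)
    then show "AE y in lborel. (\<lambda>n. ?\<Psi> y * gauss ((1 / real (Suc n)) *\<^sub>R y)) \<longlonglongrightarrow> ?\<Psi> y * gauss (0::'a)"
      by (intro AE_I2 tendsto_mult_left isCont_tendsto_compose[of 0 gauss] null)
    show "AE y in lborel. norm (?\<Psi> y * gauss ((1 / real (Suc n)) *\<^sub>R y)) \<le> norm (?\<Psi> y) * norm (gauss (0::'a))" for n
      unfolding norm_mult by (intro AE_I2 mult_left_mono gauss_bounded) auto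
  qed auto
  then have L0: "L \<longlonglongrightarrow> 0" using zero by simp
  obtain B where B: "B > 0" "\<And>x::'a. norm (bump x) \<le> B" using test_bounded[OF test_bump] by blast
  have "R \<longlonglongrightarrow> (\<integral>\<xi>. bump (0::'a) * fourier gauss (\<xi> :: 'a) \<partial>lborel)"
    unfolding R_def
  proof (rule integral_dominated_convergence)
    show "integrable lborel (\<lambda>y. B * norm (fourier gauss (y :: 'a)))"
      by (intro integrable_mult_right integrable_norm fgi)
    have "isCont bump (0::'a)"
      using smooth_continuous[OF smooth_bump[where 'a='a], of UNIV] by (simp add: continuous_on_eq_continuous_at)
    then show "AE \<xi> in lborel. (\<lambda>n. bump ((1 / real (Suc n)) *\<^sub>R \<xi>) * fourier gauss (\<xi> :: 'a)) \<longlonglongrightarrow> bump (0::'a) * fourier gauss \<xi>"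
      by (intro AE_I2 tendsto_mult_right isCont_tendsto_compose[of 0 bump] null)
    show "AE \<xi> in lborel. norm (bump ((1 / real (Suc n)) *\<^sub>R \<xi>) * fourier gauss (\<xi> :: 'a)) \<le> B * norm (fourier gauss \<xi>)" for n
      unfolding norm_mult by (intro AE_I2 mult_right_mono B) auto
  qed auto
  moreover have "R = L" using LR by (simp add: fun_eq_iff)
  ultimately have "(\<integral>\<xi>. bump (0::'a) * fourier gauss (\<xi> :: 'a) \<partial>lborel) = 0"
    using L0 LIMSEQ_unique by blast
  then have "(\<integral>\<xi>. gauss (0 + (2 * pi) *\<^sub>R \<xi> :: 'a) \<partial>lborel) = 0"
    by (simp add: bump_eq_1 fg)
  then show False
    using integral_affine_lborel[of "gauss :: 'a \<Rightarrow> complex" "2 * pi" 0] integral_gauss[where 'a='a] by simp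
qed

section \<open>Peetre's maximal inequality\<close>

text \<open>The constant must serve all \<open>\<kappa>\<close> and \<open>f\<close>. Taking the
  cutoff radius \<open>R\<close> proportional to \<open>\<kappa>\<close> achieves this: the kernel
  decays in \<open>\<kappa> |v - w|\<close>, and its factor \<open>R^d\<close> is a fixed multiple
  of \<open>\<kappa>^d\<close>.\<close>

lemma band_limited_kernel_estimate:
  assumes A: "A > 0"
  shows "\<exists>C>0. \<forall>\<kappa>>0. \<forall>f\<in>band_limited (A * \<kappa>). \<forall>v::'a::euclidean_space.
    ennreal (norm (f v)) \<le> ennreal (C * \<kappa> ^ DIM('a)) *
      (\<integral>\<^sup>+w. ennreal (norm (f w) * (1 + \<kappa> * norm (v - w)) powr (- L)) \<partial>lborel)"
proof -
  let ?d = "DIM('a)"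
  let ?\<Psi> = "fourier bump :: 'a \<Rightarrow> complex"
  define N where "N = nat \<lceil>L\<rceil>"
  \<comment> \<open>\<open>\<nu> > 2 A\<close> makes the kernel reproduce functions with spectrum in
    the ball of radius \<open>2 A \<kappa>\<close>; \<open>\<nu> \<ge> 1\<close> gives
    \<open>R \<ge> \<kappa>\<close>, so that decay in \<open>R |v - w|\<close> implies decay in
    \<open>\<kappa> |v - w|\<close>.\<close>
  define \<nu> where "\<nu> = 2 * A + 1"
  define c where "c = (\<integral>y. ?\<Psi> y \<partial>lborel)"
  have c0: "norm c > 0" using integral_fourier_bump_nonzero[where 'a='a] by (simp add: c_def)
  have N: "L \<le> real N" unfolding N_def by linarith
  have \<nu>: "\<nu> \<ge> 1" using A by (simp add: \<nu>_def)
  obtain B0 where B0: "\<And>z. (1 + norm z) ^ N * norm (?\<Psi> z) \<le> B0"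
    using schwartz_bound[OF fourier_test_schwartz[OF test_bump], of "[]" N] by auto
  define B where "B = max 1 B0"
  have B: "(1 + norm z) ^ N * norm (?\<Psi> z) \<le> B" for z using B0[of z] by (simp add: B_def)
  have Bpos: "B > 0" by (simp add: B_def)
  define C where "C = \<nu> ^ ?d * B / norm c"
  have C0: "C > 0" using \<nu> Bpos c0 by (simp add: C_def)
  have "ennreal (norm (f v)) \<le> ennreal (C * \<kappa> ^ ?d) *
      (\<integral>\<^sup>+w. ennreal (norm (f w) * (1 + \<kappa> * norm (v - w)) powr (- L)) \<partial>lborel)"
    if \<kappa>: "\<kappa> > 0" and f: "f \<in> band_limited (A * \<kappa>)" for \<kappa> f and v :: 'a
  proof -
    define R where "R = \<nu> * \<kappa>"
    have R: "0 < R" "2 * (A * \<kappa>) < R" "\<kappa> \<le> R" using \<kappa> A by (simp_all add: R_def \<nu>_def distrib_right add_pos_pos)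
    have [measurable]: "f \<in> borel_measurable borel"
      using f by (intro smooth_measurable) (simp add: band_limited_def)
    let ?K = "\<lambda>y. of_real (R ^ ?d) * ?\<Psi> (R *\<^sub>R y + - (R *\<^sub>R v))"
    have K: "norm (?K w) \<le> (R ^ ?d * B) * (1 + \<kappa> * norm (v - w)) powr (- L)" for w
    proof -
      define W where "W = 1 + \<kappa> * norm (v - w)"
      have W: "W \<ge> 1" using \<kappa> by (simp add: W_def)
      let ?z = "R *\<^sub>R w + - (R *\<^sub>R v)"
      have "norm ?z = R * norm (v - w)"
        using R by (simp add: norm_minus_commute flip: scaleR_diff_right)
      then have "W \<le> 1 + norm ?z" using R by (simp add: W_def mult_right_mono)
      then have "W ^ N \<le> (1 + norm ?z) ^ N" using W by (intro power_mono) auto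
      then have "W ^ N * norm (?\<Psi> ?z) \<le> B"
        using B[of ?z] mult_right_mono[of "W ^ N" "(1 + norm ?z) ^ N" "norm (?\<Psi> ?z)"] by simp
      moreover have "W ^ N > 0" using W by simp
      ultimately have "norm (?\<Psi> ?z) \<le> B * inverse (W ^ N)"
        by (simp add: field_simps)
      also have "inverse (W ^ N) = W powr (- real N)"
        using W by (simp add: powr_minus powr_realpow)
      also have "B * W powr (- real N) \<le> B * W powr (- L)"
        using W N Bpos by (intro mult_left_mono powr_mono) auto
      finally have "R ^ ?d * norm (?\<Psi> ?z) \<le> R ^ ?d * (B * W powr (- L))"
        using R by (intro mult_left_mono) auto
      then show ?thesis using R by (simp add: norm_mult norm_power W_def mult.assoc)
    qed
    have "ennreal (norm (f v) * norm c) = ennreal (norm (\<integral>y. f y * ?K y \<partial>lborel))"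
      using band_limited_reproducing(2)[OF f R(1,2), of v] by (simp add: c_def norm_mult[symmetric])
    also have "\<dots> \<le> (\<integral>\<^sup>+y. ennreal (norm (f y * ?K y)) \<partial>lborel)"
      by (rule integral_norm_bound_ennreal[OF band_limited_reproducing(1)[OF f R(1,2)]])
    also have "\<dots> \<le> (\<integral>\<^sup>+w. ennreal (R ^ ?d * B) * ennreal (norm (f w) * (1 + \<kappa> * norm (v - w)) powr (- L)) \<partial>lborel)"
    proof (rule nn_integral_mono)
      fix w
      have "norm (f w * ?K w) \<le> norm (f w) * ((R ^ ?d * B) * (1 + \<kappa> * norm (v - w)) powr (- L))"
        unfolding norm_mult[of "f w"] by (intro mult_left_mono K) auto
      then show "ennreal (norm (f w * ?K w)) \<le> ennreal (R ^ ?d * B) * ennreal (norm (f w) * (1 + \<kappa> * norm (v - w)) powr (- L))"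
        using R Bpos by (subst ennreal_mult'[symmetric]) (auto simp: mult_ac intro!: ennreal_leI)
    qed
    also have "\<dots> = ennreal (R ^ ?d * B) * (\<integral>\<^sup>+w. ennreal (norm (f w) * (1 + \<kappa> * norm (v - w)) powr (- L)) \<partial>lborel)"
      by (subst nn_integral_cmult) auto
    finally have "ennreal (1 / norm c) * ennreal (norm (f v) * norm c) \<le>
      ennreal (1 / norm c) * (ennreal (R ^ ?d * B) * (\<integral>\<^sup>+w. ennreal (norm (f w) * (1 + \<kappa> * norm (v - w)) powr (- L)) \<partial>lborel))"
      by (intro mult_left_mono) auto
    moreover have "ennreal (1 / norm c) * ennreal (norm (f v) * norm c) = ennreal (norm (f v))"
      using c0 by (simp flip: ennreal_mult')
    moreover have "ennreal (1 / norm c) * ennreal (R ^ ?d * B) = ennreal (C * \<kappa> ^ ?d)"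
      using c0 by (simp add: C_def R_def power_mult_distrib mult_ac flip: ennreal_mult')
    ultimately show ?thesis by (simp only: mult.assoc[symmetric])
  qed
  with C0 show ?thesis by blast
qed

text \<open>The second supremum bounds the mean by \<open>D (\<kappa> l)^\<epsilon>\<close>. Undoing
  the average multiplies the \<open>t\<close>-th power by \<open>(\<kappa> l)^d\<close>, which
  raises the exponent inside that power by \<open>d/t\<close>, from \<open>\<epsilon>\<close> to
  \<open>d/r\<close>.\<close>

lemma cube_integral_le_cube_maximal:
  fixes f :: "'a::euclidean_space \<Rightarrow> complex"
  defines "d \<equiv> DIM('a)"
  assumes D: "cube_maximal t k (real d * (1 / r - 1 / t)) f x \<le> ennreal D" "D > 0" and t: "t > 0"
    and l: "0 < l" "1 < 2 powi k * l" "x \<in> cube a l"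
  shows "ennreal ((2 powi k) ^ d) * (\<integral>\<^sup>+w\<in>cube a l. ennreal (norm (f w) powr t) \<partial>lborel)
    \<le> ennreal ((D * (2 powi k * l) powr (real d / r)) powr t)"
proof -
  define \<kappa> :: real where "\<kappa> = 2 powi k"
  define \<epsilon> where "\<epsilon> = real d * (1 / r - 1 / t)"
  define I where "I = (\<integral>\<^sup>+w\<in>cube a l. ennreal (norm (f w) powr t) \<partial>lborel)"
  have \<kappa>: "\<kappa> > 0" by (simp add: \<kappa>_def)
  have \<kappa>l: "\<kappa> * l > 1" using l by (simp add: \<kappa>_def)
  have "ennreal ((\<kappa> * l) powr (- \<epsilon>)) * cube_mean t f (cube a l) \<le>
    (SUP (a, l) \<in> {(a, l). 0 < l \<and> 2 powi k * l > 1 \<and> x \<in> cube a l}.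
        ennreal ((2 powi k * l) powr (- \<epsilon>)) * cube_mean t f (cube a l))"
    using l by (intro SUP_upper2[of "(a, l)"]) (auto simp: \<kappa>_def)
  also have "\<dots> \<le> cube_maximal t k \<epsilon> f x"
    unfolding cube_maximal_def by (rule add_increasing) auto
  finally have le: "ennreal ((\<kappa> * l) powr (- \<epsilon>)) * cube_mean t f (cube a l) \<le> ennreal D"
    using D(1) by (simp add: \<epsilon>_def)
  have mean: "cube_mean t f (cube a l) = ennreal_powr (I / ennreal (l ^ d)) (1 / t)"
    using l by (simp add: cube_mean_def I_def emeasure_cube d_def)
  show ?thesis
  proof (cases I)
    \<comment> \<open>An infinite integral would make the mean infinite, contrary to the finite
      bound \<open>D\<close>; \<open>ennreal_powr\<close> keeps \<open>\<infinity>\<close> at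
      \<open>\<infinity>\<close>.\<close>
    case top
    then have "cube_mean t f (cube a l) = \<infinity>"
      unfolding mean by (simp add: ennreal_powr_def ennreal_top_divide)
    then have False using le \<kappa> l by (simp add: ennreal_mult_top top_unique)
    then show ?thesis ..
  next
    case (real i)
    have ld: "l ^ d > 0" using l by simp
    have "cube_mean t f (cube a l) = ennreal ((i / l ^ d) powr (1 / t))"
      unfolding mean real using real ld by (simp add: ennreal_powr_def divide_ennreal)
    then have "(\<kappa> * l) powr (- \<epsilon>) * (i / l ^ d) powr (1 / t) \<le> D"
      using le D(2) by (simp flip: ennreal_mult)
    moreover have "(\<kappa> * l) powr \<epsilon> > 0" using \<kappa> l by simp
    ultimately have "(i / l ^ d) powr (1 / t) \<le> D * (\<kappa> * l) powr \<epsilon>"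
      by (simp add: powr_minus field_simps)
    then have "((i / l ^ d) powr (1 / t)) powr t \<le> (D * (\<kappa> * l) powr \<epsilon>) powr t"
      using t by (intro powr_mono2) auto
    then have "i / l ^ d \<le> (D * (\<kappa> * l) powr \<epsilon>) powr t"
      using t real ld by (simp add: powr_powr)
    then have "(\<kappa> * l) ^ d * (i / l ^ d) \<le> (\<kappa> * l) ^ d * (D * (\<kappa> * l) powr \<epsilon>) powr t"
      using \<kappa>l by (intro mult_left_mono) auto
    moreover have "(\<kappa> * l) ^ d * (i / l ^ d) = \<kappa> ^ d * i"
      using ld l by (simp add: power_mult_distrib)
    moreover have "(\<kappa> * l) ^ d * (D * (\<kappa> * l) powr \<epsilon>) powr t = (D * (\<kappa> * l) powr (real d / r)) powr t"
    proof -
      have "(\<kappa> * l) ^ d = ((\<kappa> * l) powr (real d / t)) powr t"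
        using \<kappa>l t by (simp add: powr_powr powr_realpow)
      then have "(\<kappa> * l) ^ d * (D * (\<kappa> * l) powr \<epsilon>) powr t = (D * ((\<kappa> * l) powr (real d / t) * (\<kappa> * l) powr \<epsilon>)) powr t"
        by (simp add: powr_mult[symmetric] mult_ac)
      also have "(\<kappa> * l) powr (real d / t) * (\<kappa> * l) powr \<epsilon> = (\<kappa> * l) powr (real d / r)"
        unfolding powr_add[symmetric] by (simp add: \<epsilon>_def algebra_simps)
      finally show ?thesis .
    qed
    ultimately have "\<kappa> ^ d * i \<le> (D * (\<kappa> * l) powr (real d / r)) powr t" by simp
    then show ?thesis
      unfolding I_def[symmetric] real \<kappa>_def[symmetric] using \<kappa>
      by (simp add: ennreal_leI flip: ennreal_mult')
  qed
qed

text \<open>The \<open>M\<close> in \<open>growth\<close> does not enter the conclusion: it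
  guarantees that the weighted supremum is finite. It must however go with the same \<open>L\<close>
  as \<open>self\<close>, whose constant \<open>C\<close> does enter, and this is what calls for two
  applications.\<close>

lemma peetre_pointwise_estimate:
  fixes f :: "'a::euclidean_space \<Rightarrow> complex" and x :: 'a
  assumes f: "f \<in> borel_measurable borel"
    and \<kappa>: "\<kappa> > 0" and D: "D > 0" and r: "0 < r" "r < t" and p: "p \<ge> 0" and C: "C > 0"
    and cubes: "\<And>a l. 0 < l \<Longrightarrow> 1 < \<kappa> * l \<Longrightarrow> x \<in> cube a l \<Longrightarrow>
      ennreal (\<kappa> ^ DIM('a)) * (\<integral>\<^sup>+w\<in>cube a l. ennreal (norm (f w) powr t) \<partial>lborel) \<le>
        ennreal ((D * (\<kappa> * l) powr p) powr t)"
    and s: "0 < s" "s \<le> 1" "s \<le> r"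
    and L: "L \<ge> p + 1 + (real DIM('a) + 1) / s"
    and self: "\<And>v. ennreal (norm (f v)) \<le> ennreal (C * \<kappa> ^ DIM('a)) *
      (\<integral>\<^sup>+w. ennreal (norm (f w) * (1 + \<kappa> * norm (v - w)) powr (- L)) \<partial>lborel)"
    and growth: "\<exists>M. \<forall>w. norm (f w) \<le> M * (1 + \<kappa> * norm (z - w)) powr L"
  shows "norm (f z) \<le> (C * (2 ^ (2 * DIM('a) + 2) + 1 / (1 - 2 powr (- r)))) powr (1 / s) *
    2 powr (2 * p + 1) * D * (1 + \<kappa> * norm (x - z)) powr p"
proof -
  define X where "X = 2 powr (2 * p + 1) * D * (1 + \<kappa> * norm (x - z)) powr p"
  define K where "K = 2 ^ (2 * DIM('a) + 2) + 1 / (1 - 2 powr (- r))"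
  have "2 powr (- r) < (1::real)" using r by (simp add: powr_less_one)
  then have K: "K > 0" unfolding K_def by (intro add_pos_pos) auto
  have X: "X \<ge> 0" using D by (simp add: X_def)
  have "0 \<le> (real DIM('a) + 1) / s" using s by simp
  then have L0: "L \<ge> 0" using L p by linarith
  obtain M where M: "\<And>w. norm (f w) \<le> M * (1 + \<kappa> * norm (z - w)) powr L" using growth by blast
  let ?I = "\<integral>\<^sup>+w. ennreal (norm (f w) powr s * (1 + \<kappa> * norm (z - w)) powr (- L * s)) \<partial>lborel"
  have "ennreal (norm (f z) powr s) \<le> ennreal (C * \<kappa> ^ DIM('a)) * ?I"
    using C \<kappa> by (intro powr_le_weighted_integral[OF f \<kappa> _ s(1,2) L0 M self]) auto
  also have "\<dots> = ennreal C * (ennreal (\<kappa> ^ DIM('a)) * ?I)"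
    using C \<kappa> by (simp add: ennreal_mult mult.assoc)
  also have "\<dots> \<le> ennreal C * ennreal (X powr s * K)"
    unfolding X_def K_def using r s
    by (intro mult_left_mono weighted_integral_le_cube_bound[OF f \<kappa> D _ _ r(1) _ p cubes L]) auto
  also have "\<dots> = ennreal (C * (X powr s * K))"
    using C by (simp add: ennreal_mult')
  finally have "norm (f z) powr s \<le> C * (X powr s * K)"
    using C K by (subst (asm) ennreal_le_iff) auto
  then have "(norm (f z) powr s) powr (1 / s) \<le> ((C * K) * X powr s) powr (1 / s)"
    using s by (intro powr_mono2) (auto simp: mult_ac)
  moreover have "(norm (f z) powr s) powr (1 / s) = norm (f z)" using s by (simp add: powr_powr)
  moreover have "((C * K) * X powr s) powr (1 / s) = (C * K) powr (1 / s) * X"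
    using s X unfolding powr_mult by (simp add: powr_powr)
  ultimately show ?thesis by (simp add: X_def K_def mult.assoc)
qed

text \<open>The pointwise estimate is applied twice: first with an exponent \<open>L\<close> so large that the
  polynomial growth of \<open>f\<close> is admissible, which yields growth of order \<open>p\<close>, and then with an
  \<open>L\<close> (hence a constant) that does not depend on \<open>f\<close>.\<close>

lemma band_limited_peetre:
  fixes A r :: real
  assumes A: "A > 0" and r: "r > 0"
  shows "\<exists>C>0. \<forall>t>r. \<forall>k. \<forall>f\<in>band_limited (A * 2 powi k). \<forall>x z::'a::euclidean_space. \<forall>D>0.
    cube_maximal t k (real DIM('a) * (1 / r - 1 / t)) f x \<le> ennreal D \<longrightarrow>
    norm (f z) \<le> C * D * (1 + 2 powi k * norm (x - z)) powr (real DIM('a) / r)"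
proof -
  let ?d = "DIM('a)"
  define s where "s = min 1 r"
  define p where "p = real ?d / r"
  define L0 where "L0 = p + 1 + (real ?d + 1) / s"
  define K where "K = 2 ^ (2 * ?d + 2) + 1 / (1 - 2 powr (- r))"
  have s: "0 < s" "s \<le> 1" "s \<le> r" using r by (auto simp: s_def)
  have p: "p \<ge> 0" using r by (simp add: p_def)
  have pL: "p \<le> L0" using s by (simp add: L0_def)
  have "2 powr (- r) < (1::real)" using r by (simp add: powr_less_one)
  then have K: "K > 0" unfolding K_def by (intro add_pos_pos) auto
  obtain C1 where C1: "C1 > 0" and self1: "\<And>\<kappa> f v. \<kappa> > 0 \<Longrightarrow> f \<in> band_limited (A * \<kappa>) \<Longrightarrow>
    ennreal (norm (f (v::'a))) \<le> ennreal (C1 * \<kappa> ^ ?d) *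
      (\<integral>\<^sup>+w. ennreal (norm (f w) * (1 + \<kappa> * norm (v - w)) powr (- L0)) \<partial>lborel)"
    using band_limited_kernel_estimate[OF A, of L0, where 'a='a] by blast
  define C where "C = (C1 * K) powr (1 / s) * 2 powr (2 * p + 1)"
  have C0: "C > 0" using C1 K by (simp add: C_def)
  have "norm (f z) \<le> C * D * (1 + 2 powi k * norm (x - z)) powr p"
    if t: "t > r" and f: "f \<in> band_limited (A * 2 powi k)" and D: "D > 0"
      and max: "cube_maximal t k (real ?d * (1 / r - 1 / t)) f x \<le> ennreal D"
    for t k f and x z :: 'a and D
  proof -
    define \<kappa> :: real where "\<kappa> = 2 powi k"
    have \<kappa>: "\<kappa> > 0" by (simp add: \<kappa>_def)
    have f: "f \<in> band_limited (A * \<kappa>)" using f by (simp add: \<kappa>_def)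
    have meas: "f \<in> borel_measurable borel"
      using f by (intro smooth_measurable) (simp add: band_limited_def)
    have cubes: "ennreal (\<kappa> ^ ?d) * (\<integral>\<^sup>+w\<in>cube a l. ennreal (norm (f w) powr t) \<partial>lborel) \<le>
        ennreal ((D * (\<kappa> * l) powr p) powr t)" if "0 < l" "1 < \<kappa> * l" "x \<in> cube a l" for a l
      using cube_integral_le_cube_maximal[OF max D _ _ _ that(3)] that t r
      by (simp add: \<kappa>_def p_def)
    have W: "1 + \<kappa> * norm (y - w) \<ge> 1" for y w :: 'a using \<kappa> by simp
    have E: "\<exists>E. \<forall>w. norm (f w) \<le> E * (1 + \<kappa> * norm (x - w)) powr p"
    proof -
      define c where "c = (\<integral>y. fourier bump y \<partial>(lborel :: 'a measure))"
      have c0: "norm c > 0" using integral_fourier_bump_nonzero[where 'a='a] by (simp add: c_def)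
      have "0 < 2 * (A * \<kappa>) + 1" using A \<kappa> by (simp add: add_pos_pos)
      then obtain M :: nat where M: "\<And>y. norm (f y * c) \<le> real M * (1 + norm y) ^ M"
        using band_limited_reproducing(3)[OF f, of "2 * (A * \<kappa>) + 1"] by (auto simp: c_def)
      \<comment> \<open>\<open>M\<close> is the order of growth of the individual \<open>f\<close>,
        so \<open>L\<close> and \<open>C2\<close> depend on \<open>f\<close> too. Only the existence
        of the resulting \<open>E\<close> is kept.\<close>
      define L where "L = max L0 (real M)"
      obtain C2 where C2: "C2 > 0" and self2: "\<And>v. ennreal (norm (f v)) \<le> ennreal (C2 * \<kappa> ^ ?d) *
        (\<integral>\<^sup>+w. ennreal (norm (f w) * (1 + \<kappa> * norm (v - w)) powr (- L)) \<partial>lborel)"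
        using band_limited_kernel_estimate[OF A, of L, where 'a='a] \<kappa> f by blast
      have growth: "\<exists>M. \<forall>w. norm (f w) \<le> M * (1 + \<kappa> * norm (z - w)) powr L" for z
      proof (intro exI allI)
        fix w
        \<comment> \<open>\<open>G\<close> converts the weight of unit scale centred at
          \<open>0\<close> into the one of scale \<open>\<kappa>\<close> centred at
          \<open>z\<close>.\<close>
        define G where "G = (1 + norm z) * (1 + 1 / \<kappa>)"
        have "1 + norm w \<le> (1 + norm z) * (1 + norm (z - w))"
          using peetre_weight_submultiplicative[of 1 0 w z] by simp
        also have "\<dots> \<le> (1 + norm z) * ((1 + 1 / \<kappa>) * (1 + \<kappa> * norm (z - w)))"
        proof (rule mult_left_mono)
          have "0 \<le> 1 / \<kappa> + \<kappa> * norm (z - w)" using \<kappa> by simp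
          then show "1 + norm (z - w) \<le> (1 + 1 / \<kappa>) * (1 + \<kappa> * norm (z - w))"
            using \<kappa> by (simp add: distrib_left distrib_right)
        qed simp
        finally have "(1 + norm w) ^ M \<le> (G * (1 + \<kappa> * norm (z - w))) ^ M"
          by (intro power_mono) (auto simp: G_def mult.assoc)
        also have "\<dots> = G ^ M * (1 + \<kappa> * norm (z - w)) powr (real M)"
          using W[of z w] by (simp add: power_mult_distrib powr_realpow)
        also have "\<dots> \<le> G ^ M * (1 + \<kappa> * norm (z - w)) powr L"
          using W[of z w] \<kappa> by (intro mult_left_mono powr_mono) (auto simp: G_def L_def)
        finally have "real M * (1 + norm w) ^ M \<le> real M * (G ^ M * (1 + \<kappa> * norm (z - w)) powr L)"
          by (intro mult_left_mono) auto
        then have "norm (f w) * norm c \<le> real M * (G ^ M * (1 + \<kappa> * norm (z - w)) powr L)"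
          using M[of w] by (simp add: norm_mult)
        then show "norm (f w) \<le> (real M * ((1 + norm z) * (1 + 1 / \<kappa>)) ^ M / norm c) * (1 + \<kappa> * norm (z - w)) powr L"
          using c0 by (simp add: G_def field_simps)
      qed
      have L: "L \<ge> p + 1 + (real ?d + 1) / s" unfolding L_def L0_def[symmetric] by simp
      show ?thesis
        using peetre_pointwise_estimate[OF meas \<kappa> D r t p C2 cubes s L self2 growth] by blast
    qed
    then obtain E where E: "\<And>w. norm (f w) \<le> E * (1 + \<kappa> * norm (x - w)) powr p" by blast
    have E0: "E \<ge> 0" using order_trans[OF norm_ge_zero E[of x]] by simp
    \<comment> \<open>Growth of order \<open>p\<close> around \<open>x\<close> is growth of order
      \<open>p\<close> around any \<open>z\<close>, by submultiplicativity;
      \<open>p \<le> L0\<close> makes it admissible for the kernel with constant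
      \<open>C1\<close>.\<close>
    have growth: "\<exists>M. \<forall>w. norm (f w) \<le> M * (1 + \<kappa> * norm (z - w)) powr L0" for z
    proof (intro exI allI)
      fix w
      have "norm (f w) \<le> E * (1 + \<kappa> * norm (x - w)) powr p" by (rule E)
      also have "\<dots> \<le> E * ((1 + \<kappa> * norm (x - z)) * (1 + \<kappa> * norm (z - w))) powr p"
        using E0 \<kappa> p W[of x w]
        by (intro mult_left_mono powr_mono2 peetre_weight_submultiplicative) auto
      also have "\<dots> = E * (1 + \<kappa> * norm (x - z)) powr p * (1 + \<kappa> * norm (z - w)) powr p"
        by (simp add: powr_mult)
      also have "\<dots> \<le> E * (1 + \<kappa> * norm (x - z)) powr p * (1 + \<kappa> * norm (z - w)) powr L0"
        using E0 W[of z w] pL by (intro mult_left_mono powr_mono) auto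
      finally show "norm (f w) \<le> (E * (1 + \<kappa> * norm (x - z)) powr p) * (1 + \<kappa> * norm (z - w)) powr L0" .
    qed
    have L: "L0 \<ge> p + 1 + (real ?d + 1) / s" by (simp add: L0_def)
    have "norm (f z) \<le> (C1 * K) powr (1 / s) * 2 powr (2 * p + 1) * D * (1 + \<kappa> * norm (x - z)) powr p"
      unfolding K_def by (rule peetre_pointwise_estimate[OF meas \<kappa> D r t p C1 cubes s L self1[OF \<kappa> f] growth])
    then show ?thesis by (simp add: C_def \<kappa>_def)
  qed
  with C0 show ?thesis unfolding p_def by blast
qed

theorem lemma1p2:
  fixes A r :: real
  assumes "A > 0" and "r > 0"
  shows "\<exists>C::real. C > 0 \<and>
    (\<forall>t. r < t \<longrightarrow>
      (\<forall>f :: int \<Rightarrow> 'a::euclidean_space \<Rightarrow> complex.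
        (\<forall>k. f k \<in> band_limited (A * 2 powi k)) \<longrightarrow>
        (\<forall>k x. peetre (real DIM('a) / r) k (f k) x
               \<le> ennreal C * cube_maximal t k (real DIM('a) * (1 / r - 1 / t)) (f k) x)))"
proof -
  let ?p = "real DIM('a) / r"
  obtain C where C: "C > 0" and bound: "\<And>t k f (x::'a) z D. t > r \<Longrightarrow> f \<in> band_limited (A * 2 powi k) \<Longrightarrow> D > 0 \<Longrightarrow>
    cube_maximal t k (real DIM('a) * (1 / r - 1 / t)) f x \<le> ennreal D \<Longrightarrow>
    norm (f z) \<le> C * D * (1 + 2 powi k * norm (x - z)) powr ?p"
    using band_limited_peetre[OF assms, where 'a='a] by blast
  show ?thesis
  proof (intro exI[of _ C] conjI C allI impI)
    fix t k and f :: "int \<Rightarrow> 'a \<Rightarrow> complex" and x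
    assume t: "r < t" and "\<forall>k. f k \<in> band_limited (A * 2 powi k)"
    then have f: "f k \<in> band_limited (A * 2 powi k)" by blast
    let ?M = "cube_maximal t k (real DIM('a) * (1 / r - 1 / t)) (f k) x"
    show "peetre ?p k (f k) x \<le> ennreal C * ?M"
    proof (cases ?M)
      case top
      then show ?thesis using C by (simp add: ennreal_mult_top)
    next
      case (real m)
      show ?thesis
        unfolding peetre_def
      proof (rule SUP_least)
        fix y
        have "norm (f k (x - y)) / (1 + 2 powi k * norm y) powr ?p \<le> C * m"
        \<comment> \<open>\<open>bound\<close> requires a positive \<open>D\<close>, but the maximal
          function may vanish, so it is applied with \<open>D = m + e / C\<close>. The choice
          \<open>z = x - y\<close> turns \<open>x - z\<close> into \<open>y\<close>.\<close>
        proof (rule field_le_epsilon)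
          fix e :: real assume e: "e > 0"
          have "norm (f k (x - y)) \<le> C * (m + e / C) * (1 + 2 powi k * norm (x - (x - y))) powr ?p"
            using real e C by (intro bound[OF t f]) (auto intro!: ennreal_leI add_nonneg_pos)
          moreover have "C * (m + e / C) = C * m + e" using C by (simp add: distrib_left)
          moreover have "(1 + 2 powi k * norm y) powr ?p > 0"
            by (simp add: add_pos_nonneg less_imp_neq[symmetric])
          ultimately show "norm (f k (x - y)) / (1 + 2 powi k * norm y) powr ?p \<le> C * m + e"
            by (simp add: divide_le_eq)
        qed
        then show "ennreal (norm (f k (x - y)) / (1 + 2 powi k * norm y) powr ?p) \<le> ennreal C * ?M"
          unfolding real(2) using C real(1) by (simp add: ennreal_leI flip: ennreal_mult')
      qed
    qed
  qed
qed

end
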